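(* $\widetilde{\mathcal{E}^f}$ is an $\mathfrak{sl}_2$-algebra, whose $\mathfrak{sl}_2$-triple is $(W,\partial,\delta)$.
   Context: Let $\mathfrak{H}^1=\mathbb{Q}\langle z_k\mid k\ge1\rangle\cong\mathbb{Q}+\mathbb{Q}\langle x,y\rangle y$ (via $z_k=x^{k-1}y$), with harmonic product $\ast$ and shuffle product $\sqcup\!\sqcup$; $\mathfrak{H}^0$ the span of words not starting with $z_1$, $\mathfrak{H}^{\ge2}=\mathbb{Q}\langle z_k\mid k\ge2\rangle$. Let $\varphi(w)=w\ast z_2-w\sqcup\!\sqcup z_2$, $R(u,v)=\varphi(u\ast v)-\varphi(u)\ast v-u\ast\varphi(v)$, $\mathcal{D}:\mathfrak{H}^0\to\mathfrak{H}^{\ge2}$ the Drop1 operator of Hirose–Maesaka–Seki–Watanabe, and $\partial:=-\mathcal{D}\circ\varphi$. Let $\mathsf{DR}_\ast$ be the ideal of $\mathfrak{H}^{\ge2}_\ast$ spanned by $\partial^n(R(u,v))\ast w$ ($n\ge0$, $u,v,w\in\mathfrak{H}^{\ge2}$), and $\widetilde{\mathcal{E}^f}=\mathfrak{H}^{\ge2}_\ast/\mathsf{DR}_\ast$. $W$ multiplies a word $z_{k_1}\cdots z_{k_r}$ by its weight $k_1+\cdots+k_r$, and $\delta$ (the derivation of Bachmann–Ihara–Matthes restricted to $\mathfrak{H}^1$) is $\delta(w)=\big(\tfrac12\mathbf{1}_{w=(yx)u}-\tfrac12\mathbf{1}_{w=(xy)u}+\tfrac14\mathbf{1}_{w=(yy)u}\big)u+\tfrac12\big(\sum_{w=u(yyx)u'}-\sum_{w=u(xyy)u'}\big)uyu'$.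 An $\mathfrak{sl}_2$-triple means derivations with $[W,\partial]=2\partial$, $[W,\delta]=-2\delta$, $[\delta,\partial]=W$. *)

theory Defs
  imports Complex_Main "HOL-Algebra.QuotRing" "HOL-Algebra.Module" "HOL-Library.Poly_Mapping"
begin

definition qscale :: "rat \<Rightarrow> ('a \<Rightarrow>\<^sub>0 rat) \<Rightarrow> ('a \<Rightarrow>\<^sub>0 rat)" where
  "qscale c p = Poly_Mapping.map ((*) c) p"

abbreviation word :: "'a \<Rightarrow> ('a \<Rightarrow>\<^sub>0 rat)" where
  "word w \<equiv> Poly_Mapping.single w 1"

definition lin_ext :: "('a \<Rightarrow> ('b \<Rightarrow>\<^sub>0 rat)) \<Rightarrow> ('a \<Rightarrow>\<^sub>0 rat) \<Rightarrow> ('b \<Rightarrow>\<^sub>0 rat)" where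
  "lin_ext f p = (\<Sum>w\<in>Poly_Mapping.keys p. qscale (Poly_Mapping.lookup p w) (f w))"

definition bilin_ext ::
  "('a \<Rightarrow> 'b \<Rightarrow> ('c \<Rightarrow>\<^sub>0 rat)) \<Rightarrow> ('a \<Rightarrow>\<^sub>0 rat) \<Rightarrow> ('b \<Rightarrow>\<^sub>0 rat) \<Rightarrow> ('c \<Rightarrow>\<^sub>0 rat)" where
  "bilin_ext f p q = lin_ext (\<lambda>u. lin_ext (f u) q) p"

definition rat_ext :: "('a \<Rightarrow> rat) \<Rightarrow> ('a \<Rightarrow>\<^sub>0 rat) \<Rightarrow> rat" where
  "rat_ext f p = (\<Sum>w\<in>Poly_Mapping.keys p. Poly_Mapping.lookup p w * f w)"

definition prepend :: "'a \<Rightarrow> ('a list \<Rightarrow>\<^sub>0 rat) \<Rightarrow> ('a list \<Rightarrow>\<^sub>0 rat)" where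
  "prepend a = lin_ext (\<lambda>w. word (a # w))"

text \<open>The list \<open>[k\<^sub>1, \<dots>, k\<^sub>r]\<close> stands for the word \<open>z\<^bsub>k\<^sub>1\<^esub> \<cdots> z\<^bsub>k\<^sub>r\<^esub>\<close>. Lists containing \<open>0\<close> are
  excluded by the carrier sets below.\<close>

type_synonym zpoly = "nat list \<Rightarrow>\<^sub>0 rat"

definition H1 :: "zpoly set" where
  "H1 = {p. \<forall>ks\<in>Poly_Mapping.keys p. \<forall>k\<in>set ks. k \<ge> 1}"

definition H0 :: "zpoly set" where
  "H0 = {p \<in> H1. \<forall>ks\<in>Poly_Mapping.keys p. ks \<noteq> [] \<longrightarrow> hd ks \<noteq> 1}"

definition Hge2 :: "zpoly set" where
  "Hge2 = {p. \<forall>ks\<in>Poly_Mapping.keys p. \<forall>k\<in>set ks. k \<ge> 2}"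

datatype letter = LX | LY  \<comment> \<open>the letters \<open>x\<close> and \<open>y\<close>, with \<open>z\<^sub>k = x\<^bsup>k - 1\<^esup> y\<close>\<close>

definition xy_word :: "nat list \<Rightarrow> letter list" where
  "xy_word ks = concat (map (\<lambda>k. replicate (k - 1) LX @ [LY]) ks)"

text \<open>Inverse of \<^const>\<open>xy_word\<close> on words that are empty or end in \<open>LY\<close>; the first argument counts
  the letters \<open>LX\<close> read since the last \<open>LY\<close>.\<close>

fun z_word_from :: "nat \<Rightarrow> letter list \<Rightarrow> nat list" where
  "z_word_from c [] = []"
| "z_word_from c (LX # w) = z_word_from (Suc c) w"
| "z_word_from c (LY # w) = Suc c # z_word_from 0 w"

definition z_word :: "letter list \<Rightarrow> nat list" where
  "z_word = z_word_from 0"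

definition to_z :: "(letter list \<Rightarrow>\<^sub>0 rat) \<Rightarrow> zpoly" where
  "to_z = lin_ext (\<lambda>w. word (z_word w))"

fun harmonic_word :: "nat list \<Rightarrow> nat list \<Rightarrow> zpoly" where
  "harmonic_word [] v = word v"
| "harmonic_word u [] = word u"
| "harmonic_word (a # u) (b # v) =
     prepend a (harmonic_word u (b # v)) + prepend b (harmonic_word (a # u) v)
     + prepend (a + b) (harmonic_word u v)"

definition harmonic :: "zpoly \<Rightarrow> zpoly \<Rightarrow> zpoly" (infixl \<open>\<star>\<close> 70) where
  "p \<star> q = bilin_ext harmonic_word p q"

fun shuffle_word :: "letter list \<Rightarrow> letter list \<Rightarrow> (letter list \<Rightarrow>\<^sub>0 rat)" where
  "shuffle_word [] v = word v"
| "shuffle_word u [] = word u"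
| "shuffle_word (a # u) (b # v) =
     prepend a (shuffle_word u (b # v)) + prepend b (shuffle_word (a # u) v)"

definition shuffle :: "zpoly \<Rightarrow> zpoly \<Rightarrow> zpoly" where
  "shuffle p q = bilin_ext (\<lambda>u v. to_z (shuffle_word (xy_word u) (xy_word v))) p q"

definition phi :: "zpoly \<Rightarrow> zpoly" where
  "phi w = w \<star> word [2] - shuffle w (word [2])"

definition R_op :: "zpoly \<Rightarrow> zpoly \<Rightarrow> zpoly" where
  "R_op u v = phi (u \<star> v) - phi u \<star> v - u \<star> phi v"

text \<open>The truncated sum of \<open>1 / (n\<^sub>1\<^bsup>k\<^sub>1\<^esup> \<cdots> n\<^sub>r\<^bsup>k\<^sub>r\<^esup>)\<close> over \<open>N > n\<^sub>1 > \<dots> > n\<^sub>r > 0\<close>.\<close>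

definition zeta_trunc_word :: "nat \<Rightarrow> nat list \<Rightarrow> rat" where
  "zeta_trunc_word N ks =
     (\<Sum>ns\<in>{ns. length ns = length ks \<and> set ns \<subseteq> {1..<N} \<and> sorted_wrt (>) ns}.
        \<Prod>i<length ks. 1 / of_nat (ns ! i) ^ (ks ! i))"

definition zeta_trunc :: "nat \<Rightarrow> zpoly \<Rightarrow> rat" where
  "zeta_trunc N = rat_ext (zeta_trunc_word N)"

text \<open>The modified multiple harmonic sum: a discretised iterated integral, in which each letter
  carries its own summation index \<open>n \<in> {1..<N}\<close>, \<open>LX\<close> contributes \<open>1 / n\<close> and \<open>LY\<close> contributes
  \<open>1 / (N - n)\<close>. Indices weakly decrease along the word, and strictly decrease exactly from a \<open>LY\<close> to
  an immediately following \<open>LX\<close>. If no two \<open>LY\<close> are adjacent, this is the sum in the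
  Maesaka--Seki--Watanabe formula and equals the ordinary truncated sum; in general
  the relation between adjacent \<open>LY\<close>s is weak instead of strict, which makes the sum invariant under
  the duality that reverses the word and exchanges \<open>LX\<close> and \<open>LY\<close>.\<close>

definition zeta_modified_xy :: "nat \<Rightarrow> letter list \<Rightarrow> rat" where
  "zeta_modified_xy N w =
     (\<Sum>ns\<in>{ns. length ns = length w \<and> set ns \<subseteq> {1..<N} \<and>
            (\<forall>i. Suc i < length w \<longrightarrow>
               (if w ! i = LY \<and> w ! Suc i = LX then ns ! Suc i < ns ! i else ns ! Suc i \<le> ns ! i))}.
        \<Prod>i<length w. if w ! i = LX then 1 / of_nat (ns ! i) else 1 / of_nat (N - ns ! i))"

definition zeta_modified :: "nat \<Rightarrow> zpoly \<Rightarrow> rat" where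
  "zeta_modified N = rat_ext (\<lambda>ks. zeta_modified_xy N (xy_word ks))"

text \<open>The modified sum of an element of \<^const>\<open>H0\<close> is, for all \<open>N\<close> simultaneously, the truncated
  sum of exactly one element of \<^const>\<open>Hge2\<close>; Drop1 is the resulting map. For instance it
  sends \<open>z\<^sub>2 z\<^sub>1\<close> to \<open>z\<^sub>3\<close> and \<open>z\<^sub>3 z\<^sub>1\<close> to \<open>z\<^sub>4 - z\<^sub>2 z\<^sub>2\<close>. It is only meaningful on \<^const>\<open>H0\<close>.\<close>

definition drop1 :: "zpoly \<Rightarrow> zpoly" where
  "drop1 w = (THE v. v \<in> Hge2 \<and> (\<forall>N\<ge>1. zeta_trunc N v = zeta_modified N w))"

definition W_op :: "zpoly \<Rightarrow> zpoly" where
  "W_op = lin_ext (\<lambda>ks. qscale (of_nat (sum_list ks)) (word ks))"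

definition partial_op :: "zpoly \<Rightarrow> zpoly" where
  "partial_op w = - drop1 (phi w)"

definition replace_triple :: "letter list \<Rightarrow> letter list \<Rightarrow> (letter list \<Rightarrow>\<^sub>0 rat)" where
  "replace_triple t w =
     (\<Sum>i | i + 3 \<le> length w \<and> take 3 (drop i w) = t. word (take i w @ [LY] @ drop (i + 3) w))"

definition delta_xy :: "letter list \<Rightarrow> (letter list \<Rightarrow>\<^sub>0 rat)" where
  "delta_xy w =
     qscale ((if take 2 w = [LY, LX] then 1 / 2 else 0)
             - (if take 2 w = [LX, LY] then 1 / 2 else 0)
             + (if take 2 w = [LY, LY] then 1 / 4 else 0)) (word (drop 2 w))
     + qscale (1 / 2) (replace_triple [LY, LY, LX] w - replace_triple [LX, LY, LY] w)"

definition delta_op :: "zpoly \<Rightarrow> zpoly" where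
  "delta_op = lin_ext (\<lambda>ks. to_z (delta_xy (xy_word ks)))"

definition is_derivation :: "('k, 'm) ring_scheme \<Rightarrow> ('k, 'a, 'n) module_scheme \<Rightarrow> ('a \<Rightarrow> 'a) \<Rightarrow> bool" where
  "is_derivation K A d \<longleftrightarrow>
     d \<in> carrier A \<rightarrow> carrier A \<and>
     (\<forall>a\<in>carrier A. \<forall>b\<in>carrier A. d (a \<oplus>\<^bsub>A\<^esub> b) = d a \<oplus>\<^bsub>A\<^esub> d b) \<and>
     (\<forall>c\<in>carrier K. \<forall>a\<in>carrier A. d (c \<odot>\<^bsub>A\<^esub> a) = c \<odot>\<^bsub>A\<^esub> d a) \<and>
     (\<forall>a\<in>carrier A. \<forall>b\<in>carrier A. d (a \<otimes>\<^bsub>A\<^esub> b) = d a \<otimes>\<^bsub>A\<^esub> b \<oplus>\<^bsub>A\<^esub> a \<otimes>\<^bsub>A\<^esub> d b)"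

definition commutator :: "('a, 'm) ring_scheme \<Rightarrow> ('a \<Rightarrow> 'a) \<Rightarrow> ('a \<Rightarrow> 'a) \<Rightarrow> 'a \<Rightarrow> 'a" where
  "commutator A f g a = f (g a) \<ominus>\<^bsub>A\<^esub> g (f a)"

definition sl2_triple ::
  "('k, 'm) ring_scheme \<Rightarrow> ('k, 'a, 'n) module_scheme \<Rightarrow> ('a \<Rightarrow> 'a) \<Rightarrow> ('a \<Rightarrow> 'a) \<Rightarrow> ('a \<Rightarrow> 'a) \<Rightarrow> bool" where
  "sl2_triple K A W \<Delta> \<delta> \<longleftrightarrow>
     is_derivation K A W \<and> is_derivation K A \<Delta> \<and> is_derivation K A \<delta> \<and>
     (\<forall>a\<in>carrier A.
        commutator A W \<Delta> a = [(2::nat)] \<cdot>\<^bsub>A\<^esub> \<Delta> a \<and>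
        commutator A W \<delta> a = \<ominus>\<^bsub>A\<^esub> ([(2::nat)] \<cdot>\<^bsub>A\<^esub> \<delta> a) \<and>
        commutator A \<delta> \<Delta> a = W a)"

definition sl2_algebra ::
  "('k, 'm) ring_scheme \<Rightarrow> ('k, 'a, 'n) module_scheme \<Rightarrow> ('a \<Rightarrow> 'a) \<Rightarrow> ('a \<Rightarrow> 'a) \<Rightarrow> ('a \<Rightarrow> 'a) \<Rightarrow> bool" where
  "sl2_algebra K A W \<Delta> \<delta> \<longleftrightarrow> algebra K A \<and> sl2_triple K A W \<Delta> \<delta>"

definition quot_algebra :: "('k, 'a, 'n) module_scheme \<Rightarrow> 'a set \<Rightarrow> ('k, 'a set) module" where
  "quot_algebra A I =
     \<lparr>carrier = carrier (A Quot I), mult = mult (A Quot I), one = one (A Quot I),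
      zero = zero (A Quot I), add = add (A Quot I),
      smult = (\<lambda>c C. \<Union>a\<in>C. I +>\<^bsub>A\<^esub> (c \<odot>\<^bsub>A\<^esub> a))\<rparr>"

definition descends :: "('a, 'm) ring_scheme \<Rightarrow> 'a set \<Rightarrow> ('a \<Rightarrow> 'a) \<Rightarrow> bool" where
  "descends A I f \<longleftrightarrow>
     f \<in> carrier A \<rightarrow> carrier A \<and>
     (\<forall>a\<in>carrier A. \<forall>b\<in>carrier A. a \<ominus>\<^bsub>A\<^esub> b \<in> I \<longrightarrow> f a \<ominus>\<^bsub>A\<^esub> f b \<in> I)"

definition induced :: "('a, 'm) ring_scheme \<Rightarrow> 'a set \<Rightarrow> ('a \<Rightarrow> 'a) \<Rightarrow> 'a set \<Rightarrow> 'a set" where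
  "induced A I f C = (\<Union>a\<in>C. I +>\<^bsub>A\<^esub> f a)"

definition rat_field :: "rat ring" where
  "rat_field = \<lparr>carrier = UNIV, mult = (*), one = 1, zero = 0, add = (+)\<rparr>"

definition Hge2_alg :: "(rat, zpoly) module" where
  "Hge2_alg = \<lparr>carrier = Hge2, mult = (\<star>), one = word [], zero = 0, add = (+), smult = qscale\<rparr>"

definition DR :: "zpoly set" where
  "DR = Modules.module.span qscale
     {(partial_op ^^ n) (R_op u v) \<star> w | n u v w. u \<in> Hge2 \<and> v \<in> Hge2 \<and> w \<in> Hge2}"

definition Ef_alg :: "(rat, zpoly set) module" where
  "Ef_alg = quot_algebra Hge2_alg DR"

end

theory Submission
  imports Defs "HOL-Computational_Algebra.Polynomial"
begin

text \<open>
  The truncated sums of distinct words are linearly independent as functions of \<open>N\<close>, so identities in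
  \<open>H\<^sup>1\<close> can be checked on these functions, where the harmonic product is the pointwise product.
  Shuffling a word of \<open>H\<^bsup>\<ge>2\<^esup>\<close> with \<open>z\<^sub>2\<close> produces, outside \<open>H\<^bsup>\<ge>2\<^esup>\<close>, only words \<open>P z\<^sub>1 Q\<close>. By a
  connected-sum argument the modified sum of such a word differs from its truncated sum by a sum
  with an additional factor \<open>1 / (N - m)\<close>, and partial fractions in \<open>N\<close> yield a recursive formula for its
  image under Drop1, hence an explicit formula for \<open>\<partial>\<close> on \<open>H\<^bsup>\<ge>2\<^esup>\<close>.

  Composed with the truncated sums, \<open>\<phi> + \<partial>\<close> is a derivation; therefore the failure of \<open>\<partial>\<close> to be a
  derivation is exactly \<open>- R\<close>. On \<open>H\<^bsup>\<ge>2\<^esup>\<close> the operator \<open>\<delta>\<close> is \<open>-1/2\<close> times the removal of a leading \<open>z\<^sub>2\<close>, which amounts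
  to reading off the coefficient of \<open>N\<^bsup>-2\<^esup>\<close> in the difference of a truncated sum in \<open>N\<close>. The
  commutation relations thus hold already on \<open>H\<^bsup>\<ge>2\<^esup>\<close>, and they imply that the ideal is stable.
\<close>

section \<open>Linear extension\<close>

text \<open>The additional sum depends on \<open>N\<close> twice, as the upper bound of the indices
  and inside \<open>1 / (N - m)\<close>, so a recursion in the bound does not apply to it directly.
  It is therefore studied with two variables: \<open>M\<close> in the pole and \<open>N\<close> as
  the bound, with induction on \<open>N\<close> at fixed \<open>M\<close>, a separate formula for
  the shift from \<open>M\<close> to \<open>M + 1\<close>, and only then the diagonal
  \<open>M = N\<close>. Shifting \<open>M\<close> produces sums whose pole sits at an index that
  already carries a power, and expanding these by partial fractions leads back to the first kind;
  hence the mutual recursion for the image under Drop1. The derivation property is a matter of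
  counting slots: summed over all places for \<open>z_1\<close>, the extra index runs freely, and
  the total becomes the first variation of the truncated sum when each index \<open>m\<close> is
  displaced, a derivation for every \<open>M\<close>. The constants fit together as follows. A new
  \<open>y\<close> next to an old one can stand before or after it, which gives a factor 2 that the
  \<open>1/2\<close> in \<open>delta_op\<close> cancels. A block \<open>z_k\<close> can absorb an
  extra \<open>x\<close> in \<open>k\<close> ways, and these multiplicities add up to the weight, so
  that the commutator is exactly \<open>W_op\<close>.\<close>

lemma lookup_qscale [simp]: "Poly_Mapping.lookup (qscale c p) w = c * Poly_Mapping.lookup p w"
  by (simp add: qscale_def map.rep_eq when_def)

text \<open>Interpreting the bare module locale makes \<open>qs.span\<close> the very span that
  occurs in the definition of \<open>DR\<close>.\<close>

global_interpretation qs: Modules.module "qscale :: rat \<Rightarrow> ('a \<Rightarrow>\<^sub>0 rat) \<Rightarrow> ('a \<Rightarrow>\<^sub>0 rat)"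
  by unfold_locales (auto intro!: poly_mapping_eqI simp: lookup_add algebra_simps)

abbreviation qlin :: "(('a \<Rightarrow>\<^sub>0 rat) \<Rightarrow> ('b \<Rightarrow>\<^sub>0 rat)) \<Rightarrow> bool" where
  "qlin \<equiv> Modules.module_hom qscale qscale"

abbreviation qform :: "(('a \<Rightarrow>\<^sub>0 rat) \<Rightarrow> rat) \<Rightarrow> bool" where
  "qform \<equiv> Modules.module_hom qscale (*)"

lemma qlinI:
  assumes "\<And>p q. f (p + q) = f p + f q" "\<And>c p. f (qscale c p) = qscale c (f p)"
  shows "qlin f"
  by unfold_locales (use assms in auto)

lemma qformI:
  assumes "\<And>p q. f (p + q) = f p + f q" "\<And>c p. f (qscale c p) = c * f p"
  shows "qform f"
  by unfold_locales (auto simp: assms algebra_simps)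

text \<open>\<open>H1\<close>, \<open>Hge2\<close> and the homogeneous components are all of this
  shape, so one set of closure rules serves them all.\<close>

definition supp_in :: "'a set \<Rightarrow> ('a \<Rightarrow>\<^sub>0 rat) set" where
  "supp_in A = {p. Poly_Mapping.keys p \<subseteq> A}"

lemma in_supp_in_iff: "p \<in> supp_in A \<longleftrightarrow> (\<forall>w. w \<notin> A \<longrightarrow> Poly_Mapping.lookup p w = 0)"
  by (auto simp: supp_in_def in_keys_iff)

lemma subspace_supp_in: "qs.subspace (supp_in A)"
  by (rule qs.subspaceI) (auto simp: in_supp_in_iff lookup_add)

lemmas supp_in_0 [simp] = qs.subspace_0[OF subspace_supp_in]
  and supp_in_add = qs.subspace_add[OF subspace_supp_in]
  and supp_in_qscale = qs.subspace_scale[OF subspace_supp_in]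
  and supp_in_diff = qs.subspace_diff[OF subspace_supp_in]
  and supp_in_sum = qs.subspace_sum[OF subspace_supp_in]

lemma word_in_supp_in [simp]: "word w \<in> supp_in A \<longleftrightarrow> w \<in> A"
  by (auto simp: supp_in_def)

lemma supp_in_mono: "p \<in> supp_in A \<Longrightarrow> A \<subseteq> B \<Longrightarrow> p \<in> supp_in B"
  by (auto simp: supp_in_def)

lemma H1_eq: "H1 = supp_in (lists {1..})"
  by (auto simp: H1_def supp_in_def subset_iff in_lists_conv_set)

lemma Hge2_eq: "Hge2 = supp_in (lists {2..})"
  by (auto simp: Hge2_def supp_in_def subset_iff in_lists_conv_set)

lemma lists2_lists1: "lists {2..} \<subseteq> lists {1::nat..}"
  by (rule lists_mono) auto

lemma Hge2_H1: "p \<in> Hge2 \<Longrightarrow> p \<in> H1"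
  unfolding Hge2_eq H1_eq by (rule supp_in_mono[OF _ lists2_lists1])

lemma keys_qscale_subset: "Poly_Mapping.keys (qscale c p) \<subseteq> Poly_Mapping.keys p"
  by (auto simp: in_keys_iff)

lemma sum_words: "p = (\<Sum>w\<in>Poly_Mapping.keys p. qscale (Poly_Mapping.lookup p w) (word w))"
proof (rule poly_mapping_eqI)
  fix v
  have "(\<Sum>w\<in>Poly_Mapping.keys p. Poly_Mapping.lookup p w * Poly_Mapping.lookup (word w) v)
     = (\<Sum>w\<in>Poly_Mapping.keys p. if w = v then Poly_Mapping.lookup p w else 0)"
    by (intro sum.cong) (auto simp: lookup_single)
  then show "Poly_Mapping.lookup p v = Poly_Mapping.lookup
      (\<Sum>w\<in>Poly_Mapping.keys p. qscale (Poly_Mapping.lookup p w) (word w)) v"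
    by (simp add: lookup_sum sum.delta in_keys_iff)
qed

text \<open>The scaling \<open>s\<close> of the target stays a parameter, so that the rule covers
  operators on words as well as rational functionals.\<close>

lemma linear_eq_on_words:
  assumes f: "Modules.module_hom qscale s f" and g: "Modules.module_hom qscale s g"
    and p: "p \<in> supp_in A" and eq: "\<And>w. w \<in> A \<Longrightarrow> f (word w) = g (word w)"
  shows "f p = g p"
proof -
  let ?s = "\<Sum>w\<in>Poly_Mapping.keys p. qscale (Poly_Mapping.lookup p w) (word w)"
  have "f ?s = g ?s"
    unfolding module_hom.sum[OF f] module_hom.sum[OF g] module_hom.scale[OF f] module_hom.scale[OF g]
    using p by (intro sum.cong) (auto simp: eq supp_in_def)
  then show ?thesis by (simp only: sum_words[symmetric] mem_Collect_eq)
qed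

lemma subspace_word_induct:
  assumes "qs.subspace (Collect P)" and "p \<in> supp_in A" and "\<And>w. w \<in> A \<Longrightarrow> P (word w)"
  shows "P p"
proof -
  have "(\<Sum>w\<in>Poly_Mapping.keys p. qscale (Poly_Mapping.lookup p w) (word w)) \<in> Collect P"
    using assms(2,3)
    by (intro qs.subspace_sum[OF assms(1)] qs.subspace_scale[OF assms(1)]) (auto simp: supp_in_def)
  then show ?thesis by (simp only: sum_words[symmetric] mem_Collect_eq)
qed

lemma lin_ext_superset:
  assumes "finite S" "Poly_Mapping.keys p \<subseteq> S"
  shows "lin_ext f p = (\<Sum>w\<in>S. qscale (Poly_Mapping.lookup p w) (f w))"
  unfolding lin_ext_def using assms by (intro sum.mono_neutral_left) (auto simp: in_keys_iff)

lemma rat_ext_superset: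
  assumes "finite S" "Poly_Mapping.keys p \<subseteq> S"
  shows "rat_ext f p = (\<Sum>w\<in>S. Poly_Mapping.lookup p w * f w)"
  unfolding rat_ext_def using assms by (intro sum.mono_neutral_left) (auto simp: in_keys_iff)

lemma lin_ext_linear: "qlin (lin_ext f)"
proof (rule qlinI)
  fix p q :: "'a \<Rightarrow>\<^sub>0 rat" and c :: rat
  let ?S = "Poly_Mapping.keys p \<union> Poly_Mapping.keys q"
  have "Poly_Mapping.keys (p + q) \<subseteq> ?S" by (rule keys_add)
  then show "lin_ext f (p + q) = lin_ext f p + lin_ext f q"
    by (simp add: lin_ext_superset[of ?S] lookup_add qs.scale_left_distrib sum.distrib)
  show "lin_ext f (qscale c p) = qscale c (lin_ext f p)"
    by (subst (1 2) lin_ext_superset[of "Poly_Mapping.keys p"])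
      (simp_all add: keys_qscale_subset qs.scale_sum_right)
qed

lemma rat_ext_linear: "qform (rat_ext f)"
proof (rule qformI)
  fix p q :: "'a \<Rightarrow>\<^sub>0 rat" and c :: rat
  let ?S = "Poly_Mapping.keys p \<union> Poly_Mapping.keys q"
  have "Poly_Mapping.keys (p + q) \<subseteq> ?S" by (rule keys_add)
  then show "rat_ext f (p + q) = rat_ext f p + rat_ext f q"
    by (simp add: rat_ext_superset[of ?S] lookup_add distrib_right sum.distrib)
  show "rat_ext f (qscale c p) = c * rat_ext f p"
    by (subst (1 2) rat_ext_superset[of "Poly_Mapping.keys p"])
      (simp_all add: keys_qscale_subset sum_distrib_left mult.assoc)
qed

lemma lin_ext_word [simp]: "lin_ext f (word w) = f w"
  by (simp add: lin_ext_def)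

lemma rat_ext_word [simp]: "rat_ext f (word w) = f w"
  by (simp add: rat_ext_def)

lemmas lin_ext_simps [simp] =
  module_hom.add[OF lin_ext_linear] module_hom.scale[OF lin_ext_linear]
  module_hom.zero[OF lin_ext_linear] module_hom.diff[OF lin_ext_linear]
  module_hom.neg[OF lin_ext_linear] module_hom.sum[OF lin_ext_linear]

lemmas rat_ext_simps [simp] =
  module_hom.add[OF rat_ext_linear] module_hom.scale[OF rat_ext_linear]
  module_hom.zero[OF rat_ext_linear] module_hom.diff[OF rat_ext_linear]
  module_hom.neg[OF rat_ext_linear] module_hom.sum[OF rat_ext_linear]

lemma lin_ext_add_fun: "lin_ext (\<lambda>w. f w + g w) p = lin_ext f p + lin_ext g p"
  by (simp add: lin_ext_def qs.scale_right_distrib sum.distrib)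

lemma lin_ext_qscale_fun: "lin_ext (\<lambda>w. qscale c (f w)) p = qscale c (lin_ext f p)"
  by (simp add: lin_ext_def qs.scale_sum_right mult.commute)

lemma lin_ext_in_supp_in:
  assumes "p \<in> supp_in A" "\<And>w. w \<in> A \<Longrightarrow> f w \<in> supp_in B"
  shows "lin_ext f p \<in> supp_in B"
  unfolding lin_ext_def using assms
  by (intro supp_in_sum supp_in_qscale) (auto simp: supp_in_def)

lemma qlin_comp: "qlin f \<Longrightarrow> Modules.module_hom qscale s g \<Longrightarrow> Modules.module_hom qscale s (\<lambda>p. g (f p))"
  using module_hom_compose[of qscale qscale f s g] by (simp add: comp_def)

lemma bilin_ext_linear_left: "qlin (\<lambda>p. bilin_ext f p q)"
  unfolding bilin_ext_def by (rule lin_ext_linear)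

lemma bilin_ext_linear_right: "qlin (bilin_ext f p)"
  by (rule qlinI) (simp_all add: bilin_ext_def lin_ext_add_fun lin_ext_qscale_fun)

lemma bilin_ext_word [simp]: "bilin_ext f (word u) (word v) = f u v"
  by (simp add: bilin_ext_def)

lemma bilin_ext_in_supp_in:
  assumes "p \<in> supp_in A" "q \<in> supp_in B" "\<And>u v. u \<in> A \<Longrightarrow> v \<in> B \<Longrightarrow> f u v \<in> supp_in C"
  shows "bilin_ext f p q \<in> supp_in C"
  unfolding bilin_ext_def using assms by (intro lin_ext_in_supp_in[OF assms(1)] lin_ext_in_supp_in[OF assms(2)])

section \<open>Linearity of the products and of the evaluation maps\<close>

lemma harmonic_linear_left: "qlin (\<lambda>p. p \<star> q)"
  unfolding harmonic_def by (rule bilin_ext_linear_left)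

lemma harmonic_linear_right: "qlin ((\<star>) p)"
  unfolding harmonic_def[abs_def] by (rule bilin_ext_linear_right)

lemmas harmonic_left_simps [simp] =
  module_hom.add[OF harmonic_linear_left] module_hom.scale[OF harmonic_linear_left]
  module_hom.zero[OF harmonic_linear_left] module_hom.diff[OF harmonic_linear_left]
  module_hom.neg[OF harmonic_linear_left]

lemmas harmonic_right_simps [simp] =
  module_hom.add[OF harmonic_linear_right] module_hom.scale[OF harmonic_linear_right]
  module_hom.zero[OF harmonic_linear_right] module_hom.diff[OF harmonic_linear_right]
  module_hom.neg[OF harmonic_linear_right]

lemma harmonic_words [simp]: "word u \<star> word v = harmonic_word u v"
  by (simp add: harmonic_def)

lemma shuffle_linear_left: "qlin (\<lambda>p. shuffle p q)"
  unfolding shuffle_def by (rule bilin_ext_linear_left)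

lemma shuffle_words: "shuffle (word u) (word v) = to_z (shuffle_word (xy_word u) (xy_word v))"
  by (simp add: shuffle_def)

lemma prepend_linear: "qlin (prepend a)"
  unfolding prepend_def by (rule lin_ext_linear)

lemmas prepend_simps [simp] =
  module_hom.add[OF prepend_linear] module_hom.scale[OF prepend_linear]
  module_hom.zero[OF prepend_linear] module_hom.diff[OF prepend_linear]
  module_hom.neg[OF prepend_linear] module_hom.sum[OF prepend_linear]

lemma prepend_word [simp]: "prepend a (word w) = word (a # w)"
  by (simp add: prepend_def)

lemma prepend_in_supp_in:
  assumes "p \<in> supp_in A" "\<And>w. w \<in> A \<Longrightarrow> a # w \<in> B"
  shows "prepend a p \<in> supp_in B"
  unfolding prepend_def using assms by (intro lin_ext_in_supp_in[OF assms(1)]) auto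

lemma zeta_trunc_linear: "qform (zeta_trunc N)"
  unfolding zeta_trunc_def by (rule rat_ext_linear)

lemmas zeta_trunc_simps [simp] =
  module_hom.add[OF zeta_trunc_linear] module_hom.scale[OF zeta_trunc_linear]
  module_hom.zero[OF zeta_trunc_linear] module_hom.diff[OF zeta_trunc_linear]
  module_hom.neg[OF zeta_trunc_linear] module_hom.sum[OF zeta_trunc_linear]

lemma zeta_trunc_of_word [simp]: "zeta_trunc N (word w) = zeta_trunc_word N w"
  by (simp add: zeta_trunc_def)

lemma zeta_modified_linear: "qform (zeta_modified N)"
  unfolding zeta_modified_def by (rule rat_ext_linear)

lemmas zeta_modified_simps [simp] =
  module_hom.add[OF zeta_modified_linear] module_hom.scale[OF zeta_modified_linear]
  module_hom.zero[OF zeta_modified_linear] module_hom.diff[OF zeta_modified_linear]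
  module_hom.neg[OF zeta_modified_linear] module_hom.sum[OF zeta_modified_linear]

lemma zeta_modified_word [simp]: "zeta_modified N (word w) = zeta_modified_xy N (xy_word w)"
  by (simp add: zeta_modified_def)

lemma phi_linear: "qlin phi"
  by (rule qlinI) (simp_all add: phi_def module_hom.add[OF shuffle_linear_left]
    module_hom.scale[OF shuffle_linear_left] qs.scale_right_diff_distrib algebra_simps)

lemmas phi_simps [simp] =
  module_hom.add[OF phi_linear] module_hom.scale[OF phi_linear]
  module_hom.zero[OF phi_linear] module_hom.diff[OF phi_linear] module_hom.neg[OF phi_linear]

section \<open>Recursions for truncated and modified sums\<close>

lemma zeta_trunc_word_Nil [simp]: "zeta_trunc_word N [] = 1"
proof -
  have "{ns. length ns = length ([]::nat list) \<and> set ns \<subseteq> {1..<N} \<and> sorted_wrt (>) ns} = {[]}"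
    by auto
  then show ?thesis by (simp add: zeta_trunc_word_def)
qed

lemma zeta_trunc_word_Cons:
  "zeta_trunc_word N (k # w) = (\<Sum>m=1..<N. 1 / of_nat m ^ k * zeta_trunc_word m w)"
proof -
  let ?T = "\<lambda>N l. {ns. length ns = l \<and> set ns \<subseteq> {1..<N} \<and> sorted_wrt (>) (ns::nat list)}"
  have fin: "finite (?T N l)" for N l
    by (rule finite_subset[OF _ finite_lists_length_eq[of "{1..<N}" l]]) auto
  have bij: "bij_betw (\<lambda>(m, ns). m # ns) (SIGMA m:{1..<N}. ?T m (length w)) (?T N (Suc (length w)))"
  proof (rule bij_betwI')
    fix ns assume "ns \<in> ?T N (Suc (length w))"
    then obtain m ms where "ns = m # ms" "length ms = length w" "m \<in> {1..<N}" "set ms \<subseteq> {1..<N}"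
      "\<forall>x\<in>set ms. x < m" "sorted_wrt (>) ms"
      by (cases ns) auto
    then show "\<exists>x\<in>SIGMA m:{1..<N}. ?T m (length w). ns = (case x of (m, ns) \<Rightarrow> m # ns)"
      by (intro bexI[of _ "(m, ms)"]) (auto simp: subset_iff)
  qed (auto simp: subset_iff intro: less_trans)
  have "zeta_trunc_word N (k # w) = (\<Sum>(m, ns)\<in>(SIGMA m:{1..<N}. ?T m (length w)).
      1 / of_nat m ^ k * (\<Prod>i<length w. 1 / of_nat (ns ! i) ^ (w ! i)))"
    unfolding zeta_trunc_word_def length_Cons
    by (subst sum.reindex_bij_betw[OF bij, symmetric])
      (auto intro!: sum.cong simp: prod.lessThan_Suc_shift simp del: prod.lessThan_Suc)
  also have "\<dots> = (\<Sum>m=1..<N. 1 / of_nat m ^ k * zeta_trunc_word m w)"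
    unfolding zeta_trunc_word_def by (subst sum.Sigma[symmetric]) (auto simp: fin[simplified] sum_distrib_left)
  finally show ?thesis .
qed

lemma zeta_trunc_word_Suc:
  "zeta_trunc_word (Suc N) (k # w) = zeta_trunc_word N (k # w)
     + (if N = 0 then 0 else 1 / of_nat N ^ k * zeta_trunc_word N w)"
  by (cases N) (simp_all add: zeta_trunc_word_Cons atLeastLessThanSuc)

lemma zeta_trunc_word_le1 [simp]: "N \<le> 1 \<Longrightarrow> zeta_trunc_word N (k # w) = 0"
  by (simp add: zeta_trunc_word_Cons)

text \<open>The bound \<open>a\<close> on the leading index is separated from the \<open>N\<close>
  in the factors \<open>1 / (N - n)\<close>, which makes a recursion along the letters possible;
  \<open>a = N - 1\<close> gives back the modified sum.\<close>

fun modified_partial :: "nat \<Rightarrow> letter list \<Rightarrow> nat \<Rightarrow> rat" where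
  "modified_partial N [] a = 1"
| "modified_partial N (l # w) a =
     (\<Sum>n=1..a. (if l = LX then 1 / of_nat n else 1 / of_nat (N - n))
        * modified_partial N w (if l = LY \<and> take 1 w = [LX] then n - 1 else n))"

definition admissible_chain :: "letter list \<Rightarrow> nat list \<Rightarrow> bool" where
  "admissible_chain w ns \<longleftrightarrow> (\<forall>i. Suc i < length w \<longrightarrow>
     (if w ! i = LY \<and> w ! Suc i = LX then ns ! Suc i < ns ! i else ns ! Suc i \<le> ns ! i))"

lemma admissible_chain_Cons:
  "admissible_chain (l # w) (n # ns) \<longleftrightarrow>
     (w \<noteq> [] \<longrightarrow> (if l = LY \<and> w ! 0 = LX then ns ! 0 < n else ns ! 0 \<le> n)) \<and> admissible_chain w ns"
  (is "?L \<longleftrightarrow> ?R")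
proof
  assume L: ?L
  show ?R
    unfolding admissible_chain_def
  proof (intro conjI allI impI)
    assume "w \<noteq> []"
    then show "if l = LY \<and> w ! 0 = LX then ns ! 0 < n else ns ! 0 \<le> n"
      using L[unfolded admissible_chain_def, rule_format, of 0] by auto
  next
    fix i assume "Suc i < length w"
    then show "if w ! i = LY \<and> w ! Suc i = LX then ns ! Suc i < ns ! i else ns ! Suc i \<le> ns ! i"
      using L[unfolded admissible_chain_def, rule_format, of "Suc i"] by auto
  qed
next
  assume R: ?R
  show ?L
    unfolding admissible_chain_def
  proof (intro allI impI)
    fix i assume "Suc i < length (l # w)"
    then show "if (l # w) ! i = LY \<and> (l # w) ! Suc i = LX then (n # ns) ! Suc i < (n # ns) ! i
      else (n # ns) ! Suc i \<le> (n # ns) ! i"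
      using R by (cases i) (auto simp: admissible_chain_def)
  qed
qed

text \<open>Admissible chains never increase, so bounding the head bounds every index; this is how
  the range condition passes from a list to its tail.\<close>

lemma admissible_chain_le_hd:
  assumes "length ns = length w" "admissible_chain w ns" "x \<in> set ns"
  shows "x \<le> ns ! 0"
  using assms
proof (induction w arbitrary: ns)
  case (Cons l w)
  then obtain n ms where ns: "ns = n # ms" "length ms = length w" by (cases ns) auto
  show ?case
  proof (cases "x = n")
    case False
    then have x: "x \<in> set ms" using Cons.prems ns by simp
    then have "w \<noteq> []" using ns by auto
    then have "ms ! 0 \<le> n" "admissible_chain w ms"
      using Cons.prems(2) unfolding ns admissible_chain_Cons by (auto split: if_splits)
    then show ?thesis using Cons.IH[OF ns(2) _ x] ns by auto
  qed (simp add: ns)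
qed simp

lemma modified_partial_eq_sum:
  "modified_partial N w a =
     (\<Sum>ns\<in>{ns. length ns = length w \<and> set ns \<subseteq> {1..a} \<and> admissible_chain w ns}.
        \<Prod>i<length w. if w ! i = LX then 1 / of_nat (ns ! i) else 1 / of_nat (N - ns ! i))"
proof (induction w arbitrary: a)
  case Nil
  have "{ns. length ns = length ([]::letter list) \<and> set ns \<subseteq> {1..a} \<and> admissible_chain [] ns} = {[]}"
    by (auto simp: admissible_chain_def)
  then show ?case by simp
next
  case (Cons l w)
  let ?T = "\<lambda>w a. {ns. length ns = length w \<and> set ns \<subseteq> {1..a} \<and> admissible_chain w ns}"
  let ?b = "\<lambda>n. if l = LY \<and> take 1 w = [LX] then n - 1 else n"
  have fin: "finite (?T w a)" for w a
    by (rule finite_subset[OF _ finite_lists_length_eq[of "{1..a}" "length w"]]) auto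
  have step: "n # ns \<in> ?T (l # w) a \<longleftrightarrow> n \<in> {1..a} \<and> ns \<in> ?T w (?b n)" for n ns
  proof (cases "w = []")
    case True
    then show ?thesis by (auto simp: admissible_chain_Cons admissible_chain_def)
  next
    case False
    then have tk: "take 1 w = [LX] \<longleftrightarrow> w ! 0 = LX" by (cases w) auto
    show ?thesis
    proof
      assume A: "n # ns \<in> ?T (l # w) a"
      then have le: "ns ! 0 \<le> ?b n" "admissible_chain w ns" "length ns = length w"
        using False unfolding mem_Collect_eq admissible_chain_Cons tk by (auto split: if_splits)
      have "x \<le> ?b n" if "x \<in> set ns" for x
        using admissible_chain_le_hd[OF le(3,2) that] le(1) by linarith
      then show "n \<in> {1..a} \<and> ns \<in> ?T w (?b n)"
        using A le by (fastforce simp: subset_iff)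
    next
      assume A: "n \<in> {1..a} \<and> ns \<in> ?T w (?b n)"
      then have "length ns = length w" by blast
      then have "ns ! 0 \<in> set ns" using False by (metis length_greater_0_conv nth_mem)
      then have "1 \<le> ns ! 0 \<and> ns ! 0 \<le> ?b n" using A by auto
      then show "n # ns \<in> ?T (l # w) a"
        using A by (auto simp: admissible_chain_Cons tk[simplified] subset_iff split: if_splits)
    qed
  qed
  have bij: "bij_betw (\<lambda>(n, ns). n # ns) (SIGMA n:{1..a}. ?T w (?b n)) (?T (l # w) a)"
  proof (rule bij_betwI')
    fix ns assume A: "ns \<in> ?T (l # w) a"
    then obtain m ms where ns: "ns = m # ms" by (cases ns) auto
    then show "\<exists>x\<in>SIGMA n:{1..a}. ?T w (?b n). ns = (case x of (m, ns) \<Rightarrow> m # ns)"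
      using A step[of m ms] by (intro bexI[of _ "(m, ms)"]) auto
  next
    fix x assume "x \<in> (SIGMA n:{1..a}. ?T w (?b n))"
    then obtain n ns where "x = (n, ns)" "n \<in> {1..a}" "ns \<in> ?T w (?b n)" by blast
    then show "(case x of (m, ns) \<Rightarrow> m # ns) \<in> ?T (l # w) a"
      using step[of n ns] by simp
  qed auto
  let ?g = "\<lambda>w ns. \<Prod>i<length w. if w ! i = LX then 1 / of_nat (ns ! i) else 1 / of_nat (N - ns ! i) :: rat"
  have "(\<Sum>ns\<in>?T (l # w) a. ?g (l # w) ns) = (\<Sum>(n, ns)\<in>(SIGMA n:{1..a}. ?T w (?b n)).
      (if l = LX then 1 / of_nat n else 1 / of_nat (N - n)) * ?g w ns)"
    by (subst sum.reindex_bij_betw[OF bij, symmetric])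
      (auto intro!: sum.cong simp: prod.lessThan_Suc_shift simp del: prod.lessThan_Suc cong: if_cong)
  also have "\<dots> = (\<Sum>n=1..a. (if l = LX then 1 / of_nat n else 1 / of_nat (N - n)) * (\<Sum>ns\<in>?T w (?b n). ?g w ns))"
    by (subst sum.Sigma[symmetric]) (auto simp: fin[simplified] sum_distrib_left)
  finally show ?case by (simp only: modified_partial.simps Cons.IH)
qed

lemma zeta_modified_xy_eq: "zeta_modified_xy N w = modified_partial N w (N - 1)"
proof -
  have "{1..<N} = {1..N - 1}" by auto
  then show ?thesis
    by (simp only: zeta_modified_xy_def modified_partial_eq_sum admissible_chain_def)
qed

section \<open>The harmonic product and the truncated sums\<close>

lemma zeta_trunc_prepend_Suc:
  "zeta_trunc (Suc N) (prepend a p) = zeta_trunc N (prepend a p)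
     + (if N = 0 then 0 else 1 / of_nat N ^ a * zeta_trunc N p)"
  by (rule linear_eq_on_words[where s="(*)" and A=UNIV
        and f="\<lambda>p. zeta_trunc (Suc N) (prepend a p)"
        and g="\<lambda>p. zeta_trunc N (prepend a p) + (if N = 0 then 0 else 1 / of_nat N ^ a * zeta_trunc N p)"])
    (auto intro!: qformI simp: supp_in_def zeta_trunc_word_Suc algebra_simps add_divide_distrib)

lemma zeta_trunc_prepend_0 [simp]: "zeta_trunc 0 (prepend a p) = 0"
  by (rule linear_eq_on_words[where s="(*)" and A=UNIV and f="\<lambda>p. zeta_trunc 0 (prepend a p)" and g="\<lambda>p. 0"])
    (auto intro!: qformI simp: supp_in_def)

text \<open>Going from \<open>N\<close> to \<open>N + 1\<close> adds the terms whose top index is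
  \<open>N\<close>. The three summands of the harmonic recursion supply exactly the three new terms
  in the expansion of \<open>(s + x * s') * (t + y * t')\<close>.\<close>

lemma zeta_trunc_harmonic_word:
  "zeta_trunc N (harmonic_word u v) = zeta_trunc_word N u * zeta_trunc_word N v"
proof (induction u v arbitrary: N rule: harmonic_word.induct)
  case (3 a u b v)
  show ?case
  proof (induction N)
    case 0
    then show ?case by simp
  next
    case (Suc N)
    show ?case
    proof (cases "N = 0")
      case False
      define x y :: rat where "x = 1 / of_nat N ^ a" and "y = 1 / of_nat N ^ b"
      have xy: "1 / of_nat N ^ (a + b) = x * y" by (simp add: x_def y_def power_add)
      have "zeta_trunc (Suc N) (harmonic_word (a # u) (b # v)) = zeta_trunc N (harmonic_word (a # u) (b # v))
          + x * zeta_trunc N (harmonic_word u (b # v)) + y * zeta_trunc N (harmonic_word (a # u) v)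
          + x * y * zeta_trunc N (harmonic_word u v)"
        using False by (simp add: zeta_trunc_prepend_Suc xy x_def[symmetric] y_def[symmetric])
      also have "\<dots> = (zeta_trunc_word N (a # u) + x * zeta_trunc_word N u)
          * (zeta_trunc_word N (b # v) + y * zeta_trunc_word N v)"
        unfolding Suc.IH "3.IH" by (simp add: algebra_simps)
      also have "\<dots> = zeta_trunc_word (Suc N) (a # u) * zeta_trunc_word (Suc N) (b # v)"
        using False by (simp add: zeta_trunc_word_Suc x_def y_def)
      finally show ?thesis .
    qed (simp add: zeta_trunc_prepend_Suc)
  qed
qed auto

lemma zeta_trunc_harmonic [simp]: "zeta_trunc N (p \<star> q) = zeta_trunc N p * zeta_trunc N q"
proof -
  have w: "zeta_trunc N (word u \<star> q) = zeta_trunc N (word u) * zeta_trunc N q" for u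
    by (rule linear_eq_on_words[where s="(*)" and A=UNIV and f="\<lambda>q. zeta_trunc N (word u \<star> q)"
          and g="\<lambda>q. zeta_trunc N (word u) * zeta_trunc N q"])
      (auto intro!: qformI simp: supp_in_def zeta_trunc_harmonic_word algebra_simps)
  show ?thesis
    by (rule linear_eq_on_words[where s="(*)" and A=UNIV and f="\<lambda>p. zeta_trunc N (p \<star> q)"
          and g="\<lambda>p. zeta_trunc N p * zeta_trunc N q"])
      (use w in \<open>auto intro!: qformI simp: supp_in_def algebra_simps\<close>)
qed

lemma harmonic_word_supp_in:
  assumes A: "\<And>a b. a \<in> A \<Longrightarrow> b \<in> A \<Longrightarrow> a + b \<in> A"
  shows "u \<in> lists A \<Longrightarrow> v \<in> lists A \<Longrightarrow> harmonic_word u v \<in> supp_in (lists A)"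
  by (induction u v rule: harmonic_word.induct) (auto intro!: supp_in_add prepend_in_supp_in A)

lemma harmonic_word_homogeneous:
  "harmonic_word u v \<in> supp_in {w. sum_list w = sum_list u + sum_list v}"
proof (induction u v rule: harmonic_word.induct)
  case (3 a u b v)
  then show ?case by (auto intro!: supp_in_add intro: prepend_in_supp_in)
qed auto

lemma harmonic_H1 [intro]: "p \<in> H1 \<Longrightarrow> q \<in> H1 \<Longrightarrow> p \<star> q \<in> H1"
  unfolding H1_eq harmonic_def by (rule bilin_ext_in_supp_in) (auto intro!: harmonic_word_supp_in)

lemma harmonic_Hge2 [intro]: "p \<in> Hge2 \<Longrightarrow> q \<in> Hge2 \<Longrightarrow> p \<star> q \<in> Hge2"
  unfolding Hge2_eq harmonic_def by (rule bilin_ext_in_supp_in) (auto intro!: harmonic_word_supp_in)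

section \<open>Linear independence of the truncated sums\<close>

lemma eventually_poly_shift_nonzero:
  fixes A :: "real poly"
  assumes "A \<noteq> 0"
  shows "eventually (\<lambda>x. poly A (x + c) \<noteq> 0) (at a)"
proof -
  let ?Z = "(\<lambda>z. z - c) ` {z. poly A z = 0}"
  have "finite ?Z" using poly_roots_finite[OF assms] by simp
  then have "eventually (\<lambda>x. \<forall>z\<in>?Z. x \<noteq> z) (at a)"
    by (rule eventually_ball_finite) (simp add: eventually_neq_at_within)
  then show ?thesis by eventually_elim force
qed

lemma finite_nat_roots:
  fixes A :: "real poly"
  assumes "A \<noteq> 0"
  shows "finite {n. poly A (real n) = 0}" "finite {n. poly A (- real n) = 0}"
proof -
  have "inj (\<lambda>n. real n)" "inj (\<lambda>n. - real n)" by (auto intro: injI)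
  then show "finite {n. poly A (real n) = 0}" "finite {n. poly A (- real n) = 0}"
    using finite_vimageI[OF poly_roots_finite[OF assms], of "\<lambda>n. real n"]
      finite_vimageI[OF poly_roots_finite[OF assms], of "\<lambda>n. - real n"]
    by (simp_all add: vimage_def)
qed

text \<open>Telescoping from \<open>x - i\<close> to \<open>x + j\<close>, where \<open>-i\<close> and \<open>j\<close> are not poles of \<open>B / A\<close>, leaves a
  function that is regular at \<open>0\<close>, whereas the right-hand side has a pole there.\<close>

lemma no_rational_antidifference:
  fixes A B :: "real poly" and c :: "nat \<Rightarrow> real"
  assumes A: "A \<noteq> 0" and I: "finite I" "K \<in> I" "\<And>k. k \<in> I \<Longrightarrow> 1 \<le> k \<and> k \<le> K" and c: "c K \<noteq> 0"
    and eq: "\<And>x. poly A x \<noteq> 0 \<Longrightarrow> poly A (x + 1) \<noteq> 0 \<Longrightarrow> x \<noteq> 0 \<Longrightarrow>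
      poly B (x + 1) / poly A (x + 1) - poly B x / poly A x = (\<Sum>k\<in>I. c k / x ^ k)"
  shows False
proof -
  \<comment> \<open>The endpoints \<open>-i\<close> and \<open>j\<close> avoid the zeros of
    \<open>A\<close>; \<open>j >= 1\<close> guarantees that the step \<open>m = i\<close>, where the
    argument is \<open>x\<close> itself, belongs to the telescoping sum.\<close>
  have "\<exists>j::nat. j \<notin> {n. poly A (real n) = 0} \<union> {0}"
    by (rule ex_new_if_finite) (simp_all add: finite_nat_roots[OF A])
  then obtain j where j: "poly A (real j) \<noteq> 0" "j \<ge> 1" by auto
  have "\<exists>i::nat. i \<notin> {n. poly A (- real n) = 0}"
    by (rule ex_new_if_finite) (simp_all add: finite_nat_roots[OF A])
  then obtain i where i: "poly A (- real i) \<noteq> 0" by auto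
  define g where "g x = poly B x / poly A x" for x
  define y where "y m x = x + (real m - real i)" for m :: nat and x :: real
  let ?L = "i + j"
  have K: "K \<ge> 1" using I by blast
  have ev: "eventually (\<lambda>x. (\<forall>m\<in>{..?L}. poly A (y m x) \<noteq> 0) \<and> (\<forall>m\<in>{..?L}. y m x \<noteq> 0)) (at 0)"
  proof (intro eventually_conj eventually_ball_finite ballI)
    show "eventually (\<lambda>x. poly A (y m x) \<noteq> 0) (at 0)" for m
      unfolding y_def by (rule eventually_poly_shift_nonzero[OF A])
    show "eventually (\<lambda>x. y m x \<noteq> 0) (at 0)" for m
      using eventually_neq_at_within[of "real i - real m" 0 UNIV] unfolding y_def
      by eventually_elim auto
  qed auto
  have "((\<lambda>x. x ^ K * (g (y ?L x) - g (y 0 x))) \<longlongrightarrow> 0 ^ K * (g (real j) - g (- real i))) (at 0)"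
    unfolding g_def y_def using i j by (auto intro!: tendsto_eq_intros)
  then have lim1: "((\<lambda>x. x ^ K * (g (y ?L x) - g (y 0 x))) \<longlongrightarrow> 0) (at 0)"
    using K by (simp add: power_0_left)
  \<comment> \<open>Only \<open>m = i\<close> has a pole at \<open>0\<close>; there the factor
    \<open>x ^ K\<close> isolates the coefficient of the highest power, and all other terms vanish
    in the limit.\<close>
  have lim2: "((\<lambda>x. \<Sum>m<?L. x ^ K * (\<Sum>k\<in>I. c k / y m x ^ k)) \<longlongrightarrow> (\<Sum>m<?L. if m = i then c K else 0)) (at 0)"
  proof (rule tendsto_sum)
    fix m
    show "((\<lambda>x. x ^ K * (\<Sum>k\<in>I. c k / y m x ^ k)) \<longlongrightarrow> (if m = i then c K else 0)) (at 0)"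
    proof (cases "m = i")
      case True
      have "((\<lambda>x. \<Sum>k\<in>I. c k * x ^ (K - k)) \<longlongrightarrow> (\<Sum>k\<in>I. c k * 0 ^ (K - k))) (at (0::real))"
        by (auto intro!: tendsto_eq_intros)
      also have "(\<Sum>k\<in>I. c k * 0 ^ (K - k)) = (\<Sum>k\<in>I. if k = K then c k else 0)"
        using I by (intro sum.cong) (auto simp: power_0_left le_antisym)
      also have "\<dots> = c K" using I by simp
      finally have "((\<lambda>x. \<Sum>k\<in>I. c k * x ^ (K - k)) \<longlongrightarrow> c K) (at 0)" .
      moreover have "eventually (\<lambda>x. (\<Sum>k\<in>I. c k * x ^ (K - k)) = x ^ K * (\<Sum>k\<in>I. c k / y m x ^ k)) (at 0)"
        using eventually_neq_at_within[of 0 0 UNIV]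
      proof eventually_elim
        case (elim x)
        then show ?case using True I unfolding sum_distrib_left
          by (intro sum.cong) (auto simp: y_def power_diff)
      qed
      ultimately show ?thesis using True by (auto elim: Lim_transform_eventually)
    next
      case False
      have "((\<lambda>x. x ^ K * (\<Sum>k\<in>I. c k / y m x ^ k)) \<longlongrightarrow> 0 ^ K * (\<Sum>k\<in>I. c k / (real m - real i) ^ k)) (at 0)"
        unfolding y_def using False by (auto intro!: tendsto_eq_intros)
      then show ?thesis using False K by (simp add: power_0_left)
    qed
  qed
  have "eventually (\<lambda>x. x ^ K * (g (y ?L x) - g (y 0 x)) = (\<Sum>m<?L. x ^ K * (\<Sum>k\<in>I. c k / y m x ^ k))) (at 0)"
    using ev
  proof eventually_elim
    case (elim x)
    have "g (y ?L x) - g (y 0 x) = (\<Sum>m<?L. g (y (Suc m) x) - g (y m x))"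
      using sum_lessThan_telescope[of "\<lambda>m. g (y m x)" ?L] by simp
    also have "\<dots> = (\<Sum>m<?L. \<Sum>k\<in>I. c k / y m x ^ k)"
    proof (rule sum.cong)
      fix m assume "m \<in> {..<?L}"
      then have "poly A (y m x) \<noteq> 0" "poly A (y (Suc m) x) \<noteq> 0" "y m x \<noteq> 0" using elim by auto
      moreover have "y (Suc m) x = y m x + 1" by (simp add: y_def)
      ultimately show "g (y (Suc m) x) - g (y m x) = (\<Sum>k\<in>I. c k / y m x ^ k)"
        unfolding g_def using eq[of "y m x"] by simp
    qed simp
    finally show ?case by (simp add: sum_distrib_left)
  qed
  then have "((\<lambda>x. \<Sum>m<?L. x ^ K * (\<Sum>k\<in>I. c k / y m x ^ k)) \<longlongrightarrow> 0) (at 0)"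
    using lim1 by (rule Lim_transform_eventually[rotated])
  then have "(\<Sum>m<?L. if m = i then c K else 0) = 0"
    by (intro tendsto_unique[OF _ lim2]) simp_all
  then show False using c j by simp
qed

text \<open>\<open>B / A\<close> has period 1, hence is constant along all large integers, and
  polynomials that agree at infinitely many points are equal.\<close>

lemma periodic_ratio_constant:
  fixes A B :: "real poly"
  assumes A: "A \<noteq> 0" and eq: "\<And>x. poly A x * poly B (x + 1) = poly A (x + 1) * poly B x"
  shows "\<exists>c. B = smult c A"
proof -
  obtain n0 where n0: "\<And>n. n \<ge> n0 \<Longrightarrow> poly A (real n) \<noteq> 0"
    using finite_nat_roots(1)[OF A] by (auto simp: finite_nat_set_iff_bounded_le not_le[symmetric])
      (metis Suc_n_not_le_n order_trans)
  define c where "c = poly B (real n0) / poly A (real n0)"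
  have "poly B (real n) = c * poly A (real n)" if "n \<ge> n0" for n
    using that
  proof (induction rule: dec_induct)
    case base
    then show ?case using n0[of n0] by (simp add: c_def)
  next
    case (step n)
    have "poly A (real n) * poly B (real n + 1) = poly A (real n) * (c * poly A (real n + 1))"
      using eq[of "real n"] step.IH by (simp add: mult.commute)
    then show ?case using n0[OF step(1)] by (simp add: add.commute)
  qed
  then have "{n0..} \<subseteq> {n. poly (B - smult c A) (real n) = 0}" by auto
  then have "infinite {n. poly (B - smult c A) (real n) = 0}"
    using infinite_Ici finite_subset by blast
  then have "B - smult c A = 0" using finite_nat_roots(1) by blast
  then show ?thesis by (intro exI[of _ c]) simp
qed

text \<open>Polynomial coefficients are needed to close the induction: eliminating one word of
  maximal length between the relations at \<open>N\<close> and \<open>N + 1\<close> produces them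
  even from constants. The eliminated relation has a smaller maximal length or fewer words of that
  length, so it is trivial. Its top coefficients then say that all top coefficients of the original
  relation are proportional, and the coefficient at the tail \<open>u\<close> of a top word turns
  into a rational antidifference of a sum of pure powers, which cannot exist.\<close>

lemma zeta_trunc_poly_independent:
  fixes P :: "nat list \<Rightarrow> real poly"
  assumes "finite F" "F \<subseteq> lists {1..}" "\<And>w. w \<in> F \<Longrightarrow> P w \<noteq> 0"
    and "\<And>N. N \<ge> 1 \<Longrightarrow> (\<Sum>w\<in>F. poly (P w) (real N) * real_of_rat (zeta_trunc_word N w)) = 0"
  shows "F = {}"
  using assms
proof (induction F arbitrary: P rule: wf_induct_rule[OF wf_measures[of
      "[\<lambda>F. Max (length ` F), \<lambda>F. card {w\<in>F. length w = Max (length ` F)}]"]])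
  case (1 F)
  note fin = "1.prems"(1) and F1 = "1.prems"(2) and nz = "1.prems"(3) and rel = "1.prems"(4)
  define S where "S N w = real_of_rat (zeta_trunc_word N w)" for N w
  define d where "d = Max (length ` F)"
  show "F = {}"
  proof (rule ccontr)
    assume ne: "F \<noteq> {}"
    have dle: "length w \<le> d" if "w \<in> F" for w using that fin by (auto simp: d_def)
    have "d \<in> length ` F" unfolding d_def using fin ne by (intro Max_in) auto
    then obtain w1 where w1: "w1 \<in> F" "length w1 = d" by auto
    have d0: "d \<noteq> 0"
    proof
      assume "d = 0"
      then have F: "F = {[]}" using dle ne by auto
      have "poly (P []) (real N) = 0" if "N \<ge> 1" for N using rel[OF that] by (simp add: F)
      then have "{1..} \<subseteq> {n. poly (P []) (real n) = 0}" by auto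
      then have "infinite {n. poly (P []) (real n) = 0}" using infinite_Ici finite_subset by blast
      then show False using finite_nat_roots(1) nz F by blast
    qed
    define Ks where "Ks w = {k. k # w \<in> F}" for w
    have finK: "finite (Ks w)" for w
      using finite_vimageI[OF fin, of "\<lambda>k. k # w"] by (simp add: Ks_def vimage_def inj_def)
    define u where "u = tl w1"
    \<comment> \<open>The largest first letter among the words with tail \<open>u\<close> provides
      the highest pole in the final contradiction.\<close>
    define k0 where "k0 = Max (Ks u)"
    define w0 where "w0 = k0 # u"
    have "w1 = hd w1 # u" using w1 d0 by (cases w1) (auto simp: u_def)
    then have "hd w1 \<in> Ks u" using w1 by (simp add: Ks_def)
    then have "Ks u \<noteq> {}" by blast
    then have k0: "k0 \<in> Ks u" unfolding k0_def using finK by (rule Max_in[rotated])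
    then have w0: "w0 \<in> F" "length w0 = d" using w1 d0 by (auto simp: w0_def Ks_def u_def)
    define K where "K = Max (insert 0 (hd ` F))"
    have hdK: "hd v \<le> K" if "v \<in> F" for v using that fin by (auto simp: K_def)
    define sh where "sh p = pcompose p [:1, 1:]" for p :: "real poly"
    have sh: "poly (sh p) x = poly p (x + 1)" for p x by (simp add: sh_def poly_pcompose add.commute)
    \<comment> \<open>\<open>Q w\<close> is the coefficient of \<open>w\<close> in
      \<open>N ^ K * (P w0 (N) * rel (N + 1) - P w0 (N + 1) * rel (N))\<close>. The second sum
      collects the words \<open>k # w\<close> that lose their first letter when \<open>N\<close>
      increases, and \<open>N ^ K\<close> clears the denominators \<open>N ^ k\<close>. By
      construction \<open>Q w0 = 0\<close>.\<close>
    define Q where "Q w = (if w \<in> F then monom 1 K * (P w0 * sh (P w) - sh (P w0) * P w) else 0)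
        + (\<Sum>k\<in>Ks w. monom 1 (K - k) * (P w0 * sh (P (k # w))))" for w
    let ?G = "F \<union> tl ` F"
    have finG: "finite ?G" using fin by simp
    have relQ: "(\<Sum>w\<in>?G. poly (Q w) (real N) * S N w) = 0" if N: "N \<ge> 1" for N
    proof -
      let ?x = "real N"
      let ?f = "\<lambda>v. ?x ^ (K - hd v) * poly (P v) (?x + 1) * S N (tl v)"
      have "(\<Sum>w\<in>?G. \<Sum>k\<in>Ks w. ?f (k # w)) = (\<Sum>(w, k)\<in>(SIGMA w:?G. Ks w). ?f (k # w))"
        using finG finK by (subst sum.Sigma) auto
      also have "\<dots> = (\<Sum>v\<in>F - {[]}. ?f v)"
        by (rule sum.reindex_bij_witness[of _ "\<lambda>v. (tl v, hd v)" "\<lambda>(w, k). k # w"])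
          (auto simp: Ks_def image_iff intro!: bexI)
      finally have A: "(\<Sum>w\<in>?G. \<Sum>k\<in>Ks w. ?f (k # w)) = (\<Sum>v\<in>F - {[]}. ?f v)" .
      have B: "(\<Sum>w\<in>?G. (if w \<in> F then h w else 0)) = (\<Sum>w\<in>F. h w)" for h :: "nat list \<Rightarrow> real"
        using finG by (simp add: sum.If_cases Int_absorb1)
      have Suc_S: "?x ^ K * S (Suc N) v = ?x ^ K * S N v + ?x ^ (K - hd v) * S N (tl v)"
        if v: "v \<in> F - {[]}" for v
      proof -
        obtain k v' where vk: "v = k # v'" using v by (cases v) auto
        have "k \<le> K" using hdK v vk by force
        then have "?x ^ K * (1 / ?x ^ k) = ?x ^ (K - k)" using N by (simp add: power_diff)
        moreover have "S (Suc N) v = S N v + (1 / ?x ^ k) * S N v'"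
          using N unfolding S_def vk zeta_trunc_word_Suc
          by (simp add: of_rat_add of_rat_mult of_rat_divide of_rat_power)
        ultimately show ?thesis
          by (simp only: vk list.sel distrib_left mult.assoc[symmetric])
      qed
      have C: "(\<Sum>w\<in>F. ?x ^ K * poly (P w) (?x + 1) * S N w) + (\<Sum>v\<in>F - {[]}. ?f v)
          = ?x ^ K * (\<Sum>w\<in>F. poly (P w) (real (Suc N)) * S (Suc N) w)"
      proof -
        have "(\<Sum>v\<in>F - {[]}. ?f v) = (\<Sum>v\<in>F. if v \<noteq> [] then ?f v else 0)"
          using fin by (intro sum.mono_neutral_cong_left) auto
        then have "(\<Sum>w\<in>F. ?x ^ K * poly (P w) (?x + 1) * S N w) + (\<Sum>v\<in>F - {[]}. ?f v)
          = (\<Sum>v\<in>F. poly (P v) (?x + 1) * (?x ^ K * S N v + (if v \<noteq> [] then ?x ^ (K - hd v) * S N (tl v) else 0)))"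
          by (simp add: sum.distrib[symmetric] algebra_simps) (auto intro!: sum.cong simp: algebra_simps)
        also have "\<dots> = (\<Sum>v\<in>F. poly (P v) (?x + 1) * (?x ^ K * S (Suc N) v))"
          using Suc_S by (intro sum.cong) (auto simp: S_def)
        finally show ?thesis by (simp add: sum_distrib_left algebra_simps)
      qed
      have "(\<Sum>w\<in>?G. poly (Q w) ?x * S N w) =
          (\<Sum>w\<in>?G. (if w \<in> F then ?x ^ K * (poly (P w0) ?x * poly (P w) (?x + 1) - poly (P w0) (?x + 1) * poly (P w) ?x) * S N w else 0))
          + poly (P w0) ?x * (\<Sum>w\<in>?G. \<Sum>k\<in>Ks w. ?f (k # w))"
        by (simp add: Q_def poly_sum poly_monom sh sum_distrib_left sum_distrib_right sum.distrib[symmetric])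
          (auto intro!: sum.cong simp: algebra_simps sum_distrib_left sum_distrib_right poly_monom sh)
      also have "\<dots> = poly (P w0) ?x * ((\<Sum>w\<in>F. ?x ^ K * poly (P w) (?x + 1) * S N w) + (\<Sum>v\<in>F - {[]}. ?f v))
          - ?x ^ K * poly (P w0) (?x + 1) * (\<Sum>w\<in>F. poly (P w) ?x * S N w)"
        unfolding A B by (simp add: sum_distrib_left sum_subtractf algebra_simps)
      also have "\<dots> = 0"
        unfolding C using rel[OF N] rel[of "Suc N"] by (simp add: S_def)
      finally show ?thesis .
    qed
    define F' where "F' = {w\<in>?G. Q w \<noteq> 0}"
    have finF': "finite F'" using finG by (simp add: F'_def)
    have topQ: "Q w = monom 1 K * (P w0 * sh (P w) - sh (P w0) * P w)" if "w \<in> F" "length w = d" for w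
    proof -
      have "Ks w = {}" using dle that by (force simp: Ks_def)
      then show ?thesis using that by (simp add: Q_def)
    qed
    have "F' = {}"
    proof (cases "F' = {}")
      case False
      have lentl: "length (tl v) < d" if "v \<in> F" for v
        using dle[OF that] d0 unfolding length_tl by linarith
      have le: "length w \<le> d" if "w \<in> F'" for w
        using that dle lentl[THEN less_imp_le] unfolding F'_def by blast
      have topF': "w \<in> F" if "w \<in> F'" "length w = d" for w
        using that lentl unfolding F'_def by blast
      have "w0 \<notin> F'" using topQ[OF w0] by (simp add: F'_def mult.commute)
      have m: "(F', F) \<in> measures [\<lambda>F. Max (length ` F), \<lambda>F. card {w\<in>F. length w = Max (length ` F)}]"
      proof (cases "Max (length ` F') = d")
        case True
        have "{w\<in>F'. length w = d} \<subset> {w\<in>F. length w = d}"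
          using topF' w0 \<open>w0 \<notin> F'\<close> by blast
        then have "card {w\<in>F'. length w = d} < card {w\<in>F. length w = d}"
          using fin by (intro psubset_card_mono) auto
        then show ?thesis using True by (simp add: d_def[symmetric])
      next
        case neq: False
        have "Max (length ` F') \<le> d" using le finF' False by auto
        then show ?thesis using neq by (simp add: d_def[symmetric])
      qed
      have l: "F' \<subseteq> lists {1..}"
      proof -
        have "tl v \<in> lists {1..}" if "v \<in> F" for v
        proof -
          have "v \<in> lists {1..}" using that F1 by blast
          then show ?thesis by (cases v) simp_all
        qed
        then show ?thesis using F1 unfolding F'_def by blast
      qed
      have r: "(\<Sum>w\<in>F'. poly (Q w) (real N) * real_of_rat (zeta_trunc_word N w)) = 0" if "N \<ge> 1" for N
      proof -
        have "(\<Sum>w\<in>F'. poly (Q w) (real N) * S N w) = (\<Sum>w\<in>?G. poly (Q w) (real N) * S N w)"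
          using finG by (intro sum.mono_neutral_left) (auto simp: F'_def)
        then show ?thesis using relQ[OF that] by (simp add: S_def)
      qed
      have "Q w \<noteq> 0" if "w \<in> F'" for w using that by (simp add: F'_def)
      then show ?thesis by (rule "1.IH"[OF m finF' l _ r])
    qed
    then have Q0: "Q w = 0" if "w \<in> ?G" for w using that by (auto simp: F'_def)
    have "\<exists>c. P w = smult c (P w0)" if w: "w \<in> F" "length w = d" for w
    proof (rule periodic_ratio_constant)
      show "P w0 \<noteq> 0" using nz w0 by blast
      have "P w0 * sh (P w) - sh (P w0) * P w = 0" using topQ[OF w] Q0[of w] w by simp
      then have "poly (P w0 * sh (P w) - sh (P w0) * P w) x = 0" for x by simp
      then show "poly (P w0) x * poly (P w) (x + 1) = poly (P w0) (x + 1) * poly (P w) x" for x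
        by (simp add: sh)
    qed
    then obtain c where c: "\<And>w. w \<in> F \<Longrightarrow> length w = d \<Longrightarrow> P w = smult (c w) (P w0)" by metis
    \<comment> \<open>Since every \<open>P (k # u)\<close> is a multiple of \<open>P w0\<close>, the
      equation \<open>Q u = 0\<close> says that \<open>B / P w0\<close> is the forbidden
      antidifference.\<close>
    define B where "B = (if u \<in> F then P u else 0)"
    have "u \<in> ?G" using w0 by (force simp: w0_def)
    show False
    proof (rule no_rational_antidifference)
      show "P w0 \<noteq> 0" using nz w0 by blast
      show "finite (Ks u)" "k0 \<in> Ks u" by fact+
      show "1 \<le> k \<and> k \<le> k0" if "k \<in> Ks u" for k
        using that F1 finK by (auto simp: k0_def Ks_def)
      show "- c (k0 # u) \<noteq> 0" using c[OF w0] nz[OF w0(1)] by (auto simp: w0_def)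
      fix x assume x: "poly (P w0) x \<noteq> 0" "poly (P w0) (x + 1) \<noteq> 0" "x \<noteq> 0"
      have "k # u \<in> F \<and> length (k # u) = d \<and> k \<le> K" if "k \<in> Ks u" for k
        using that w0 hdK[of "k # u"] by (auto simp: Ks_def w0_def)
      then have *: "(\<Sum>k\<in>Ks u. x ^ (K - k) * (poly (P w0) x * poly (P (k # u)) (x + 1)))
          = (\<Sum>k\<in>Ks u. x ^ K * (poly (P w0) x * poly (P w0) (x + 1)) * (c (k # u) / x ^ k))"
        using x by (intro sum.cong) (auto simp: c power_diff)
      have "poly (Q u) x = 0" using Q0[OF \<open>u \<in> ?G\<close>] by simp
      then have "x ^ K * (poly (P w0) x * poly B (x + 1) - poly (P w0) (x + 1) * poly B x)
          + x ^ K * (poly (P w0) x * poly (P w0) (x + 1)) * (\<Sum>k\<in>Ks u. c (k # u) / x ^ k) = 0"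
        unfolding sum_distrib_left *[symmetric] Q_def B_def
        by (auto simp: poly_sum poly_monom sh split: if_splits)
      then have "x ^ K * ((poly (P w0) x * poly B (x + 1) - poly (P w0) (x + 1) * poly B x)
          + (poly (P w0) x * poly (P w0) (x + 1)) * (\<Sum>k\<in>Ks u. c (k # u) / x ^ k)) = 0"
        by (simp only: distrib_left mult.assoc)
      then have "poly (P w0) x * poly B (x + 1) - poly (P w0) (x + 1) * poly B x
          = - (poly (P w0) x * poly (P w0) (x + 1)) * (\<Sum>k\<in>Ks u. c (k # u) / x ^ k)"
        using x by (simp add: eq_neg_iff_add_eq_0)
      then show "poly B (x + 1) / poly (P w0) (x + 1) - poly B x / poly (P w0) x
          = (\<Sum>k\<in>Ks u. - c (k # u) / x ^ k)"
        using x by (simp add: field_simps sum_negf)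
    qed
  qed
qed

lemma zeta_trunc_inj:
  assumes p: "p \<in> H1" "q \<in> H1" and eq: "\<And>N. N \<ge> 1 \<Longrightarrow> zeta_trunc N p = zeta_trunc N q"
  shows "p = q"
proof -
  let ?r = "p - q"
  have r: "?r \<in> H1" using p unfolding H1_eq by (rule supp_in_diff)
  have "Poly_Mapping.keys ?r = {}"
  proof (rule zeta_trunc_poly_independent)
    show "Poly_Mapping.keys ?r \<subseteq> lists {1..}" using r by (simp add: H1_eq supp_in_def)
    show "[:real_of_rat (Poly_Mapping.lookup ?r w):] \<noteq> 0" if "w \<in> Poly_Mapping.keys ?r" for w
      using that by (simp add: in_keys_iff)
    fix N :: nat assume "N \<ge> 1"
    then have "real_of_rat (zeta_trunc N ?r) = 0" using eq by simp
    then show "(\<Sum>w\<in>Poly_Mapping.keys ?r. poly [:real_of_rat (Poly_Mapping.lookup ?r w):] (real N)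
        * real_of_rat (zeta_trunc_word N w)) = 0"
      unfolding zeta_trunc_def rat_ext_def of_rat_sum of_rat_mult by simp
  qed simp
  then show "p = q" by simp
qed

section \<open>Evaluation of the modified sums\<close>

text \<open>The connector of the connected-sum method. As \<open>a\<close> runs from
  \<open>0\<close> to \<open>N - 1\<close>, it deforms the point mass at \<open>m = 0\<close> into
  the constant 1 on \<open>m < N\<close>, where the denominator never vanishes.\<close>

definition binom_quot :: "nat \<Rightarrow> nat \<Rightarrow> nat \<Rightarrow> rat" where
  "binom_quot N a m = of_nat (a choose m) / of_nat ((N - 1) choose m)"

definition connected_sum :: "nat \<Rightarrow> (nat \<Rightarrow> rat) \<Rightarrow> nat \<Rightarrow> rat" where
  "connected_sum N g a = (\<Sum>m<N. binom_quot N a m * g m)"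

lemma binom_quot_step:
  assumes "Suc m < N"
  shows "binom_quot N (Suc a) (Suc m) - binom_quot N a (Suc m)
    = binom_quot N a m * of_nat (Suc m) / (of_nat N - of_nat (Suc m))"
proof -
  have "Suc m * ((N - 1) choose Suc m) = (N - 1 - m) * ((N - 1) choose m)"
    using binomial_absorption[of m "N - 1"] binomial_absorb_comp[of "N - 1" m] by simp
  then have "of_nat (Suc m) * of_nat ((N - 1) choose Suc m) = (of_nat (N - 1 - m) :: rat) * of_nat ((N - 1) choose m)"
    by (metis of_nat_mult)
  moreover have "of_nat (N - 1 - m) = (of_nat N - of_nat (Suc m) :: rat)"
    using assms by (simp add: of_nat_diff)
  ultimately have eq: "of_nat (Suc m) * of_nat ((N - 1) choose Suc m)
      = (of_nat N - of_nat (Suc m) :: rat) * of_nat ((N - 1) choose m)"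
    by simp
  have "binom_quot N (Suc a) (Suc m) - binom_quot N a (Suc m)
      = of_nat (a choose m) / of_nat ((N - 1) choose Suc m)"
    by (simp add: binom_quot_def add_divide_distrib)
  also have "\<dots> = of_nat (Suc m) * of_nat (a choose m) / (of_nat (Suc m) * of_nat ((N - 1) choose Suc m))"
    by (simp del: of_nat_Suc)
  also have "\<dots> = binom_quot N a m * of_nat (Suc m) / (of_nat N - of_nat (Suc m))"
    unfolding eq binom_quot_def by (simp add: mult_ac del: of_nat_Suc)
  finally show ?thesis .
qed

lemma sum_binomial_over:
  "m \<ge> 1 \<Longrightarrow> (\<Sum>n=1..a. of_nat (n choose m) / of_nat n) = (of_nat (a choose m) / of_nat m :: rat)"
proof (induction a)
  case (Suc a)
  obtain j where j: "m = Suc j" using Suc.prems by (cases m) auto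
  have "of_nat (Suc j) * of_nat (Suc a choose Suc j) = (of_nat (Suc a) * of_nat (a choose j) :: rat)"
    using Suc_times_binomial[of j a] by (metis of_nat_mult)
  then have "of_nat (Suc a choose m) / of_nat (Suc a) = (of_nat (a choose j) / of_nat m :: rat)"
    by (simp add: j divide_simps del: of_nat_Suc binomial_Suc_Suc) (simp add: algebra_simps)
  then show ?case using Suc by (simp add: j add_divide_distrib del: of_nat_Suc)
qed simp

text \<open>Transport of a letter \<open>x\<close>: the hockey-stick sum of
  \<open>(n choose m) / n\<close> reproduces the connector with a factor \<open>1 / m\<close>. It
  fails at \<open>m = 0\<close>, which is why the kernel has to vanish there.\<close>

lemma connected_sum_LX:
  assumes "g 0 = 0"
  shows "(\<Sum>n=1..a. 1 / of_nat n * connected_sum N g n) = connected_sum N (\<lambda>m. g m / of_nat m) a"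
proof -
  have "(\<Sum>n=1..a. 1 / of_nat n * connected_sum N g n)
      = (\<Sum>m<N. \<Sum>n=1..a. of_nat (n choose m) / of_nat n * (g m / of_nat ((N - 1) choose m)))"
    unfolding connected_sum_def binom_quot_def sum_distrib_left
    by (subst sum.swap) (intro sum.cong refl, simp add: mult_ac)
  also have "\<dots> = (\<Sum>m<N. (\<Sum>n=1..a. of_nat (n choose m) / of_nat n) * (g m / of_nat ((N - 1) choose m)))"
    by (simp only: sum_distrib_right)
  also have "\<dots> = connected_sum N (\<lambda>m. g m / of_nat m) a"
    unfolding connected_sum_def binom_quot_def
  proof (rule sum.cong)
    fix m
    show "(\<Sum>n=1..a. of_nat (n choose m) / of_nat n) * (g m / of_nat ((N - 1) choose m)) =
        of_nat (a choose m) / of_nat ((N - 1) choose m) * (g m / of_nat m)"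
    proof (cases "m = 0")
      case False
      then show ?thesis using sum_binomial_over[of m a] by simp
    qed (simp add: assms)
  qed simp
  finally show ?thesis .
qed

text \<open>Induction on \<open>a\<close>: each summand on the right increases by a difference
  \<open>t (m' - 1) - t m'\<close>, so the right side grows by \<open>t m\<close>, which is the new
  term on the left.\<close>

lemma sum_binom_quot_over:
  assumes "a < N"
  shows "(\<Sum>n=1..a. 1 / of_nat (N - n) * binom_quot N (n - 1) m) = (\<Sum>m'=Suc m..<N. binom_quot N a m' / of_nat m')"
  using assms
proof (induction a)
  case 0
  have "(\<Sum>m'=Suc m..<N. binom_quot N 0 m' / of_nat m') = (\<Sum>m'=Suc m..<N. 0)"
    by (intro sum.cong) (auto simp: binom_quot_def)
  then show ?case by simp
next
  case (Suc a)
  define t where "t m = binom_quot N a m / (of_nat N - of_nat (Suc a))" for m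
  have nz: "of_nat N - of_nat (Suc a) \<noteq> (0::rat)"
    using Suc.prems by (metis less_irrefl of_nat_eq_iff right_minus_eq)
  have step: "t j - t (Suc j) = (binom_quot N (Suc a) (Suc j) - binom_quot N a (Suc j)) / of_nat (Suc j)"
    if "Suc j < N" for j
  proof -
    have nz': "of_nat N - of_nat (Suc j) \<noteq> (0::rat)"
      using that by (metis less_irrefl of_nat_eq_iff right_minus_eq)
    have "binom_quot N a (Suc j) = binom_quot N a j * (of_nat a - of_nat j) / (of_nat N - of_nat (Suc j))"
    proof -
      have "of_nat (Suc a choose Suc j) * of_nat (Suc j) = (of_nat (Suc a) * of_nat (a choose j) :: rat)"
        using Suc_times_binomial[of j a] by (metis of_nat_mult mult.commute)
      then have "binom_quot N (Suc a) (Suc j) * of_nat (Suc j)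
          = of_nat (Suc a) * of_nat (a choose j) / of_nat ((N - 1) choose Suc j)"
        by (simp add: binom_quot_def del: of_nat_Suc binomial_Suc_Suc)
      moreover have "binom_quot N (Suc a) (Suc j) - binom_quot N a (Suc j)
          = of_nat (a choose j) / of_nat ((N - 1) choose Suc j)"
        by (simp add: binom_quot_def add_divide_distrib)
      ultimately have "binom_quot N (Suc a) (Suc j) * of_nat (Suc j)
          = of_nat (Suc a) * (binom_quot N (Suc a) (Suc j) - binom_quot N a (Suc j))"
        by simp
      then have "of_nat (Suc j) * binom_quot N a (Suc j)
          = (of_nat a - of_nat j) * (binom_quot N (Suc a) (Suc j) - binom_quot N a (Suc j))"
        by (simp add: algebra_simps)
      also have "\<dots> = of_nat (Suc j) * (binom_quot N a j * (of_nat a - of_nat j) / (of_nat N - of_nat (Suc j)))"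
        unfolding binom_quot_step[OF that] by simp
      finally show ?thesis by (simp only: mult_cancel_left of_nat_eq_0_iff) simp
    qed
    then have "t j - t (Suc j) = binom_quot N a j * (1 - (of_nat a - of_nat j) / (of_nat N - of_nat (Suc j))) / (of_nat N - of_nat (Suc a))"
      by (simp add: t_def diff_divide_distrib right_diff_distrib)
    also have "1 - (of_nat a - of_nat j) / (of_nat N - of_nat (Suc j)) = (of_nat N - of_nat (Suc a) :: rat) / (of_nat N - of_nat (Suc j))"
      using nz' by (simp add: divide_simps)
    also have "binom_quot N a j * \<dots> / (of_nat N - of_nat (Suc a)) = binom_quot N a j / (of_nat N - of_nat (Suc j))"
      using nz by simp
    also have "\<dots> = (binom_quot N (Suc a) (Suc j) - binom_quot N a (Suc j)) / of_nat (Suc j)"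
      unfolding binom_quot_step[OF that] by (simp del: of_nat_Suc)
    finally show ?thesis .
  qed
  have "(\<Sum>m'=Suc m..<N. binom_quot N (Suc a) m' / of_nat m') - (\<Sum>m'=Suc m..<N. binom_quot N a m' / of_nat m')
      = (\<Sum>m'=Suc m..<N. t (m' - 1) - t m')"
    unfolding sum_subtractf[symmetric]
  proof (rule sum.cong)
    fix m' assume "m' \<in> {Suc m..<N}"
    then show "binom_quot N (Suc a) m' / of_nat m' - binom_quot N a m' / of_nat m' = t (m' - 1) - t m'"
      using step[of "m' - 1"] by (simp add: diff_divide_distrib)
  qed simp
  also have "\<dots> = t m"
  proof (cases "Suc m \<le> N")
    case True
    have "(\<Sum>m'=Suc m..<N. t (m' - 1) - t m') = - (\<Sum>j=m..<N - 1. t (Suc j) - t j)"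
      using sum.shift_bounds_Suc_ivl[of "\<lambda>m'. t (m' - 1) - t m'" m "N - 1"] Suc.prems
      by (simp add: sum_negf[symmetric])
    also have "\<dots> = t m - t (N - 1)"
      using True by (subst sum_Suc_diff') auto
    \<comment> \<open>The old bound satisfies \<open>a < N - 1\<close>, so the binomial coefficient
      vanishes.\<close>
    also have "t (N - 1) = 0"
      using Suc.prems by (simp add: t_def binom_quot_def binomial_eq_0)
    finally show ?thesis by simp
  next
    case False
    then have "t m = 0" using Suc.prems by (simp add: t_def binom_quot_def binomial_eq_0)
    then show ?thesis using False by simp
  qed
  also have "t m = 1 / of_nat (N - Suc a) * binom_quot N a m"
    using Suc.prems by (simp add: t_def of_nat_diff)
  finally show ?case using Suc by simp
qed

text \<open>Transport of a \<open>y\<close> followed by a strict descent: each kernel index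
  \<open>m\<close> is traded for all larger ones, and interchanging the sums gives the strict
  inequality \<open>m1 < m\<close>.\<close>

lemma connected_sum_LY_strict:
  assumes "a < N"
  shows "(\<Sum>n=1..a. 1 / of_nat (N - n) * connected_sum N g (n - 1))
    = connected_sum N (\<lambda>m. (\<Sum>m1<m. g m1) / of_nat m) a"
proof -
  have "(\<Sum>n=1..a. 1 / of_nat (N - n) * connected_sum N g (n - 1))
      = (\<Sum>m<N. (\<Sum>n=1..a. 1 / of_nat (N - n) * binom_quot N (n - 1) m) * g m)"
    unfolding connected_sum_def sum_distrib_left sum_distrib_right
    by (subst sum.swap) (auto intro!: sum.cong simp: algebra_simps)
  also have "\<dots> = (\<Sum>m<N. \<Sum>m'=Suc m..<N. binom_quot N a m' / of_nat m' * g m)"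
    unfolding sum_binom_quot_over[OF assms] sum_distrib_right ..
  also have "\<dots> = (\<Sum>m'<N. \<Sum>m<m'. binom_quot N a m' / of_nat m' * g m)"
    unfolding sum.Sigma[OF finite_lessThan ballI[OF finite_atLeastLessThan]]
      sum.Sigma[OF finite_lessThan ballI[OF finite_lessThan]]
    by (rule sum.reindex_bij_witness[of _ prod.swap prod.swap]) auto
  also have "\<dots> = connected_sum N (\<lambda>m. (\<Sum>m1<m. g m1) / of_nat m) a"
    by (simp add: connected_sum_def sum_distrib_left sum_divide_distrib)
  finally show ?thesis .
qed

text \<open>Pascal's rule lowers the argument of the connector by one at the price of a corrected
  kernel. This reduces the weak descent between adjacent \<open>y\<close> to the strict one, and the
  correction is where the factor \<open>1 / (N - m)\<close> originates.\<close>

lemma connected_sum_pred: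
  assumes "1 \<le> n"
  shows "connected_sum N g n
    = connected_sum N (\<lambda>m. g m + of_nat (Suc m) * g (Suc m) / (of_nat N - of_nat (Suc m))) (n - 1)"
proof -
  obtain a where a: "n = Suc a" using assms by (cases n) auto
  have "(\<Sum>m<N. binom_quot N (Suc a) m * g m) - (\<Sum>m<N. binom_quot N a m * g m)
      = (\<Sum>m<N. (binom_quot N (Suc a) m - binom_quot N a m) * g m)"
    by (simp add: sum_subtractf left_diff_distrib)
  also have "\<dots> = (\<Sum>m<N - 1. (binom_quot N (Suc a) (Suc m) - binom_quot N a (Suc m)) * g (Suc m))"
  proof (cases N)
    case (Suc N')
    then show ?thesis by (simp add: sum.lessThan_Suc_shift binom_quot_def del: sum.lessThan_Suc)
  qed simp
  also have "\<dots> = (\<Sum>m<N - 1. binom_quot N a m * (of_nat (Suc m) * g (Suc m) / (of_nat N - of_nat (Suc m))))"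
  proof (rule sum.cong)
    fix m assume "m \<in> {..<N - 1}"
    then have "Suc m < N" by auto
    then show "(binom_quot N (Suc a) (Suc m) - binom_quot N a (Suc m)) * g (Suc m) =
        binom_quot N a m * (of_nat (Suc m) * g (Suc m) / (of_nat N - of_nat (Suc m)))"
      by (simp add: binom_quot_step del: of_nat_Suc)
  qed simp
  also have "\<dots> = (\<Sum>m<N. binom_quot N a m * (of_nat (Suc m) * g (Suc m) / (of_nat N - of_nat (Suc m))))"
    by (cases N) simp_all
  finally show ?thesis
    unfolding a connected_sum_def by (simp add: distrib_left sum.distrib algebra_simps del: of_nat_Suc)
qed

lemma connected_sum_LY_weak:
  assumes "a < N"
  shows "(\<Sum>n=1..a. 1 / of_nat (N - n) * connected_sum N g n)
    = connected_sum N (\<lambda>m. ((\<Sum>m1<m. g m1) + (\<Sum>m1=1..m. of_nat m1 * g m1 / (of_nat N - of_nat m1))) / of_nat m) a"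
proof -
  let ?h = "\<lambda>m. g m + of_nat (Suc m) * g (Suc m) / (of_nat N - of_nat (Suc m))"
  have "(\<Sum>n=1..a. 1 / of_nat (N - n) * connected_sum N g n)
      = (\<Sum>n=1..a. 1 / of_nat (N - n) * connected_sum N ?h (n - 1))"
    by (intro sum.cong) (simp_all only: connected_sum_pred atLeastAtMost_iff)
  also have "\<dots> = connected_sum N (\<lambda>m. (\<Sum>m1<m. ?h m1) / of_nat m) a"
    by (rule connected_sum_LY_strict[OF assms])
  also have "(\<lambda>m. (\<Sum>m1<m. ?h m1) / of_nat m)
      = (\<lambda>m. ((\<Sum>m1<m. g m1) + (\<Sum>m1=1..m. of_nat m1 * g m1 / (of_nat N - of_nat m1))) / of_nat m)"
  proof
    fix m
    have "(\<Sum>m1=1..m. of_nat m1 * g m1 / (of_nat N - of_nat m1))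
        = (\<Sum>m1<m. of_nat (Suc m1) * g (Suc m1) / (of_nat N - of_nat (Suc m1)))"
      by (rule sum.reindex_bij_witness[of _ Suc "\<lambda>n. n - 1"]) auto
    then show "(\<Sum>m1<m. ?h m1) / of_nat m
      = ((\<Sum>m1<m. g m1) + (\<Sum>m1=1..m. of_nat m1 * g m1 / (of_nat N - of_nat m1))) / of_nat m"
      by (simp add: sum.distrib)
  qed
  finally show ?thesis .
qed

lemma connected_sum_top: "connected_sum N g (N - 1) = (\<Sum>m<N. g m)"
  unfolding connected_sum_def binom_quot_def
  by (intro sum.cong) (auto simp: binomial_eq_0_iff)

lemma modified_partial_LX_power:
  assumes "\<And>a. a < N \<Longrightarrow> modified_partial N w a = connected_sum N g a" "g 0 = 0" "a < N"
  shows "modified_partial N (replicate c LX @ w) a = connected_sum N (\<lambda>m. g m / of_nat m ^ c) a"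
  using assms(3)
proof (induction c arbitrary: a)
  case (Suc c)
  have "modified_partial N (replicate (Suc c) LX @ w) a
      = (\<Sum>n=1..a. 1 / of_nat n * modified_partial N (replicate c LX @ w) n)"
    by simp
  also have "\<dots> = (\<Sum>n=1..a. 1 / of_nat n * connected_sum N (\<lambda>m. g m / of_nat m ^ c) n)"
    using Suc by (intro sum.cong) auto
  also have "\<dots> = connected_sum N (\<lambda>m. g m / of_nat m ^ c / of_nat m) a"
    by (rule connected_sum_LX) (simp add: assms(2))
  also have "(\<lambda>m. g m / of_nat m ^ c / of_nat m) = (\<lambda>m. g m / of_nat m ^ Suc c)"
    by (simp add: fun_eq_iff mult.commute)
  finally show ?case .
qed (simp add: assms(1))

lemma xy_word_simps [simp]:
  "xy_word [] = []" "xy_word (k # w) = replicate (k - 1) LX @ LY # xy_word w"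
  by (simp_all add: xy_word_def)

lemma modified_partial_strict_block:
  assumes g: "\<And>a. a < N \<Longrightarrow> modified_partial N w a = connected_sum N g a"
    and w: "w = [] \<or> take 1 w = [LX]" and "k \<ge> 1" "a < N"
  shows "modified_partial N (replicate (k - 1) LX @ LY # w) a
    = connected_sum N (\<lambda>m. (\<Sum>m1<m. g m1) / of_nat m ^ k) a"
proof -
  have y: "modified_partial N (LY # w) a = connected_sum N (\<lambda>m. (\<Sum>m1<m. g m1) / of_nat m) a" if "a < N" for a
  proof -
    have "modified_partial N (LY # w) a = (\<Sum>n=1..a. 1 / of_nat (N - n) * modified_partial N w (n - 1))"
      using w by (auto intro!: sum.cong)
    also have "\<dots> = (\<Sum>n=1..a. 1 / of_nat (N - n) * connected_sum N g (n - 1))"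
      using that by (intro sum.cong) (auto simp: g)
    finally show ?thesis by (simp only: connected_sum_LY_strict[OF that])
  qed
  have "modified_partial N (replicate (k - 1) LX @ LY # w) a
    = connected_sum N (\<lambda>m. (\<Sum>m1<m. g m1) / of_nat m / of_nat m ^ (k - 1)) a"
    by (rule modified_partial_LX_power[OF y]) (use assms in auto)
  also have "(\<lambda>m. (\<Sum>m1<m. g m1) / of_nat m / of_nat m ^ (k - 1)) = (\<lambda>m. (\<Sum>m1<m. g m1) / of_nat m ^ k)"
    using \<open>k \<ge> 1\<close> by (auto simp: fun_eq_iff power_eq_if)
  finally show ?thesis .
qed

lemma modified_partial_weak_block:
  assumes g: "\<And>a. a < N \<Longrightarrow> modified_partial N w a = connected_sum N g a"
    and w: "take 1 w = [LY]" and "k \<ge> 1" "a < N"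
  shows "modified_partial N (replicate (k - 1) LX @ LY # w) a
    = connected_sum N (\<lambda>m. ((\<Sum>m1<m. g m1) + (\<Sum>m1=1..m. of_nat m1 * g m1 / (of_nat N - of_nat m1))) / of_nat m ^ k) a"
    (is "_ = connected_sum N (\<lambda>m. ?h m / of_nat m ^ k) a")
proof -
  have y: "modified_partial N (LY # w) a = connected_sum N (\<lambda>m. ?h m / of_nat m) a" if "a < N" for a
  proof -
    have "modified_partial N (LY # w) a = (\<Sum>n=1..a. 1 / of_nat (N - n) * modified_partial N w n)"
      using w by auto
    also have "\<dots> = (\<Sum>n=1..a. 1 / of_nat (N - n) * connected_sum N g n)"
      using that by (intro sum.cong) (auto simp: g)
    finally show ?thesis by (simp only: connected_sum_LY_weak[OF that])
  qed
  have "modified_partial N (replicate (k - 1) LX @ LY # w) a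
    = connected_sum N (\<lambda>m. ?h m / of_nat m / of_nat m ^ (k - 1)) a"
    by (rule modified_partial_LX_power[OF y]) (use assms in auto)
  also have "(\<lambda>m. ?h m / of_nat m / of_nat m ^ (k - 1)) = (\<lambda>m. ?h m / of_nat m ^ k)"
    using \<open>k \<ge> 1\<close> by (auto simp: fun_eq_iff power_eq_if)
  finally show ?thesis .
qed

section \<open>Modified sums of words with no \<open>z_1\<close> or with one\<close>

lemma sum_lessThan_eq_1: "(\<Sum>m1<m. g m1) = (\<Sum>m1=1..<m. g m1)" if "g 0 = (0::rat)" for m :: nat
  using that by (intro sum.mono_neutral_right) (auto simp: not_le)

text \<open>For the empty word the point mass at \<open>0\<close> makes the connected sum the
  constant 1. For other words with positive letters the value at \<open>m = 0\<close> is
  \<open>0\<close>, because division by zero yields zero.\<close>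

definition word_kernel :: "nat list \<Rightarrow> nat \<Rightarrow> rat" where
  "word_kernel w m = (case w of [] \<Rightarrow> if m = 0 then 1 else 0 | k # w' \<Rightarrow> zeta_trunc_word m w' / of_nat m ^ k)"

lemma sum_word_kernel:
  assumes "w \<in> lists {1..}" "m \<ge> 1"
  shows "(\<Sum>m1<m. word_kernel w m1) = zeta_trunc_word m w"
proof (cases w)
  case Nil
  then show ?thesis using assms by (simp add: word_kernel_def sum.delta)
next
  case (Cons k v)
  then have "k \<ge> 1" using assms by auto
  then have "word_kernel w 0 = 0" using Cons by (simp add: word_kernel_def power_0_left)
  then show ?thesis
    by (subst sum_lessThan_eq_1) (simp_all add: Cons word_kernel_def zeta_trunc_word_Cons)
qed

lemma connected_sum_cong: "(\<And>m. m < N \<Longrightarrow> g m = h m) \<Longrightarrow> connected_sum N g a = connected_sum N h a"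
  by (auto simp: connected_sum_def intro!: sum.cong)

lemma xy_word_starts_LX: "w \<in> lists {2..} \<Longrightarrow> w = [] \<or> take 1 (xy_word w) = [LX]"
proof (cases w)
  case (Cons k v)
  moreover assume "w \<in> lists {2..}"
  ultimately obtain j where "k = Suc (Suc j)" by (cases k; cases "k - 1") auto
  then show ?thesis using Cons by simp
qed simp

text \<open>With all letters at least 2, every \<open>LY\<close> ends the word or is followed by
  \<open>LX\<close>, so only strict blocks occur.\<close>

lemma modified_partial_word:
  assumes "w \<in> lists {2..}" "a < N"
  shows "modified_partial N (xy_word w) a = connected_sum N (word_kernel w) a"
  using assms
proof (induction w arbitrary: a)
  case Nil
  have "connected_sum N (word_kernel []) a = (\<Sum>m<N. if m = 0 then 1 else 0)"
    unfolding connected_sum_def by (intro sum.cong) (auto simp: word_kernel_def binom_quot_def)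
  then show ?case using Nil by (simp add: sum.delta)
next
  case (Cons k w)
  then have w: "w \<in> lists {2..}" "k \<ge> 2" by auto
  have "modified_partial N (xy_word (k # w)) a = connected_sum N (\<lambda>m. (\<Sum>m1<m. word_kernel w m1) / of_nat m ^ k) a"
    unfolding xy_word_simps
    by (rule modified_partial_strict_block) (use Cons w xy_word_starts_LX[OF w(1)] in auto)
  also have "\<dots> = connected_sum N (word_kernel (k # w)) a"
  proof (rule connected_sum_cong)
    fix m
    show "(\<Sum>m1<m. word_kernel w m1) / of_nat m ^ k = word_kernel (k # w) m"
    proof (cases "m = 0")
      case True
      then show ?thesis using w by (simp add: word_kernel_def power_0_left)
    next
      case False
      then show ?thesis
        using sum_word_kernel[of w m] w lists2_lists1 by (auto simp: word_kernel_def)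
    qed
  qed
  finally show ?case .
qed

lemma zeta_modified_word_Hge2:
  assumes "w \<in> lists {2..}" "N \<ge> 1"
  shows "zeta_modified_xy N (xy_word w) = zeta_trunc_word N w"
proof -
  have "w \<in> lists {1..}" using assms lists2_lists1 by blast
  then show ?thesis
    using assms
    by (simp only: zeta_modified_xy_eq modified_partial_word connected_sum_top sum_word_kernel)
qed

lemma zeta_modified_Hge2:
  assumes "p \<in> Hge2" "N \<ge> 1"
  shows "zeta_modified N p = zeta_trunc N p"
  using zeta_modified_linear zeta_trunc_linear assms(1)[unfolded Hge2_eq]
  by (rule linear_eq_on_words) (simp only: zeta_modified_word zeta_trunc_of_word zeta_modified_word_Hge2 assms(2))

text \<open>The sum over \<open>N > p\<^sub>1 > \<dots> > p\<^sub>i \<ge> m > q\<^sub>1 > \<dots>\<close> of the usual summand times \<open>1 / (M - m)\<close>.\<close>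

fun gap_sum :: "nat \<Rightarrow> nat list \<Rightarrow> nat list \<Rightarrow> nat \<Rightarrow> rat" where
  "gap_sum M [] Q N = (\<Sum>m=1..<N. zeta_trunc_word m Q / (of_nat M - of_nat m))"
| "gap_sum M (k # P) Q N = (\<Sum>p=1..<N. 1 / of_nat p ^ k * gap_sum M P Q (if P = [] then Suc p else p))"

text \<open>Two adjacent \<open>LY\<close> occur only between the last letter before
  \<open>z_1\<close> and \<open>z_1\<close> itself. That block is weak and creates the gap sum; all
  blocks further out are strict and merely add outer summations. The bound \<open>Suc m\<close> for
  empty \<open>P\<close> records the weak inequality at the gap.\<close>

lemma modified_partial_insert_1:
  assumes "k # P \<in> lists {2..}" "Q \<in> lists {2..}" "a < N"
  shows "modified_partial N (xy_word ((k # P) @ 1 # Q)) a = connected_sum N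
    (\<lambda>m. (zeta_trunc_word m (P @ 1 # Q) + gap_sum N P Q (if P = [] then Suc m else m)) / of_nat m ^ k) a"
  using assms
proof (induction P arbitrary: k a)
  case Nil
  have one: "modified_partial N (xy_word (1 # Q)) a = connected_sum N (\<lambda>m. zeta_trunc_word m Q / of_nat m) a" if "a < N" for a
  proof -
    have "modified_partial N (xy_word (1 # Q)) a = connected_sum N (\<lambda>m. (\<Sum>m1<m. word_kernel Q m1) / of_nat m ^ 1) a"
      unfolding xy_word_simps
      by (rule modified_partial_strict_block)
        (use Nil that xy_word_starts_LX[OF Nil(2)] in \<open>auto simp: modified_partial_word\<close>)
    also have "\<dots> = connected_sum N (\<lambda>m. zeta_trunc_word m Q / of_nat m) a"
    proof (rule connected_sum_cong)
      fix m
      show "(\<Sum>m1<m. word_kernel Q m1) / of_nat m ^ 1 = zeta_trunc_word m Q / of_nat m"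
        using sum_word_kernel[of Q m] Nil lists2_lists1 by (cases "m = 0") auto
    qed
    finally show ?thesis .
  qed
  have "modified_partial N (xy_word ([k] @ 1 # Q)) a = connected_sum N
      (\<lambda>m. ((\<Sum>m1<m. zeta_trunc_word m1 Q / of_nat m1)
        + (\<Sum>m1=1..m. of_nat m1 * (zeta_trunc_word m1 Q / of_nat m1) / (of_nat N - of_nat m1))) / of_nat m ^ k) a"
    unfolding append_Cons append_Nil xy_word_simps(2)[of k]
    by (rule modified_partial_weak_block[OF one]) (use Nil in auto)
  also have "\<dots> = connected_sum N
    (\<lambda>m. (zeta_trunc_word m ([] @ 1 # Q) + gap_sum N [] Q (if [] = ([]::nat list) then Suc m else m)) / of_nat m ^ k) a"
  proof (rule connected_sum_cong)
    fix m
    have "(\<Sum>m1<m. zeta_trunc_word m1 Q / of_nat m1) = zeta_trunc_word m (1 # Q)"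
      by (subst sum_lessThan_eq_1) (simp_all add: zeta_trunc_word_Cons)
    moreover have "(\<Sum>m1=1..m. of_nat m1 * (zeta_trunc_word m1 Q / of_nat m1) / (of_nat N - of_nat m1)) = gap_sum N [] Q (Suc m)"
      unfolding gap_sum.simps atLeastLessThanSuc_atLeastAtMost by (intro sum.cong) auto
    ultimately show "((\<Sum>m1<m. zeta_trunc_word m1 Q / of_nat m1)
        + (\<Sum>m1=1..m. of_nat m1 * (zeta_trunc_word m1 Q / of_nat m1) / (of_nat N - of_nat m1))) / of_nat m ^ k
        = (zeta_trunc_word m ([] @ 1 # Q) + gap_sum N [] Q (if [] = ([]::nat list) then Suc m else m)) / of_nat m ^ k"
      by simp
  qed
  finally show ?case .
next
  case (Cons k' P)
  let ?g = "\<lambda>m. (zeta_trunc_word m (P @ 1 # Q) + gap_sum N P Q (if P = [] then Suc m else m)) / of_nat m ^ k'"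
  have k': "k' \<ge> 2" and k: "k \<ge> 2" using Cons.prems by auto
  then obtain j where "k' = Suc (Suc j)" by (cases k'; cases "k' - 1") auto
  then have "take 1 (xy_word ((k' # P) @ 1 # Q)) = [LX]" by simp
  then have "modified_partial N (xy_word ((k # k' # P) @ 1 # Q)) a = connected_sum N (\<lambda>m. (\<Sum>m1<m. ?g m1) / of_nat m ^ k) a"
    unfolding append_Cons[of k] xy_word_simps(2)[of k]
    by (intro modified_partial_strict_block) (use Cons in auto)
  also have "(\<lambda>m. (\<Sum>m1<m. ?g m1) / of_nat m ^ k)
      = (\<lambda>m. (zeta_trunc_word m ((k' # P) @ 1 # Q) + gap_sum N (k' # P) Q (if k' # P = [] then Suc m else m)) / of_nat m ^ k)"
  proof
    fix m
    have "(\<Sum>m1<m. ?g m1) = (\<Sum>m1=1..<m. ?g m1)"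
      by (rule sum_lessThan_eq_1) (use k' in \<open>simp add: power_0_left\<close>)
    also have "\<dots> = zeta_trunc_word m ((k' # P) @ 1 # Q) + gap_sum N (k' # P) Q m"
      by (simp add: zeta_trunc_word_Cons sum.distrib add_divide_distrib)
    finally show "(\<Sum>m1<m. ?g m1) / of_nat m ^ k
      = (zeta_trunc_word m ((k' # P) @ 1 # Q) + gap_sum N (k' # P) Q (if k' # P = [] then Suc m else m)) / of_nat m ^ k"
      by simp
  qed
  finally show ?case .
qed

lemma zeta_modified_insert_1:
  assumes "P \<in> lists {2..}" "P \<noteq> []" "Q \<in> lists {2..}" "N \<ge> 1"
  shows "zeta_modified_xy N (xy_word (P @ 1 # Q)) = zeta_trunc_word N (P @ 1 # Q) + gap_sum N P Q N"
proof -
  obtain k P' where P: "P = k # P'" using assms by (cases P) auto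
  let ?g = "\<lambda>m. (zeta_trunc_word m (P' @ 1 # Q) + gap_sum N P' Q (if P' = [] then Suc m else m)) / of_nat m ^ k"
  have "zeta_modified_xy N (xy_word (P @ 1 # Q)) = (\<Sum>m<N. ?g m)"
    using assms unfolding zeta_modified_xy_eq P
    by (subst modified_partial_insert_1) (simp_all add: connected_sum_top[simplified])
  also have "\<dots> = (\<Sum>m=1..<N. ?g m)"
    by (rule sum_lessThan_eq_1) (use assms P in \<open>simp add: power_0_left\<close>)
  finally show ?thesis
    by (simp add: P zeta_trunc_word_Cons sum.distrib add_divide_distrib)
qed

section \<open>Words with a single letter \<open>z\<^sub>1\<close>\<close>

text \<open>The truncated sum of \<open>P @ Q\<close> with the factor \<open>1 / (M - m)\<close>
  attached to the index \<open>m\<close> of the first letter of \<open>Q\<close>. For empty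
  \<open>Q\<close> this index counts as \<open>0\<close>, which gives \<open>1 / M\<close>.\<close>

fun pole_sum :: "nat \<Rightarrow> nat list \<Rightarrow> nat list \<Rightarrow> nat \<Rightarrow> rat" where
  "pole_sum M [] [] N = 1 / of_nat M"
| "pole_sum M [] (k # Q) N = (\<Sum>m=1..<N. 1 / of_nat m ^ k * zeta_trunc_word m Q / (of_nat M - of_nat m))"
| "pole_sum M (p # P) Q N = (\<Sum>m=1..<N. 1 / of_nat m ^ p * pole_sum M P Q m)"

text \<open>The same sum with the pole moved one letter to the left, onto the last letter of
  \<open>P\<close>.\<close>

definition prev_pole_sum :: "nat \<Rightarrow> nat list \<Rightarrow> nat list \<Rightarrow> nat \<Rightarrow> rat" where
  "prev_pole_sum M P Q N = (if P = [] then 0 else pole_sum M (butlast P) (last P # Q) N)"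

lemma partial_fractions:
  fixes x y :: rat
  assumes "x \<noteq> 0" "y \<noteq> 0" "y - x \<noteq> 0"
  shows "1 / (x ^ k * (y - x)) = (\<Sum>a=1..k. 1 / (x ^ a * y ^ (Suc k - a))) + 1 / (y ^ k * (y - x))"
proof (induction k)
  case (Suc k)
  have pf: "1 / (x * (y - x)) = 1 / (y * x) + 1 / (y * (y - x))"
    using assms by (simp add: field_simps)
  have "1 / (x ^ Suc k * (y - x)) = 1 / x * (1 / (x ^ k * (y - x)))" by simp
  also have "\<dots> = (\<Sum>a=1..k. 1 / (x ^ Suc a * y ^ (Suc k - a))) + 1 / y ^ k * (1 / (x * (y - x)))"
    unfolding Suc.IH by (simp add: distrib_left sum_distrib_left mult_ac)
  also have "\<dots> = (\<Sum>a=1..k. 1 / (x ^ Suc a * y ^ (Suc k - a))) + 1 / (x ^ 1 * y ^ Suc k) + 1 / (y ^ Suc k * (y - x))"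
    unfolding pf by (simp add: distrib_left mult_ac)
  also have "(\<Sum>a=1..k. 1 / (x ^ Suc a * y ^ (Suc k - a))) = (\<Sum>a=Suc 1..Suc k. 1 / (x ^ a * y ^ (Suc (Suc k) - a)))"
    unfolding sum.shift_bounds_cl_Suc_ivl by simp
  also have "\<dots> + 1 / (x ^ 1 * y ^ Suc k) = (\<Sum>a=1..Suc k. 1 / (x ^ a * y ^ (Suc (Suc k) - a)))"
    by (subst (2) sum.atLeast_Suc_atMost) (simp_all add: add.commute)
  finally show ?case .
qed simp

lemma zeta_trunc_word_Cons': "zeta_trunc_word N (k # w) = (\<Sum>m=1..<N. zeta_trunc_word m w / of_nat m ^ k)"
  by (simp add: zeta_trunc_word_Cons)

text \<open>Partial fractions of \<open>1 / (m ^ k * (M - m))\<close> leave a remainder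
  \<open>1 / (M ^ k * (M - m))\<close> in which \<open>m\<close> lies strictly below the preceding
  index. The gap sum allows equality as well, and the terms with equality form
  \<open>prev_pole_sum\<close>.\<close>

lemma pole_sum_expand:
  assumes "N \<le> M"
  shows "pole_sum M P (k # Q) N = (\<Sum>a=1..k. zeta_trunc_word N (P @ a # Q) / of_nat M ^ (Suc k - a))
    + (gap_sum M P Q N - prev_pole_sum M P Q N) / of_nat M ^ k"
  using assms
proof (induction P arbitrary: N)
  case Nil
  have "pole_sum M [] (k # Q) N = (\<Sum>m=1..<N. zeta_trunc_word m Q * (1 / (of_nat m ^ k * (of_nat M - of_nat m))))"
    by simp
  also have "\<dots> = (\<Sum>m=1..<N. (\<Sum>a=1..k. zeta_trunc_word m Q / of_nat m ^ a / of_nat M ^ (Suc k - a))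
      + zeta_trunc_word m Q / (of_nat M - of_nat m) / of_nat M ^ k)"
  proof (rule sum.cong)
    fix m assume "m \<in> {1..<N}"
    then have "of_nat m \<noteq> (0::rat)" "of_nat M \<noteq> (0::rat)" "of_nat M - of_nat m \<noteq> (0::rat)"
      using Nil by auto
    from partial_fractions[OF this, of k]
    show "zeta_trunc_word m Q * (1 / (of_nat m ^ k * (of_nat M - of_nat m)))
      = (\<Sum>a=1..k. zeta_trunc_word m Q / of_nat m ^ a / of_nat M ^ (Suc k - a))
      + zeta_trunc_word m Q / (of_nat M - of_nat m) / of_nat M ^ k"
      by (simp only: distrib_left sum_distrib_left) (simp add: mult_ac)
  qed simp
  also have "\<dots> = (\<Sum>a=1..k. zeta_trunc_word N (a # Q) / of_nat M ^ (Suc k - a)) + gap_sum M [] Q N / of_nat M ^ k"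
    unfolding sum.distrib zeta_trunc_word_Cons' gap_sum.simps sum_divide_distrib
    by (subst sum.swap) simp
  finally show ?case by (simp add: prev_pole_sum_def)
next
  case (Cons p P)
  have "pole_sum M (p # P) (k # Q) N = (\<Sum>m=1..<N. 1 / of_nat m ^ p *
      ((\<Sum>a=1..k. zeta_trunc_word m (P @ a # Q) / of_nat M ^ (Suc k - a))
       + (gap_sum M P Q m - prev_pole_sum M P Q m) / of_nat M ^ k))"
    unfolding pole_sum.simps using Cons by (intro sum.cong) auto
  also have "\<dots> = (\<Sum>m=1..<N. \<Sum>a=1..k. 1 / of_nat m ^ p * zeta_trunc_word m (P @ a # Q) / of_nat M ^ (Suc k - a))
      + (\<Sum>m=1..<N. 1 / of_nat m ^ p * (gap_sum M P Q m - prev_pole_sum M P Q m)) / of_nat M ^ k"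
    by (simp only: distrib_left sum.distrib sum_distrib_left sum_divide_distrib times_divide_eq_right)
  also have "(\<Sum>m=1..<N. \<Sum>a=1..k. 1 / of_nat m ^ p * zeta_trunc_word m (P @ a # Q) / of_nat M ^ (Suc k - a))
      = (\<Sum>a=1..k. zeta_trunc_word N ((p # P) @ a # Q) / of_nat M ^ (Suc k - a))"
    unfolding append_Cons zeta_trunc_word_Cons sum_divide_distrib by (rule sum.swap)
  also have "(\<Sum>m=1..<N. 1 / of_nat m ^ p * (gap_sum M P Q m - prev_pole_sum M P Q m))
      = gap_sum M (p # P) Q N - prev_pole_sum M (p # P) Q N"
  proof (cases "P = []")
    case True
    then show ?thesis
      by (simp add: prev_pole_sum_def sum_subtractf[symmetric] atLeastLessThanSuc diff_divide_distrib[symmetric]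
          del: sum_subtractf) (auto intro!: sum.cong simp: algebra_simps add_divide_distrib)
  next
    case False
    then show ?thesis by (simp add: prev_pole_sum_def right_diff_distrib sum_subtractf diff_divide_distrib)
  qed
  finally show ?case .
qed

text \<open>Summation by parts: replacing \<open>M\<close> by \<open>M + 1\<close> shifts
  \<open>m\<close> by one, so the differences of the truncated sum of \<open>Q\<close> appear over
  \<open>M - m\<close>. For empty \<open>Q\<close> only the boundary term \<open>1 / M\<close> at
  \<open>m = 0\<close> arises, whence the convention in \<open>pole_sum\<close>.\<close>

lemma gap_sum_Nil_shift:
  assumes "p < M"
  shows "gap_sum (Suc M) [] Q (Suc p) - gap_sum M [] Q (Suc p)
    = pole_sum M [] Q p - zeta_trunc_word p Q / (of_nat M - of_nat p)"
  using assms
proof (induction p)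
  case 0
  show ?case by (cases Q) simp_all
next
  case (Suc p)
  have e: "of_nat (Suc M) - of_nat (Suc p) = (of_nat M - of_nat p :: rat)" by simp
  have "gap_sum (Suc M) [] Q (Suc (Suc p)) - gap_sum M [] Q (Suc (Suc p))
      = pole_sum M [] Q p - zeta_trunc_word p Q / (of_nat M - of_nat p)
        + zeta_trunc_word (Suc p) Q / (of_nat M - of_nat p)
        - zeta_trunc_word (Suc p) Q / (of_nat M - of_nat (Suc p))"
    using Suc unfolding gap_sum.simps by (simp only: sum.atLeastLessThan_Suc Suc_le_mono e le_add1 One_nat_def) simp
  also have "\<dots> = pole_sum M [] Q (Suc p) - zeta_trunc_word (Suc p) Q / (of_nat M - of_nat (Suc p))"
  proof (cases Q)
    case (Cons q Q')
    then show ?thesis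
      by (cases "p = 0") (simp_all add: zeta_trunc_word_Suc atLeastLessThanSuc add_divide_distrib)
  qed simp
  finally show ?case .
qed

lemma gap_sum_shift:
  assumes "P \<noteq> []" "N \<le> M"
  shows "gap_sum (Suc M) P Q N - gap_sum M P Q N = pole_sum M P Q N - prev_pole_sum M P Q N"
  using assms
proof (induction P arbitrary: N)
  case (Cons k P)
  show ?case
  proof (cases "P = []")
    case True
    have "gap_sum (Suc M) [k] Q N - gap_sum M [k] Q N
        = (\<Sum>p=1..<N. 1 / of_nat p ^ k * (gap_sum (Suc M) [] Q (Suc p) - gap_sum M [] Q (Suc p)))"
      by (simp only: gap_sum.simps(2) if_True simp_thms right_diff_distrib sum_subtractf)
    also have "\<dots> = (\<Sum>p=1..<N. 1 / of_nat p ^ k * (pole_sum M [] Q p - zeta_trunc_word p Q / (of_nat M - of_nat p)))"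
    proof (rule sum.cong)
      fix p assume "p \<in> {1..<N}"
      then have "p < M" using Cons.prems by simp
      then show "1 / of_nat p ^ k * (gap_sum (Suc M) [] Q (Suc p) - gap_sum M [] Q (Suc p))
          = 1 / of_nat p ^ k * (pole_sum M [] Q p - zeta_trunc_word p Q / (of_nat M - of_nat p))"
        by (simp only: gap_sum_Nil_shift)
    qed simp
    finally show ?thesis
      by (simp add: True prev_pole_sum_def right_diff_distrib sum_subtractf)
  next
    case False
    have "gap_sum (Suc M) (k # P) Q N - gap_sum M (k # P) Q N
        = (\<Sum>p=1..<N. 1 / of_nat p ^ k * (gap_sum (Suc M) P Q p - gap_sum M P Q p))"
      using False by (simp only: gap_sum.simps(2) if_False right_diff_distrib sum_subtractf)
    also have "\<dots> = (\<Sum>p=1..<N. 1 / of_nat p ^ k * (pole_sum M P Q p - prev_pole_sum M P Q p))"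
      using Cons False by (intro sum.cong) auto
    finally show ?thesis
      using False by (simp add: prev_pole_sum_def right_diff_distrib diff_divide_distrib sum_subtractf)
  qed
qed simp

lemma gap_sum_Nil_diagonal:
  assumes "N \<ge> 1"
  shows "gap_sum (Suc N) [] Q (Suc N) = gap_sum N [] Q N + pole_sum N [] Q N"
proof -
  obtain p where p: "N = Suc p" using assms by (cases N) auto
  have "gap_sum (Suc N) [] Q (Suc N) = gap_sum (Suc N) [] Q N + zeta_trunc_word N Q"
    using assms by (simp add: atLeastLessThanSuc)
  also have "gap_sum (Suc N) [] Q N = gap_sum N [] Q N + (pole_sum N [] Q p - zeta_trunc_word p Q)"
    using gap_sum_Nil_shift[of p N Q] by (simp add: p)
  also have "\<dots> + zeta_trunc_word N Q = gap_sum N [] Q N + pole_sum N [] Q N"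
  proof (cases Q)
    case (Cons q Q')
    then show ?thesis by (cases "p = 0") (simp_all add: p zeta_trunc_word_Suc atLeastLessThanSuc)
  qed simp
  finally show ?thesis .
qed

text \<open>On the diagonal, pole parameter and bound move together: the new top index contributes
  the last term, and the shift of \<open>M\<close> the pole sums.\<close>

lemma gap_sum_diagonal_step:
  assumes "N \<ge> 1"
  shows "gap_sum (Suc N) (k # P) Q (Suc N) = gap_sum N (k # P) Q N
    + pole_sum N (k # P) Q N - prev_pole_sum N (k # P) Q N
    + (gap_sum N P Q N + pole_sum N P Q N - prev_pole_sum N P Q N) / of_nat N ^ k"
proof -
  have "gap_sum (Suc N) (k # P) Q (Suc N) = gap_sum (Suc N) (k # P) Q N
      + gap_sum (Suc N) P Q (if P = [] then Suc N else N) / of_nat N ^ k"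
    using assms by (simp add: atLeastLessThanSuc)
  also have "gap_sum (Suc N) P Q (if P = [] then Suc N else N) = gap_sum N P Q N + pole_sum N P Q N - prev_pole_sum N P Q N"
  proof (cases "P = []")
    case True
    then show ?thesis using gap_sum_Nil_diagonal[OF assms] by (simp add: prev_pole_sum_def del: gap_sum.simps)
  next
    case False
    then show ?thesis using gap_sum_shift[OF False, of N N Q] by (simp add: algebra_simps)
  qed
  finally show ?thesis using gap_sum_shift[of "k # P" N N Q] by (simp del: gap_sum.simps pole_sum.simps)
qed

lemma pole_sum_Nil: "pole_sum M P [] N = zeta_trunc_word N P / of_nat M"
  by (induction P arbitrary: N) (simp_all add: zeta_trunc_word_Cons sum_divide_distrib)

section \<open>Operators on the leading letter\<close>

definition shift_first :: "nat \<Rightarrow> zpoly \<Rightarrow> zpoly" where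
  "shift_first k = lin_ext (\<lambda>w. word (case w of [] \<Rightarrow> [] | a # u \<Rightarrow> (a + k) # u))"

text \<open>Reads the first letter as a power of \<open>1 / N\<close>. This is the forward
  difference of the truncated sum, under which \<open>shift_first k\<close> becomes division by
  \<open>N ^ k\<close>.\<close>

definition lead_sum :: "nat \<Rightarrow> zpoly \<Rightarrow> rat" where
  "lead_sum N = rat_ext (\<lambda>w. case w of [] \<Rightarrow> 0 | a # u \<Rightarrow> zeta_trunc_word N u / of_nat N ^ a)"

definition strip2 :: "zpoly \<Rightarrow> zpoly" where
  "strip2 = lin_ext (\<lambda>w. case w of [] \<Rightarrow> 0 | a # u \<Rightarrow> if a = 2 then word u else 0)"

lemma shift_first_simps [simp]:
  "shift_first k (p + q) = shift_first k p + shift_first k q"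
  "shift_first k (p - q) = shift_first k p - shift_first k q"
  "shift_first k (qscale c p) = qscale c (shift_first k p)"
  "shift_first k (word (a # u)) = word ((a + k) # u)"
  by (simp_all add: shift_first_def)

lemma lead_sum_simps [simp]:
  "lead_sum N (p + q) = lead_sum N p + lead_sum N q"
  "lead_sum N (p - q) = lead_sum N p - lead_sum N q"
  "lead_sum N (qscale c p) = c * lead_sum N p"
  "lead_sum N 0 = 0"
  "lead_sum N (sum f A) = (\<Sum>i\<in>A. lead_sum N (f i))"
  "lead_sum N (word []) = 0"
  "lead_sum N (word (a # u)) = zeta_trunc_word N u / of_nat N ^ a"
  by (simp_all add: lead_sum_def)

lemma strip2_linear: "qlin strip2"
  unfolding strip2_def by (rule lin_ext_linear)

lemmas strip2_simps [simp] =
  module_hom.add[OF strip2_linear] module_hom.scale[OF strip2_linear]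
  module_hom.zero[OF strip2_linear] module_hom.diff[OF strip2_linear]
  module_hom.neg[OF strip2_linear] module_hom.sum[OF strip2_linear]

lemma strip2_word [simp]:
  "strip2 (word []) = 0" "strip2 (word (a # u)) = (if a = 2 then word u else 0)"
  by (simp_all add: strip2_def)

lemma lead_sum_prepend [simp]: "lead_sum N (prepend a p) = zeta_trunc N p / of_nat N ^ a"
  by (rule linear_eq_on_words[where s="(*)" and A=UNIV and f="\<lambda>p. lead_sum N (prepend a p)"
        and g="\<lambda>p. zeta_trunc N p / of_nat N ^ a"])
    (auto intro!: qformI simp: supp_in_def add_divide_distrib)

lemma lead_sum_shift_first [simp]: "lead_sum N (shift_first k p) = lead_sum N p / of_nat N ^ k"
proof (rule linear_eq_on_words[where s="(*)" and A=UNIV and f="\<lambda>p. lead_sum N (shift_first k p)"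
        and g="\<lambda>p. lead_sum N p / of_nat N ^ k"])
  fix w :: "nat list"
  show "lead_sum N (shift_first k (word w)) = lead_sum N (word w) / of_nat N ^ k"
    by (cases w) (simp_all add: shift_first_def power_add)
qed (auto intro!: qformI simp: supp_in_def add_divide_distrib)

lemma strip2_prepend [simp]: "strip2 (prepend a p) = (if a = 2 then p else 0)"
  by (rule linear_eq_on_words[where s=qscale and A=UNIV and f="\<lambda>p. strip2 (prepend a p)"
        and g="\<lambda>p. if a = 2 then p else 0"])
    (auto intro!: qlinI simp: supp_in_def)

lemma zeta_trunc_Suc:
  assumes "N \<ge> 1"
  shows "zeta_trunc (Suc N) p = zeta_trunc N p + lead_sum N p"
proof (rule linear_eq_on_words[where s="(*)" and A=UNIV and f="zeta_trunc (Suc N)"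
        and g="\<lambda>p. zeta_trunc N p + lead_sum N p"])
  fix w :: "nat list"
  show "zeta_trunc (Suc N) (word w) = zeta_trunc N (word w) + lead_sum N (word w)"
    using assms by (cases w) (simp_all add: zeta_trunc_word_Suc)
qed (auto intro!: qformI simp: supp_in_def algebra_simps)

lemma zeta_trunc_1:
  assumes "p \<in> supp_in {w. w \<noteq> []}"
  shows "zeta_trunc 1 p = 0"
proof (rule linear_eq_on_words[where s="(*)" and f="zeta_trunc 1" and g="\<lambda>p. 0", OF _ _ assms])
  fix w :: "nat list" assume "w \<in> {w. w \<noteq> []}"
  then show "zeta_trunc 1 (word w) = 0" by (cases w) simp_all
qed (auto intro!: qformI)

text \<open>\<open>gap_elem P Q\<close> is the image under Drop1 of the word \<open>P z\<^sub>1 Q\<close>; the element \<open>pole_elem P Q\<close>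
  represents \<open>pole_sum N P Q N + pole_sum N (tl P) Q N / N\<^bsup>hd P\<^esup>\<close>, where
  the first letter of each word stands for a negative power of \<open>N\<close>.\<close>

function (sequential) pole_elem :: "nat list \<Rightarrow> nat list \<Rightarrow> zpoly"
  and gap_elem :: "nat list \<Rightarrow> nat list \<Rightarrow> zpoly" where
  "pole_elem [] [] = 0"
| "pole_elem (k1 # P) [] = word (1 # k1 # P) + word (Suc k1 # P)"
| "pole_elem [] (k # Q) = (\<Sum>a=2..k. word ((Suc k - a) # a # Q))"
| "pole_elem (k1 # P) (k # Q) =
     (\<Sum>a=2..k. word ((Suc k - a) # k1 # P @ a # Q) + word ((Suc k - a + k1) # P @ a # Q))
     + prepend k (gap_elem (k1 # P) Q) + prepend (k + k1) (gap_elem P Q)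
     - shift_first k (pole_elem (butlast (k1 # P)) (last (k1 # P) # Q))"
| "gap_elem [] Q = 0"
| "gap_elem (k1 # P) Q = pole_elem (k1 # P) Q - pole_elem (butlast (k1 # P)) (last (k1 # P) # Q)
     + prepend k1 (gap_elem P Q)"
  by pat_completeness auto
termination
  \<comment> \<open>\<open>gap_elem\<close> calls \<open>pole_elem\<close> at the same total length,
    which the summand 1 accounts for.\<close>
  by (relation "measure (case_sum (\<lambda>(P, Q). 2 * (length P + length Q)) (\<lambda>(P, Q). 2 * (length P + length Q) + 1))")
    auto

lemma sum_split_first_term:
  fixes f :: "nat \<Rightarrow> rat"
  assumes "k \<ge> 1"
  shows "(\<Sum>a=1..k. f a) = f 1 + (\<Sum>a=2..k. f a)"
  using assms by (simp add: sum.atLeast_Suc_atMost numeral_2_eq_2)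

text \<open>The term \<open>a = 1\<close> is singled out because \<open>P @ 1 # Q\<close> is not a
  word of \<open>Hge2\<close>; together with the gap sum it forms, for nonempty \<open>P\<close>,
  the modified sum that \<open>gap_elem\<close> represents.\<close>

lemma pole_sum_expand_diagonal:
  assumes "k \<ge> 1"
  shows "pole_sum N P (k # Q) N = (\<Sum>a=2..k. zeta_trunc_word N (P @ a # Q) / of_nat N ^ (Suc k - a))
    + (zeta_trunc_word N (P @ 1 # Q) + gap_sum N P Q N - prev_pole_sum N P Q N) / of_nat N ^ k"
  unfolding pole_sum_expand[OF order_refl] sum_split_first_term[OF assms]
  by (simp add: add_divide_distrib diff_divide_distrib)


lemma lists_butlast_last: "k # P \<in> lists A \<Longrightarrow> butlast (k # P) \<in> lists A \<and> last (k # P) \<in> A"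
  by (metis append_butlast_last_id append_in_lists_conv Cons_in_lists_iff list.distinct(1))

definition elem_words :: "nat \<Rightarrow> nat list set" where
  "elem_words n = {w \<in> lists {2..}. w \<noteq> [] \<and> sum_list w = Suc n}"

text \<open>The only word of \<open>pole_elem P Q\<close> outside \<open>Hge2\<close> is
  \<open>1 # P @ Q\<close>. It depends on the concatenation alone, so it cancels between the two
  pole elements in \<open>gap_elem\<close>; this is why Drop1 lands in \<open>Hge2\<close>.\<close>

lemma pole_elem_gap_elem_support:
  assumes "length P + length Q = n" "P \<in> lists {2..}" "Q \<in> lists {2..}"
  shows "(P @ Q \<noteq> [] \<longrightarrow> pole_elem P Q - word (1 # P @ Q) \<in> supp_in (elem_words (sum_list (P @ Q))))
    \<and> gap_elem P Q \<in> supp_in (elem_words (sum_list (P @ Q)))"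
  using assms
proof (induction n arbitrary: P Q rule: less_induct)
  case (less n)
  have pole: "pole_elem P Q - word (1 # P @ Q) \<in> supp_in (elem_words (sum_list (P @ Q)))"
    if len: "length P + length Q = n" and P: "P \<in> lists {2..}" and Q: "Q \<in> lists {2..}" and ne: "P @ Q \<noteq> []"
    for P Q
  proof (cases Q)
    case Nil
    then obtain k1 P' where P': "P = k1 # P'" using ne by (cases P) auto
    then show ?thesis using P Nil by (auto simp: elem_words_def)
  next
    case Q': (Cons k Q')
    then have k: "k \<ge> 2" using Q by auto
    \<comment> \<open>The term \<open>a = k\<close> is separated because it is the one with leading
      letter 1.\<close>
    then have split: "(\<Sum>a=2..k. f a) = (\<Sum>a=2..<k. f a) + f k" for f :: "nat \<Rightarrow> zpoly"
      by (metis atLeastLessThanSuc_atLeastAtMost sum.atLeastLessThan_Suc)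
    show ?thesis
    proof (cases P)
      case Nil
      have "(\<Sum>a=2..<k. word ((Suc k - a) # a # Q')) \<in> supp_in (elem_words (sum_list (P @ Q)))"
        by (rule supp_in_sum) (use Nil Q' Q in \<open>auto simp: elem_words_def\<close>)
      then show ?thesis by (simp add: Nil Q' split)
    next
      case P': (Cons k1 P')
      have k1: "k1 \<ge> 2" using P P' by auto
      let ?W = "supp_in (elem_words (sum_list (P @ Q)))"
      let ?B = "butlast (k1 # P')" and ?l = "last (k1 # P')"
      have BP: "?B @ [?l] = k1 # P'" by (rule append_butlast_last_id) simp
      have Bl: "?B \<in> lists {2..}" "?l \<ge> 2" "sum_list ?B + ?l = k1 + sum_list P'" "length ?B + 1 = Suc (length P')"
      proof -
        have "?B @ [?l] \<in> lists {2..}" using P unfolding P' BP .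
        then show "?B \<in> lists {2..}" "?l \<ge> 2" by auto
        show "sum_list ?B + ?l = k1 + sum_list P'" using arg_cong[OF BP, of sum_list] by simp
        show "length ?B + 1 = Suc (length P')" by simp
      qed
      have s1: "(\<Sum>a=2..<k. word ((Suc k - a) # k1 # P' @ a # Q')) \<in> ?W"
        by (rule supp_in_sum) (use Q' P' P Q in \<open>auto simp: elem_words_def\<close>)
      have s2: "(\<Sum>a=2..k. word ((Suc k - a + k1) # P' @ a # Q')) \<in> ?W"
        by (rule supp_in_sum) (use Q' P' P Q k1 in \<open>auto simp: elem_words_def\<close>)
      have lt: "length (k1 # P') + length Q' < n" "length P' + length Q' < n" "length ?B + length (?l # Q') < n"
        using len by (auto simp: P' Q')
      have "gap_elem (k1 # P') Q' \<in> supp_in (elem_words (sum_list ((k1 # P') @ Q')))"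
        using less.IH[OF lt(1) refl] P Q P' Q' by auto
      then have s3: "prepend k (gap_elem (k1 # P') Q') \<in> ?W"
        by (rule prepend_in_supp_in) (use k P' Q' in \<open>auto simp: elem_words_def\<close>)
      have "gap_elem P' Q' \<in> supp_in (elem_words (sum_list (P' @ Q')))"
        using less.IH[OF lt(2) refl] P Q P' Q' by auto
      then have s4: "prepend (k + k1) (gap_elem P' Q') \<in> ?W"
        by (rule prepend_in_supp_in) (use k P' Q' in \<open>auto simp: elem_words_def\<close>)
      have "pole_elem ?B (?l # Q') - word (1 # ?B @ ?l # Q') \<in> supp_in (elem_words (sum_list (?B @ ?l # Q')))"
        using less.IH[OF lt(3) refl] Bl Q Q' by (auto simp del: last.simps butlast.simps)
      then have "shift_first k (pole_elem ?B (?l # Q') - word (1 # ?B @ ?l # Q')) \<in> ?W"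
        unfolding shift_first_def
      proof (rule lin_ext_in_supp_in)
        fix w assume "w \<in> elem_words (sum_list (?B @ ?l # Q'))"
        then show "word (case w of [] \<Rightarrow> [] | a # u \<Rightarrow> (a + k) # u) \<in> ?W"
          using Bl(3) by (cases w) (auto simp: elem_words_def P' Q' simp del: last.simps butlast.simps)
      qed
      moreover have "shift_first k (word (1 # ?B @ ?l # Q')) \<in> ?W"
        using k Bl Q Q' by (auto simp: elem_words_def P' simp del: last.simps butlast.simps)
      ultimately have "shift_first k (pole_elem ?B (?l # Q') - word (1 # ?B @ ?l # Q'))
          + shift_first k (word (1 # ?B @ ?l # Q')) \<in> ?W"
        by (rule supp_in_add)
      then have s5: "shift_first k (pole_elem ?B (?l # Q')) \<in> ?W"
        by (simp del: last.simps butlast.simps shift_first_simps(4))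
      have "pole_elem P Q - word (1 # P @ Q) = (\<Sum>a=2..<k. word ((Suc k - a) # k1 # P' @ a # Q'))
          + (\<Sum>a=2..k. word ((Suc k - a + k1) # P' @ a # Q'))
          + prepend k (gap_elem (k1 # P') Q') + prepend (k + k1) (gap_elem P' Q')
          - shift_first k (pole_elem ?B (?l # Q'))"
        unfolding P' Q' pole_elem.simps(4) sum.distrib split[of "\<lambda>a. word ((Suc k - a) # k1 # P' @ a # Q')"]
        by (simp del: last.simps butlast.simps gap_elem.simps pole_elem.simps)
      then show ?thesis
        using s1 s2 s3 s4 s5 by (simp only:) (intro supp_in_add supp_in_diff)
    qed
  qed
  have gap: "gap_elem P Q \<in> supp_in (elem_words (sum_list (P @ Q)))"
  proof (cases P)
    case (Cons k1 P')
    let ?B = "butlast (k1 # P')" and ?l = "last (k1 # P')"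
    let ?W = "supp_in (elem_words (sum_list (P @ Q)))"
    have BP: "?B @ [?l] = k1 # P'" by (rule append_butlast_last_id) simp
    have BQ: "?B @ ?l # Q = P @ Q" using BP Cons by (metis append.assoc append_Cons append_Nil)
    have Bl: "?B \<in> lists {2..}" "?l # Q \<in> lists {2..}"
    proof -
      have "?B @ ?l # Q \<in> lists {2..}" using less.prems unfolding BQ by simp
      then show "?B \<in> lists {2..}" "?l # Q \<in> lists {2..}" by (auto simp del: last.simps butlast.simps)
    qed
    have "length ?B + length (?l # Q) = n" using less.prems Cons by (simp del: last.simps butlast.simps)
    from pole[OF this Bl] have p2: "pole_elem ?B (?l # Q) - word (1 # P @ Q) \<in> ?W"
      unfolding BQ using Cons by simp
    have p1: "pole_elem P Q - word (1 # P @ Q) \<in> ?W" using pole[of P Q] less.prems Cons by simp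
    have "gap_elem P' Q \<in> supp_in (elem_words (sum_list (P' @ Q)))"
      using less.IH[of "length P' + length Q" P' Q] less.prems Cons by simp
    then have p3: "prepend k1 (gap_elem P' Q) \<in> ?W"
      by (rule prepend_in_supp_in) (use less.prems Cons in \<open>auto simp: elem_words_def\<close>)
    have "gap_elem P Q = (pole_elem P Q - word (1 # P @ Q)) - (pole_elem ?B (?l # Q) - word (1 # P @ Q))
        + prepend k1 (gap_elem P' Q)"
      unfolding Cons gap_elem.simps by simp
    then show ?thesis using supp_in_add[OF supp_in_diff[OF p1 p2] p3] by (simp only:)
  qed simp
  show ?case using pole[OF less.prems] gap by blast
qed

lemma gap_elem_support:
  assumes "P \<in> lists {2..}" "Q \<in> lists {2..}"
  shows "gap_elem P Q \<in> supp_in {w \<in> lists {2..}. w \<noteq> [] \<and> sum_list w = Suc (sum_list P + sum_list Q)}"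
  using pole_elem_gap_elem_support[OF refl assms] by (simp add: elem_words_def)

lemma lead_sum_pole_elem_Nil:
  "lead_sum N (pole_elem [] (k # Q)) = (\<Sum>a=2..k. zeta_trunc_word N (a # Q) / of_nat N ^ (Suc k - a))"
  by simp

text \<open>The clauses of \<open>pole_elem\<close> transcribe
  \<open>pole_sum_expand_diagonal\<close> for \<open>P\<close> and for its tail, and those of
  \<open>gap_elem\<close> transcribe \<open>gap_sum_diagonal_step\<close>. The second claim follows
  by induction on \<open>N\<close>, as both sides vanish at \<open>N = 1\<close> and have the same
  difference.\<close>

lemma pole_elem_gap_elem_sums:
  assumes "length P + length Q = n" "P \<in> lists {2..}" "Q \<in> lists {2..}" "P \<noteq> []"
  shows "(\<forall>N\<ge>1. lead_sum N (pole_elem P Q) = pole_sum N P Q N + pole_sum N (tl P) Q N / of_nat N ^ hd P)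
    \<and> (\<forall>N\<ge>1. zeta_trunc N (gap_elem P Q) = zeta_trunc_word N (P @ 1 # Q) + gap_sum N P Q N)"
  using assms
proof (induction n arbitrary: P Q rule: less_induct)
  case (less n)
  \<comment> \<open>Stated for arbitrary words of total length \<open>n\<close>, since the second
    claim also uses it for the word with one letter moved from the left part to the right
    part.\<close>
  have pole: "lead_sum N (pole_elem (k1 # P') Q) = pole_sum N (k1 # P') Q N + pole_sum N P' Q N / of_nat N ^ k1"
    if len: "length (k1 # P') + length Q = n" and P: "k1 # P' \<in> lists {2..}" and Q: "Q \<in> lists {2..}" and N: "N \<ge> 1"
    for k1 P' Q and N :: nat
  proof (cases Q)
    case Nil
    then show ?thesis by (simp add: pole_sum_Nil del: pole_sum.simps)
  next
    case Q': (Cons k Q')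
    let ?B = "butlast (k1 # P')" and ?l = "last (k1 # P')"
    let ?x = "of_nat N :: rat"
    have k: "k \<ge> 1" and k1: "k1 \<ge> 1" using P Q Q' by auto
    have gap: "zeta_trunc N (gap_elem (k1 # P') Q') = zeta_trunc_word N (k1 # P' @ 1 # Q') + gap_sum N (k1 # P') Q' N"
      using less.IH[of "length (k1 # P') + length Q'" "k1 # P'" Q'] len P Q Q' N by auto
    \<comment> \<open>For empty \<open>P'\<close> the induction hypothesis does not apply:
      \<open>gap_elem [] Q'\<close> is zero by convention and \<open>pole_elem [] (k1 # Q')\<close>
      omits the matching remainder, and the two defects cancel.\<close>
    have prev: "lead_sum N (pole_elem ?B (?l # Q')) - zeta_trunc N (gap_elem P' Q') / ?x ^ k1
        = prev_pole_sum N (k1 # P') Q' N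
          - (zeta_trunc_word N (P' @ 1 # Q') + gap_sum N P' Q' N - prev_pole_sum N P' Q' N) / ?x ^ k1"
    proof (cases "P' = []")
      case True
      have "prev_pole_sum N [k1] Q' N = pole_sum N [] (k1 # Q') N"
        by (simp add: prev_pole_sum_def del: pole_sum.simps)
      also have "\<dots> = lead_sum N (pole_elem [] (k1 # Q'))
          + (zeta_trunc_word N ([] @ 1 # Q') + gap_sum N [] Q' N - prev_pole_sum N [] Q' N) / ?x ^ k1"
        unfolding lead_sum_pole_elem_Nil pole_sum_expand_diagonal[OF k1] by simp
      finally show ?thesis using True by (simp del: gap_sum.simps pole_elem.simps)
    next
      case False
      have "P' \<in> lists {2..}" using P by simp
      then have gap': "zeta_trunc N (gap_elem P' Q') = zeta_trunc_word N (P' @ 1 # Q') + gap_sum N P' Q' N"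
        using less.IH[of "length P' + length Q'" P' Q'] len False Q Q' N by auto
      let ?B' = "butlast P'" and ?l' = "last P'"
      have B: "?B = k1 # ?B'" "?l = ?l'" using False by simp_all
      have "?B' @ [?l'] = P'" using False by simp
      then have "?B' @ [?l'] \<in> lists {2..}" using \<open>P' \<in> lists {2..}\<close> by simp
      then have mem: "k1 # ?B' \<in> lists {2..}" "?l' # Q' \<in> lists {2..}" using P Q Q' by auto
      have lt: "length (k1 # ?B') + length (?l' # Q') < n"
        using len False Q' by simp
      have "lead_sum N (pole_elem (k1 # ?B') (?l' # Q'))
          = pole_sum N (k1 # ?B') (?l' # Q') N + pole_sum N ?B' (?l' # Q') N / ?x ^ k1"
        using less.IH[OF lt refl mem] N by (auto simp del: pole_elem.simps pole_sum.simps)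
      then have "lead_sum N (pole_elem ?B (?l # Q')) = prev_pole_sum N (k1 # P') Q' N + prev_pole_sum N P' Q' N / ?x ^ k1"
        using False unfolding prev_pole_sum_def B by (simp del: pole_elem.simps pole_sum.simps)
      then show ?thesis unfolding gap' by (simp add: diff_divide_distrib)
    qed
    have "lead_sum N (pole_elem (k1 # P') (k # Q'))
        = (\<Sum>a=2..k. zeta_trunc_word N ((k1 # P') @ a # Q') / ?x ^ (Suc k - a))
          + (\<Sum>a=2..k. zeta_trunc_word N (P' @ a # Q') / ?x ^ (Suc k - a + k1))
          + zeta_trunc N (gap_elem (k1 # P') Q') / ?x ^ k
          - (lead_sum N (pole_elem ?B (?l # Q')) - zeta_trunc N (gap_elem P' Q') / ?x ^ k1) / ?x ^ k"
      unfolding pole_elem.simps(4)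
      by (simp add: sum.distrib diff_divide_distrib power_add mult_ac
          del: gap_elem.simps pole_elem.simps last.simps butlast.simps)
    also have "(\<Sum>a=2..k. zeta_trunc_word N (P' @ a # Q') / ?x ^ (Suc k - a + k1))
        = (\<Sum>a=2..k. zeta_trunc_word N (P' @ a # Q') / ?x ^ (Suc k - a)) / ?x ^ k1"
      by (simp only: sum_divide_distrib power_add divide_divide_eq_left)
    finally have *: "lead_sum N (pole_elem (k1 # P') (k # Q'))
        = (\<Sum>a=2..k. zeta_trunc_word N ((k1 # P') @ a # Q') / ?x ^ (Suc k - a))
          + (\<Sum>a=2..k. zeta_trunc_word N (P' @ a # Q') / ?x ^ (Suc k - a)) / ?x ^ k1
          + zeta_trunc N (gap_elem (k1 # P') Q') / ?x ^ k
          - (lead_sum N (pole_elem ?B (?l # Q')) - zeta_trunc N (gap_elem P' Q') / ?x ^ k1) / ?x ^ k" .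
    show ?thesis
      unfolding Q' * prev gap pole_sum_expand_diagonal[OF k]
      by (simp add: add_divide_distrib diff_divide_distrib mult_ac del: gap_sum.simps)
  qed
  obtain k1 P' where P: "P = k1 # P'" using less.prems by (cases P) auto
  let ?B = "butlast (k1 # P')" and ?l = "last (k1 # P')"
  have memP: "k1 # P' \<in> lists {2..}" and k1: "k1 \<ge> 1" using less.prems P by auto
  have gap: "zeta_trunc N (gap_elem P Q) = zeta_trunc_word N (P @ 1 # Q) + gap_sum N P Q N" if "N \<ge> 1" for N
    using that
  proof (induction N rule: dec_induct)
    case base
    have "gap_elem P Q \<in> supp_in {w. w \<noteq> []}"
      using gap_elem_support[OF less.prems(2,3)] by (rule supp_in_mono) auto
    from zeta_trunc_1[OF this] show ?case by (simp add: P del: gap_elem.simps)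
  next
    case (step N)
    let ?x = "of_nat N :: rat"
    have N: "N \<ge> 1" using step by simp
    have lead: "lead_sum N (gap_elem P Q) = lead_sum N (pole_elem (k1 # P') Q)
        - lead_sum N (pole_elem ?B (?l # Q)) + zeta_trunc N (gap_elem P' Q) / ?x ^ k1"
      unfolding P gap_elem.simps(2) by (simp del: gap_elem.simps pole_elem.simps last.simps butlast.simps)
    have prev: "lead_sum N (pole_elem ?B (?l # Q)) - zeta_trunc N (gap_elem P' Q) / ?x ^ k1
        = prev_pole_sum N (k1 # P') Q N
          - (zeta_trunc_word N (P' @ 1 # Q) + gap_sum N P' Q N - prev_pole_sum N P' Q N) / ?x ^ k1"
    proof (cases "P' = []")
      case True
      have "prev_pole_sum N [k1] Q N = pole_sum N [] (k1 # Q) N"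
        by (simp add: prev_pole_sum_def del: pole_sum.simps)
      also have "\<dots> = lead_sum N (pole_elem [] (k1 # Q))
          + (zeta_trunc_word N ([] @ 1 # Q) + gap_sum N [] Q N - prev_pole_sum N [] Q N) / ?x ^ k1"
        unfolding lead_sum_pole_elem_Nil pole_sum_expand_diagonal[OF k1] by simp
      finally show ?thesis using True by (simp del: gap_sum.simps pole_elem.simps)
    next
      case False
      have "P' \<in> lists {2..}" using memP by simp
      then have gap': "zeta_trunc N (gap_elem P' Q) = zeta_trunc_word N (P' @ 1 # Q) + gap_sum N P' Q N"
        using less.IH[of "length P' + length Q" P' Q] less.prems False P N by auto
      let ?B' = "butlast P'" and ?l' = "last P'"
      have B: "?B = k1 # ?B'" "?l = ?l'" using False by simp_all
      have "?B' @ [?l'] = P'" using False by simp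
      then have "?B' @ [?l'] \<in> lists {2..}" using \<open>P' \<in> lists {2..}\<close> by simp
      then have mem: "k1 # ?B' \<in> lists {2..}" "?l' # Q \<in> lists {2..}" using memP less.prems by auto
      have "length (k1 # ?B') + length (?l' # Q) = n"
        using less.prems(1) False P by simp
      from pole[OF this mem N]
      have "lead_sum N (pole_elem ?B (?l # Q)) = prev_pole_sum N (k1 # P') Q N + prev_pole_sum N P' Q N / ?x ^ k1"
        using False unfolding prev_pole_sum_def B by (simp del: pole_elem.simps pole_sum.simps)
      then show ?thesis unfolding gap' by (simp add: diff_divide_distrib)
    qed
    have "lead_sum N (pole_elem (k1 # P') Q) = pole_sum N (k1 # P') Q N + pole_sum N P' Q N / ?x ^ k1"
      using pole[OF _ memP less.prems(3) N] less.prems(1) P by simp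
    with prev lead have "lead_sum N (gap_elem P Q) = pole_sum N (k1 # P') Q N + pole_sum N P' Q N / ?x ^ k1
        - prev_pole_sum N (k1 # P') Q N
        + (zeta_trunc_word N (P' @ 1 # Q) + gap_sum N P' Q N - prev_pole_sum N P' Q N) / ?x ^ k1"
      by linarith
    moreover have "zeta_trunc_word (Suc N) (P @ 1 # Q) = zeta_trunc_word N (P @ 1 # Q) + zeta_trunc_word N (P' @ 1 # Q) / ?x ^ k1"
      using N by (simp add: P zeta_trunc_word_Suc)
    ultimately show ?case
      using step.IH gap_sum_diagonal_step[OF N, of k1 P' Q]
      unfolding zeta_trunc_Suc[OF N] P
      by (simp add: add_divide_distrib diff_divide_distrib del: gap_sum.simps pole_sum.simps gap_elem.simps)
  qed
  show ?case using gap pole[OF _ memP less.prems(3)] less.prems(1) P by simp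
qed

lemma zeta_trunc_gap_elem:
  assumes "P \<in> lists {2..}" "Q \<in> lists {2..}" "P \<noteq> []" "N \<ge> 1"
  shows "zeta_trunc N (gap_elem P Q) = zeta_trunc_word N (P @ 1 # Q) + gap_sum N P Q N"
  using pole_elem_gap_elem_sums[OF refl assms(1-3)] assms(4) by blast

section \<open>Leading \<open>z_2\<close> in the pole and gap elements\<close>

definition pole_strip :: "nat list \<Rightarrow> nat list \<Rightarrow> zpoly" where
  "pole_strip P Q = (case Q of [] \<Rightarrow> 0 | k # Q' \<Rightarrow> if k = 2 then gap_elem P Q' else word (P @ (k - 1) # Q'))"

lemma strip2_eq_0:
  assumes "p \<in> supp_in {w. take 1 w \<noteq> [2]}"
  shows "strip2 p = 0"
proof (rule linear_eq_on_words[where s=qscale and f=strip2 and g="\<lambda>_. 0", OF _ _ assms])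
  fix w :: "nat list" assume "w \<in> {w. take 1 w \<noteq> [2]}"
  then show "strip2 (word w) = 0" by (cases w) auto
qed (auto intro!: qlinI)

text \<open>A leading 2 comes only from \<open>a = k - 1\<close> in the first sum or, if
  \<open>k = 2\<close>, from the prepended gap element. All other terms start with 1 or with a
  letter of size at least 3.\<close>

lemma strip2_pole_elem:
  assumes "P \<in> lists {2..}" "Q \<in> lists {2..}" "P @ Q \<noteq> []"
  shows "strip2 (pole_elem P Q) = pole_strip P Q"
proof (cases Q)
  case Nil
  then obtain k1 P' where "P = k1 # P'" using assms by (cases P) auto
  then show ?thesis using Nil assms by (simp add: pole_strip_def)
next
  case Q': (Cons k Q')
  have k: "k \<ge> 2" using assms Q' by auto
  have sum: "(\<Sum>a=2..k. if Suc k - a = 2 then word (f a) else 0)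
      = (if k = 2 then 0 else word (f (k - 1)))" for f :: "nat \<Rightarrow> nat list"
  proof -
    have "(\<Sum>a=2..k. if Suc k - a = 2 then word (f a) else 0) = (\<Sum>a=2..k. if a = k - 1 then word (f a) else 0)"
      using k by (intro sum.cong) auto
    also have "\<dots> = (if k = 2 then 0 else word (f (k - 1)))" using k by (cases "k = 2") (auto simp: sum.delta)
    finally show ?thesis .
  qed
  show ?thesis
  proof (cases P)
    case Nil
    show ?thesis using sum[of "\<lambda>a. a # Q'"] by (simp add: Nil Q' pole_strip_def if_distrib)
  next
    case P': (Cons k1 P')
    let ?B = "butlast (k1 # P')" and ?l = "last (k1 # P')"
    have k1: "k1 \<ge> 2" using assms P' by auto
    have "k1 # P' \<in> lists {2..}" "Q' \<in> lists {2..}" using assms P' Q' by auto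
    then have mem: "?B \<in> lists {2..}" "?l # Q' \<in> lists {2..}"
      using lists_butlast_last[of k1 P' "{2..}"] by (simp_all only: Cons_in_lists_iff simp_thms)
    have "pole_elem ?B (?l # Q') - word (1 # ?B @ ?l # Q') \<in> supp_in (elem_words (sum_list (?B @ ?l # Q')))"
      using pole_elem_gap_elem_support[OF refl mem] by simp
    then have "shift_first k (pole_elem ?B (?l # Q') - word (1 # ?B @ ?l # Q')) \<in> supp_in {w. take 1 w \<noteq> [2]}"
      unfolding shift_first_def
    proof (rule lin_ext_in_supp_in)
      fix w assume "w \<in> elem_words (sum_list (?B @ ?l # Q'))"
      then show "word (case w of [] \<Rightarrow> [] | a # u \<Rightarrow> (a + k) # u) \<in> supp_in {w. take 1 w \<noteq> [2]}"
        using k by (cases w) (auto simp: elem_words_def)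
    qed
    from strip2_eq_0[OF this] have "strip2 (shift_first k (pole_elem ?B (?l # Q'))) = 0"
      using k by (simp del: last.simps butlast.simps)
    moreover have "(\<Sum>a=2..k. if Suc (k + k1) - a = 2 then word (P' @ a # Q') else 0) = 0"
      by (rule sum.neutral) (use k1 in auto)
    ultimately show ?thesis
      using sum[of "\<lambda>a. k1 # P' @ a # Q'"] k k1
      by (simp add: P' Q' pole_strip_def sum.distrib del: last.simps butlast.simps gap_elem.simps)
  qed
qed

lemma strip2_gap_elem:
  assumes "k1 # P \<in> lists {2..}" "Q \<in> lists {2..}"
  shows "strip2 (gap_elem (k1 # P) Q) = pole_strip (k1 # P) Q
    - pole_strip (butlast (k1 # P)) (last (k1 # P) # Q) + (if k1 = 2 then gap_elem P Q else 0)"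
proof -
  let ?B = "butlast (k1 # P)" and ?l = "last (k1 # P)"
  have "?B \<in> lists {2..}" "?l # Q \<in> lists {2..}"
    using lists_butlast_last[OF assms(1)] assms(2) by (simp_all only: Cons_in_lists_iff simp_thms)
  then show ?thesis
    unfolding gap_elem.simps(2) using strip2_pole_elem[of ?B "?l # Q"] strip2_pole_elem[of "k1 # P" Q] assms
    by (simp del: last.simps butlast.simps pole_elem.simps gap_elem.simps)
qed

section \<open>The shuffle product with \<open>z\<^sub>2\<close>\<close>

primrec split_sum :: "nat list \<Rightarrow> (nat list \<Rightarrow> nat list \<Rightarrow> 'b::comm_monoid_add) \<Rightarrow> 'b" where
  "split_sum [] f = f [] []"
| "split_sum (k # w) f = f [] (k # w) + split_sum w (\<lambda>P. f (k # P))"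

text \<open>The sum of \<open>k \<cdot> f (A (k + 1) B) Q\<close> over all factorisations \<open>w = A k B Q\<close>; the scaling
  \<open>s\<close> is a parameter because \<open>f\<close> takes values in words as well as in numbers.\<close>

primrec raise_sum :: "nat list \<Rightarrow> (rat \<Rightarrow> 'b \<Rightarrow> 'b) \<Rightarrow> (nat list \<Rightarrow> nat list \<Rightarrow> 'b::comm_monoid_add) \<Rightarrow> 'b" where
  "raise_sum [] s f = 0"
| "raise_sum (k # w) s f = s (of_nat k) (split_sum w (\<lambda>P. f (Suc k # P))) + raise_sum w s (\<lambda>P. f (k # P))"

lemma split_sum_hom:
  assumes "Modules.module_hom qscale s L"
  shows "L (split_sum w f) = split_sum w (\<lambda>P Q. L (f P Q))"
  by (induction w arbitrary: f) (simp_all add: module_hom.add[OF assms])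

lemma raise_sum_hom:
  assumes "Modules.module_hom qscale s L"
  shows "L (raise_sum w qscale f) = raise_sum w s (\<lambda>P Q. L (f P Q))"
  by (induction w arbitrary: f)
    (simp_all add: module_hom.add[OF assms] module_hom.scale[OF assms] module_hom.zero[OF assms] split_sum_hom[OF assms])

lemma split_sum_cong:
  assumes "w \<in> lists A" "\<And>P Q. P \<in> lists A \<Longrightarrow> Q \<in> lists A \<Longrightarrow> f P Q = g P Q"
  shows "split_sum w f = split_sum w g"
  using assms
proof (induction w arbitrary: f g rule: list.induct)
  case (Cons k w)
  have "split_sum w (\<lambda>P. f (k # P)) = split_sum w (\<lambda>P. g (k # P))"
    by (rule Cons.IH) (use Cons.prems(1) in \<open>auto intro!: Cons.prems(2)\<close>)
  then show ?case using Cons.prems by simp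
qed simp

lemma raise_sum_cong:
  assumes "w \<in> lists A" "\<And>k. k \<in> A \<Longrightarrow> Suc k \<in> A"
    "\<And>P Q. P \<noteq> [] \<Longrightarrow> P \<in> lists A \<Longrightarrow> Q \<in> lists A \<Longrightarrow> f P Q = g P Q"
  shows "raise_sum w s f = raise_sum w s g"
  using assms(1,3)
proof (induction w arbitrary: f g rule: list.induct)
  case (Cons k w)
  have "raise_sum w s (\<lambda>P. f (k # P)) = raise_sum w s (\<lambda>P. g (k # P))"
    by (rule Cons.IH) (use Cons.prems(1) in \<open>auto intro!: Cons.prems(2)\<close>)
  moreover have "split_sum w (\<lambda>P. f (Suc k # P)) = split_sum w (\<lambda>P. g (Suc k # P))"
    by (rule split_sum_cong[where A=A]) (use Cons.prems(1) assms(2) in \<open>auto intro!: Cons.prems(2)\<close>)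
  ultimately show ?case by simp
qed simp

lemma split_sum_in_subspace:
  assumes "qs.subspace V" "\<And>P Q. P @ Q = w \<Longrightarrow> f P Q \<in> V"
  shows "split_sum w f \<in> V"
  using assms(2) by (induction w arbitrary: f) (auto intro!: qs.subspace_add[OF assms(1)])

lemma raise_sum_in_subspace:
  assumes "qs.subspace V" "w \<in> lists {2..}"
    "\<And>P Q. P \<noteq> [] \<Longrightarrow> P \<in> lists {2..} \<Longrightarrow> Q \<in> lists {2..} \<Longrightarrow> sum_list P + sum_list Q = Suc (sum_list w) \<Longrightarrow> f P Q \<in> V"
  shows "raise_sum w qscale f \<in> V"
  using assms(2,3)
proof (induction w arbitrary: f rule: list.induct)
  case Nil
  then show ?case by (simp add: qs.subspace_0[OF assms(1)])
next
  case (Cons k w)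
  have "raise_sum w qscale (\<lambda>P. f (k # P)) \<in> V"
    by (rule Cons.IH) (use Cons.prems(1) in \<open>auto intro!: Cons.prems(2)\<close>)
  moreover have "split_sum w (\<lambda>P. f (Suc k # P)) \<in> V"
    by (rule split_sum_in_subspace[OF assms(1)]) (use Cons.prems(1) in \<open>auto intro!: Cons.prems(2)\<close>)
  ultimately show ?case
    by (simp add: qs.subspace_add[OF assms(1)] qs.subspace_scale[OF assms(1)])
qed

definition insert_1 :: "nat list \<Rightarrow> zpoly" where
  "insert_1 w = split_sum w (\<lambda>P Q. word (P @ 1 # Q))"

definition raise_insert_1 :: "nat list \<Rightarrow> zpoly" where
  "raise_insert_1 w = raise_sum w qscale (\<lambda>P Q. word (P @ 1 # Q))"

definition raise_gap :: "nat list \<Rightarrow> zpoly" where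
  "raise_gap w = raise_sum w qscale gap_elem"

lemma insert_1_simps:
  "insert_1 [] = word [1]" "insert_1 (k # w) = word (1 # k # w) + prepend k (insert_1 w)"
  by (simp_all add: insert_1_def split_sum_hom[OF prepend_linear])

lemma raise_insert_1_simps:
  "raise_insert_1 [] = 0"
  "raise_insert_1 (k # w) = qscale (of_nat k) (prepend (Suc k) (insert_1 w)) + prepend k (raise_insert_1 w)"
  by (simp_all add: raise_insert_1_def insert_1_def split_sum_hom[OF prepend_linear] raise_sum_hom[OF prepend_linear])

text \<open>One letter \<open>z_k\<close> is cut into \<open>z_a z_b\<close> with
  \<open>a + b = k + 1\<close> and both parts at least 2.\<close>

primrec split_letter :: "nat list \<Rightarrow> zpoly" where
  "split_letter [] = 0"
| "split_letter (k # w) = prepend k (split_letter w) + (\<Sum>j=1..<k - 1. word (Suc j # (k - j) # w))"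

text \<open>The part of the shuffle of a word with \<open>z_2\<close> that stays in
  \<open>Hge2\<close>.\<close>

primrec shuffle_2_part :: "nat list \<Rightarrow> zpoly" where
  "shuffle_2_part [] = word [2]"
| "shuffle_2_part (k # w) = prepend k (shuffle_2_part w) + qscale (of_nat k) (prepend (Suc k) (split_letter w))
     + (\<Sum>d=1..<k. qscale (of_nat (k - d)) (word ((Suc k - d) # Suc d # w)))"

section \<open>From shuffles of letters to words in the \<open>z_k\<close>\<close>

lemma z_word_from_Suc: "z_word_from (Suc c) w = (case z_word_from c w of [] \<Rightarrow> [] | a # u \<Rightarrow> Suc a # u)"
proof (induction w arbitrary: c)
  case (Cons l w)
  then show ?case by (cases l) simp_all
qed simp

lemma z_word_simps [simp]:
  "z_word [] = []" "z_word (LY # w) = 1 # z_word w"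
  "z_word (LX # w) = (case z_word w of [] \<Rightarrow> [] | a # u \<Rightarrow> Suc a # u)"
  by (simp_all add: z_word_def z_word_from_Suc)

lemma z_word_block [simp]: "z_word (replicate c LX @ LY # v) = Suc c # z_word v"
  by (induction c) simp_all

lemma z_word_xy_word [simp]: "w \<in> lists {1..} \<Longrightarrow> z_word (xy_word w) = w"
  by (induction w) auto

lemma to_z_simps [simp]:
  "to_z (p + q) = to_z p + to_z q" "to_z (word w) = word (z_word w)"
  "to_z (qscale c p) = qscale c (to_z p)" "to_z (p - q) = to_z p - to_z q" "to_z 0 = 0"
  "to_z (- p) = - to_z p"
  by (simp_all add: to_z_def)

lemma to_z_prepend_LY [simp]: "to_z (prepend LY p) = prepend 1 (to_z p)"
  by (rule linear_eq_on_words[where s=qscale and A=UNIV and f="\<lambda>p. to_z (prepend LY p)"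
        and g="\<lambda>p. prepend 1 (to_z p)"])
    (auto intro!: qlinI simp: supp_in_def)

lemma to_z_prepend_LX [simp]: "to_z (prepend LX p) = shift_first 1 (to_z p)"
proof (rule linear_eq_on_words[where s=qscale and A=UNIV and f="\<lambda>p. to_z (prepend LX p)"
        and g="\<lambda>p. shift_first 1 (to_z p)"])
  fix w show "to_z (prepend LX (word w)) = shift_first 1 (to_z (word w))"
    by (cases "z_word w") (simp_all add: shift_first_def)
qed (auto intro!: qlinI simp: supp_in_def)

lemma shift_first_prepend [simp]: "shift_first k (prepend a p) = prepend (a + k) p"
  by (rule linear_eq_on_words[where s=qscale and A=UNIV and f="\<lambda>p. shift_first k (prepend a p)"
        and g="\<lambda>p. prepend (a + k) p"])
    (auto intro!: qlinI simp: supp_in_def)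

lemma shift_first_sum [simp]: "shift_first k (sum f A) = (\<Sum>i\<in>A. shift_first k (f i))"
  by (simp add: shift_first_def)

lemma shuffle_word_Nil2 [simp]: "shuffle_word u [] = word u"
  by (cases u) simp_all

definition shuffle_y :: "nat list \<Rightarrow> zpoly" where
  "shuffle_y w = to_z (shuffle_word (xy_word w) [LY])"

definition shuffle_xy :: "nat list \<Rightarrow> zpoly" where
  "shuffle_xy w = to_z (shuffle_word (xy_word w) [LX, LY])"

text \<open>The new \<open>y\<close> falls behind the whole block or cuts it after \<open>j\<close>
  letters \<open>x\<close>.\<close>

lemma shuffle_y_block:
  assumes "w \<in> lists {1..}"
  shows "to_z (shuffle_word (replicate c LX @ LY # xy_word w) [LY])
    = prepend (Suc c) (shuffle_y w) + (\<Sum>j<Suc c. word (Suc j # (Suc c - j) # w))"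
proof (induction c)
  case 0
  then show ?case using assms by (simp add: shuffle_y_def)
next
  case (Suc c)
  have "to_z (shuffle_word (replicate (Suc c) LX @ LY # xy_word w) [LY])
      = shift_first 1 (to_z (shuffle_word (replicate c LX @ LY # xy_word w) [LY])) + word (1 # Suc (Suc c) # w)"
    using assms by simp
  also have "\<dots> = prepend (Suc (Suc c)) (shuffle_y w)
      + (word (1 # Suc (Suc c) # w) + (\<Sum>j<Suc c. word (Suc (Suc j) # (Suc c - j) # w)))"
    unfolding Suc by (simp add: algebra_simps del: sum.lessThan_Suc)
  also have "word (1 # Suc (Suc c) # w) + (\<Sum>j<Suc c. word (Suc (Suc j) # (Suc c - j) # w))
      = (\<Sum>j<Suc (Suc c). word (Suc j # (Suc (Suc c) - j) # w))"
    unfolding sum.lessThan_Suc_shift[of _ "Suc c"] by simp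
  finally show ?case .
qed

text \<open>Three cases: both new letters fall behind the block; \<open>x\<close> joins the block in
  one of \<open>c + 1\<close> equivalent places and \<open>y\<close> falls behind; or both enter it,
  \<open>y\<close> leaving \<open>d\<close> letters \<open>x\<close> to its right and
  \<open>x\<close> having \<open>c + 1 - d\<close> equivalent places to its left.\<close>

lemma shuffle_xy_block:
  assumes "w \<in> lists {1..}"
  shows "to_z (shuffle_word (replicate c LX @ LY # xy_word w) [LX, LY])
    = prepend (Suc c) (shuffle_xy w) + qscale (of_nat (Suc c)) (prepend (Suc (Suc c)) (shuffle_y w))
      + (\<Sum>d<Suc c. qscale (of_nat (Suc c - d)) (word ((Suc (Suc c) - d) # Suc d # w)))"
proof (induction c)
  case 0
  have "to_z (shuffle_word (replicate 0 LX @ LY # xy_word w) [LX, LY])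
      = prepend 1 (shuffle_xy w) + shift_first 1 (to_z (shuffle_word (replicate 0 LX @ LY # xy_word w) [LY]))"
    by (simp add: shuffle_xy_def)
  then show ?case unfolding shuffle_y_block[OF assms] by (simp add: numeral_2_eq_2)
next
  case (Suc c)
  let ?f = "\<lambda>d. word ((Suc (Suc (Suc c)) - d) # Suc d # w)"
  have y: "shift_first 1 (to_z (shuffle_word (replicate (Suc c) LX @ LY # xy_word w) [LY]))
      = prepend (Suc (Suc (Suc c))) (shuffle_y w) + (\<Sum>d<Suc (Suc c). ?f d)"
  proof -
    have "(\<Sum>j<Suc (Suc c). word (Suc (Suc j) # (Suc (Suc c) - j) # w)) = (\<Sum>j<Suc (Suc c). ?f (Suc (Suc c) - Suc j))"
    proof (rule sum.cong)
      fix j assume "j \<in> {..<Suc (Suc c)}"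
      then have "Suc (Suc (Suc c)) - (Suc (Suc c) - Suc j) = Suc (Suc j)" "Suc (Suc (Suc c) - Suc j) = Suc (Suc c) - j"
        by auto
      then show "word (Suc (Suc j) # (Suc (Suc c) - j) # w) = ?f (Suc (Suc c) - Suc j)" by simp
    qed simp
    also have "\<dots> = (\<Sum>d<Suc (Suc c). ?f d)" by (rule sum.nat_diff_reindex)
    finally show ?thesis
      unfolding shuffle_y_block[OF assms] by (simp del: sum.lessThan_Suc)
  qed
  have x: "shift_first 1 (\<Sum>d<Suc c. qscale (of_nat (Suc c - d)) (word ((Suc (Suc c) - d) # Suc d # w)))
      = (\<Sum>d<Suc (Suc c). qscale (of_nat (Suc c - d)) (?f d))"
  proof -
    have "shift_first 1 (\<Sum>d<Suc c. qscale (of_nat (Suc c - d)) (word ((Suc (Suc c) - d) # Suc d # w)))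
      = (\<Sum>d<Suc c. qscale (of_nat (Suc c - d)) (?f d))"
      unfolding shift_first_sum by (intro sum.cong) (auto simp: Suc_diff_le)
    then show ?thesis by simp
  qed
  have z: "(\<Sum>d<Suc (Suc c). qscale (of_nat (Suc c - d)) (?f d)) + (\<Sum>d<Suc (Suc c). ?f d)
      = (\<Sum>d<Suc (Suc c). qscale (of_nat (Suc (Suc c) - d)) (?f d))"
    unfolding sum.distrib[symmetric]
  proof (rule sum.cong)
    fix d assume "d \<in> {..<Suc (Suc c)}"
    then have "of_nat (Suc (Suc c) - d) = (of_nat (Suc c - d) + 1 :: rat)"
      by (metis Suc_diff_le lessThan_iff less_Suc_eq_le of_nat_Suc add.commute)
    then show "qscale (of_nat (Suc c - d)) (?f d) + ?f d = qscale (of_nat (Suc (Suc c) - d)) (?f d)"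
      by (simp only: qs.scale_left_distrib qs.scale_one)
  qed simp
  have "to_z (shuffle_word (replicate (Suc c) LX @ LY # xy_word w) [LX, LY])
      = shift_first 1 (to_z (shuffle_word (replicate c LX @ LY # xy_word w) [LX, LY]))
        + shift_first 1 (to_z (shuffle_word (replicate (Suc c) LX @ LY # xy_word w) [LY]))"
    by simp
  also have "\<dots> = prepend (Suc (Suc c)) (shuffle_xy w)
      + (qscale (of_nat (Suc c)) (prepend (Suc (Suc (Suc c))) (shuffle_y w)) + prepend (Suc (Suc (Suc c))) (shuffle_y w))
      + ((\<Sum>d<Suc (Suc c). qscale (of_nat (Suc c - d)) (?f d)) + (\<Sum>d<Suc (Suc c). ?f d))"
    unfolding y Suc shift_first_simps(1) x by (simp add: add_ac del: sum.lessThan_Suc of_nat_Suc)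
  also have "qscale (of_nat (Suc c)) (prepend (Suc (Suc (Suc c))) (shuffle_y w)) + prepend (Suc (Suc (Suc c))) (shuffle_y w)
      = qscale (of_nat (Suc (Suc c))) (prepend (Suc (Suc (Suc c))) (shuffle_y w))"
    by (simp only: of_nat_Suc[of "Suc c"] qs.scale_left_distrib qs.scale_one add.commute)
  finally show ?case unfolding z by (simp only: add.assoc)
qed

text \<open>A \<open>y\<close> inserted directly before or directly after an existing
  \<open>y\<close> gives the same word, so each \<open>z_1\<close> appears twice, except in front of
  the word, where it appears once.\<close>

lemma shuffle_y_eq:
  assumes "w \<in> lists {2..}"
  shows "shuffle_y w = qscale 2 (insert_1 w) - word (1 # w) + split_letter w"
  using assms
proof (induction w rule: list.induct)
  case Nil
  have "qscale 2 (word [1]) = word [1] + (word [1] :: zpoly)"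
    by (metis one_add_one qs.scale_left_distrib qs.scale_one)
  then show ?case by (simp add: shuffle_y_def insert_1_simps)
next
  case (Cons k w)
  then have k: "k \<ge> 2" and w: "w \<in> lists {2..}" "w \<in> lists {1..}" using lists2_lists1 by auto
  obtain c where c: "k = Suc (Suc c)" using k by (metis One_nat_def Suc_1 Suc_le_D Suc_le_mono)
  have "shuffle_y (k # w) = prepend k (shuffle_y w) + (\<Sum>j<k. word (Suc j # (k - j) # w))"
    using shuffle_y_block[OF w(2), of "k - 1"] k by (simp add: shuffle_y_def)
  also have "(\<Sum>j<k. word (Suc j # (k - j) # w)) = word (1 # k # w) + (\<Sum>j=1..<k - 1. word (Suc j # (k - j) # w)) + word (k # 1 # w)"
  proof -
    have "(\<Sum>j<k. word (Suc j # (k - j) # w)) = (\<Sum>j=0..<Suc c. word (Suc j # (k - j) # w)) + word (k # 1 # w)"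
      by (simp add: c atLeast0LessThan)
    also have "(\<Sum>j=0..<Suc c. word (Suc j # (k - j) # w)) = word (1 # k # w) + (\<Sum>j=Suc 0..<Suc c. word (Suc j # (k - j) # w))"
      by (subst sum.atLeast_Suc_lessThan) (simp_all add: c)
    finally show ?thesis by (simp add: c)
  qed
  finally show ?case
    unfolding Cons.IH[OF w(1)] insert_1_simps split_letter.simps
    by (simp add: qs.scale_right_distrib qs.scale_left_distrib[of 1 1, simplified] algebra_simps)
qed

lemma shuffle_xy_eq:
  assumes "w \<in> lists {2..}"
  shows "shuffle_xy w = shuffle_2_part w + qscale 2 (raise_insert_1 w)"
  using assms
proof (induction w rule: list.induct)
  case Nil
  then show ?case by (simp add: shuffle_xy_def raise_insert_1_simps numeral_2_eq_2)
next
  case (Cons k w)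
  then have k: "k \<ge> 2" and w: "w \<in> lists {2..}" "w \<in> lists {1..}" using lists2_lists1 by auto
  have "shuffle_xy (k # w) = prepend k (shuffle_xy w) + qscale (of_nat k) (prepend (Suc k) (shuffle_y w))
      + (\<Sum>d<k. qscale (of_nat (k - d)) (word ((Suc k - d) # Suc d # w)))"
    using shuffle_xy_block[OF w(2), of "k - 1"] k by (simp add: shuffle_xy_def)
  \<comment> \<open>The term \<open>d = 0\<close> supplies the second copy of the \<open>z_1\<close>
    in front of \<open>w\<close> that \<open>shuffle_y w\<close> lacks, so the factor 2 becomes
    uniform.\<close>
  also have "(\<Sum>d<k. qscale (of_nat (k - d)) (word ((Suc k - d) # Suc d # w)))
      = qscale (of_nat k) (word (Suc k # 1 # w)) + (\<Sum>d=1..<k. qscale (of_nat (k - d)) (word ((Suc k - d) # Suc d # w)))"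
    unfolding atLeast0LessThan[symmetric] using k by (subst sum.atLeast_Suc_lessThan) simp_all
  finally show ?case
    unfolding Cons.IH[OF w(1)] shuffle_y_eq[OF w(1)] raise_insert_1_simps shuffle_2_part.simps
    by (simp add: qs.scale_right_distrib qs.scale_right_diff_distrib algebra_simps)
qed

lemma shuffle_word_2:
  assumes "w \<in> lists {2..}"
  shows "shuffle (word w) (word [2]) = shuffle_2_part w + qscale 2 (raise_insert_1 w)"
  using shuffle_xy_eq[OF assms] by (simp add: shuffle_words shuffle_xy_def numeral_2_eq_2)

definition weight_words :: "nat \<Rightarrow> nat list set" where
  "weight_words n = {w \<in> lists {2..}. sum_list w = n}"

lemma split_letter_support:
  assumes "w \<in> lists {2..}"
  shows "split_letter w \<in> supp_in (weight_words (Suc (sum_list w)))"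
  using assms
proof (induction w rule: list.induct)
  case (Cons k w)
  then show ?case
    by (auto intro!: supp_in_add supp_in_sum simp: weight_words_def elim!: prepend_in_supp_in)
qed simp

lemma shuffle_2_part_support:
  assumes "w \<in> lists {2..}"
  shows "shuffle_2_part w \<in> supp_in (weight_words (sum_list w + 2))"
  using assms
proof (induction w rule: list.induct)
  case (Cons k w)
  have "prepend (Suc k) (split_letter w) \<in> supp_in (weight_words (sum_list (k # w) + 2))"
    by (rule prepend_in_supp_in[OF split_letter_support]) (use Cons.prems in \<open>auto simp: weight_words_def\<close>)
  moreover have "prepend k (shuffle_2_part w) \<in> supp_in (weight_words (sum_list (k # w) + 2))"
    by (rule prepend_in_supp_in[OF Cons.IH]) (use Cons.prems in \<open>auto simp: weight_words_def\<close>)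
  moreover have "(\<Sum>d=1..<k. qscale (of_nat (k - d)) (word ((Suc k - d) # Suc d # w))) \<in> supp_in (weight_words (sum_list (k # w) + 2))"
    by (intro supp_in_sum supp_in_qscale) (use Cons.prems in \<open>auto simp: weight_words_def\<close>)
  ultimately show ?case by (simp only: shuffle_2_part.simps) (intro supp_in_add supp_in_qscale)
qed (auto simp: weight_words_def)

lemma raise_gap_support:
  assumes "w \<in> lists {2..}"
  shows "raise_gap w \<in> supp_in (weight_words (sum_list w + 2))"
  unfolding raise_gap_def
proof (rule raise_sum_in_subspace[OF subspace_supp_in assms])
  fix P Q :: "nat list"
  assume PQ: "P \<in> lists {2..}" "Q \<in> lists {2..}" "sum_list P + sum_list Q = Suc (sum_list w)"
  show "gap_elem P Q \<in> supp_in (weight_words (sum_list w + 2))"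
    using gap_elem_support[OF PQ(1,2)] by (rule supp_in_mono) (use PQ in \<open>auto simp: weight_words_def\<close>)
qed

lemma insert_1_support:
  assumes "w \<in> lists {1..}"
  shows "insert_1 w \<in> supp_in (lists {1..})"
  unfolding insert_1_def by (rule split_sum_in_subspace[OF subspace_supp_in]) (use assms in auto)

lemma raise_insert_1_support:
  assumes "w \<in> lists {1..}"
  shows "raise_insert_1 w \<in> supp_in (lists {1..})"
  using assms
proof (induction w rule: list.induct)
  case (Cons k w)
  have "prepend (Suc k) (insert_1 w) \<in> supp_in (lists {1..})"
    by (rule prepend_in_supp_in[OF insert_1_support]) (use Cons.prems in auto)
  moreover have "prepend k (raise_insert_1 w) \<in> supp_in (lists {1..})"
    by (rule prepend_in_supp_in[OF Cons.IH]) (use Cons.prems in auto)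
  ultimately show ?case unfolding raise_insert_1_simps by (intro supp_in_add supp_in_qscale)
qed (simp add: raise_insert_1_simps)

lemma strip2_shuffle_2_part:
  assumes "w \<in> lists {2..}"
  shows "strip2 (shuffle_2_part w) = word w + (if take 1 w = [2] then shuffle_2_part (tl w) else 0)"
proof (cases w)
  case (Cons k v)
  then have k: "k \<ge> 2" using assms by auto
  have "(\<Sum>d=1..<k. strip2 (qscale (of_nat (k - d)) (word ((Suc k - d) # Suc d # v))))
      = (\<Sum>d=1..<k. if d = k - 1 then word w else 0)"
    using k Cons by (intro sum.cong) auto
  also have "\<dots> = word w" using k by (subst sum.delta) auto
  finally show ?thesis using k unfolding Cons shuffle_2_part.simps strip2_simps
    by (simp del: strip2_word)
qed simp

section \<open>An explicit formula for the derivation\<close>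

definition pole_weight :: "nat \<Rightarrow> nat \<Rightarrow> rat" where
  "pole_weight M m = (\<Sum>i=1..m. 1 / (of_nat M - of_nat i))"

text \<open>The first variation of the truncated sum when every index \<open>m\<close> is displaced
  by \<open>- pole_weight M m\<close>: \<open>1 / m ^ k\<close> varies by
  \<open>k * pole_weight M m / m ^ Suc k\<close>.\<close>

fun gap_derivation :: "nat \<Rightarrow> nat list \<Rightarrow> nat \<Rightarrow> rat" where
  "gap_derivation M [] N = 0"
| "gap_derivation M (k # w) N = (\<Sum>m=1..<N. of_nat k / of_nat m ^ Suc k * pole_weight M m * zeta_trunc_word m w
     + gap_derivation M w m / of_nat m ^ k)"

lemma split_sum_linear:
  fixes f :: "'i \<Rightarrow> nat list \<Rightarrow> nat list \<Rightarrow> rat"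
  shows "split_sum w (\<lambda>P Q. \<Sum>i\<in>A. c i * f i P Q) = (\<Sum>i\<in>A. c i * split_sum w (f i))"
  by (induction w arbitrary: f) (simp_all add: distrib_left sum.distrib)

lemma raise_sum_linear:
  fixes f :: "'i \<Rightarrow> nat list \<Rightarrow> nat list \<Rightarrow> rat"
  shows "raise_sum w (*) (\<lambda>P Q. \<Sum>i\<in>A. c i * f i P Q) = (\<Sum>i\<in>A. c i * raise_sum w (*) (f i))"
  by (induction w arbitrary: f)
    (simp_all add: split_sum_linear distrib_left sum.distrib sum_distrib_left mult_ac)

text \<open>Given \<open>p > p_1 > p_2 > ...\<close>, each \<open>m\<close> with
  \<open>1 <= m <= p\<close> fits into exactly one slot, thanks to the mixture of weak and strict
  inequalities in \<open>gap_sum\<close>. Summed over all slots, \<open>m\<close> is therefore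
  independent of the other indices.\<close>

lemma split_sum_gap_sum:
  "split_sum w (\<lambda>P Q. gap_sum M P Q (if P = [] then Suc p else p)) = pole_weight M p * zeta_trunc_word p w"
proof (induction w arbitrary: p)
  case Nil
  then show ?case by (simp add: pole_weight_def atLeastLessThanSuc_atLeastAtMost)
next
  case (Cons k w)
  have "split_sum w (\<lambda>P Q. gap_sum M (k # P) Q p) = (\<Sum>m=1..<p. 1 / of_nat m ^ k * (pole_weight M m * zeta_trunc_word m w))" for p
    unfolding gap_sum.simps(2) split_sum_linear Cons.IH ..
  moreover have "gap_sum M [] (k # w) (Suc p) + (\<Sum>m=1..<p. 1 / of_nat m ^ k * (pole_weight M m * zeta_trunc_word m w))
      = pole_weight M p * zeta_trunc_word p (k # w)"
  proof (induction p)
    case (Suc p)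
    show ?case
    proof (cases "p = 0")
      case False
      define x y :: rat where "x = 1 / of_nat p ^ k" and "y = 1 / (of_nat M - of_nat (Suc p))"
      have "pole_weight M (Suc p) = pole_weight M p + y"
        by (simp add: pole_weight_def y_def)
      moreover have "gap_sum M [] (k # w) (Suc (Suc p)) = gap_sum M [] (k # w) (Suc p) + zeta_trunc_word (Suc p) (k # w) * y"
        by (simp add: atLeastLessThanSuc y_def)
      moreover have "zeta_trunc_word (Suc p) (k # w) = zeta_trunc_word p (k # w) + x * zeta_trunc_word p w"
        using False by (simp add: zeta_trunc_word_Suc x_def)
      moreover have "(\<Sum>m=1..<Suc p. 1 / of_nat m ^ k * (pole_weight M m * zeta_trunc_word m w))
          = (\<Sum>m=1..<p. 1 / of_nat m ^ k * (pole_weight M m * zeta_trunc_word m w)) + x * (pole_weight M p * zeta_trunc_word p w)"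
        using False by (simp add: atLeastLessThanSuc x_def)
      moreover note Suc.IH
      ultimately show ?thesis
        by (simp only:) (simp add: algebra_simps del: gap_sum.simps)
    qed simp
  qed simp
  ultimately show ?case by simp
qed

lemma raise_sum_gap_sum: "raise_sum w (*) (\<lambda>P Q. gap_sum M P Q N) = gap_derivation M w N"
proof (induction w arbitrary: N)
  case (Cons k w)
  have "split_sum w (\<lambda>P Q. gap_sum M (Suc k # P) Q N)
      = (\<Sum>m=1..<N. 1 / of_nat m ^ Suc k * (pole_weight M m * zeta_trunc_word m w))"
    unfolding gap_sum.simps(2) split_sum_linear split_sum_gap_sum ..
  moreover have "raise_sum w (*) (\<lambda>P Q. gap_sum M (k # P) Q N) = (\<Sum>m=1..<N. 1 / of_nat m ^ k * gap_derivation M w m)"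
  proof -
    have "raise_sum w (*) (\<lambda>P Q. gap_sum M (k # P) Q N) = raise_sum w (*) (\<lambda>P Q. \<Sum>m=1..<N. 1 / of_nat m ^ k * gap_sum M P Q m)"
      by (rule raise_sum_cong[where A=UNIV]) auto
    then show ?thesis unfolding raise_sum_linear Cons.IH .
  qed
  ultimately show ?case by (simp add: sum.distrib sum_distrib_left mult_ac)
qed simp

lemma gap_derivation_Suc:
  "gap_derivation M (k # w) (Suc N) = gap_derivation M (k # w) N
    + (if N = 0 then 0 else of_nat k / of_nat N ^ Suc k * pole_weight M N * zeta_trunc_word N w
         + gap_derivation M w N / of_nat N ^ k)"
  by (cases N) (simp_all add: atLeastLessThanSuc)

definition gap_derivation_ext :: "nat \<Rightarrow> nat \<Rightarrow> zpoly \<Rightarrow> rat" where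
  "gap_derivation_ext M N = rat_ext (\<lambda>w. gap_derivation M w N)"

lemma gap_derivation_ext_simps [simp]:
  "gap_derivation_ext M N (p + q) = gap_derivation_ext M N p + gap_derivation_ext M N q"
  "gap_derivation_ext M N (qscale c p) = c * gap_derivation_ext M N p"
  "gap_derivation_ext M N (word w) = gap_derivation M w N"
  by (simp_all add: gap_derivation_ext_def)

lemma gap_derivation_ext_prepend_Suc:
  "gap_derivation_ext M (Suc N) (prepend a p) = gap_derivation_ext M N (prepend a p)
    + (if N = 0 then 0 else of_nat a / of_nat N ^ Suc a * pole_weight M N * zeta_trunc N p
         + gap_derivation_ext M N p / of_nat N ^ a)"
  by (rule linear_eq_on_words[where s="(*)" and A=UNIV
        and f="\<lambda>p. gap_derivation_ext M (Suc N) (prepend a p)"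
        and g="\<lambda>p. gap_derivation_ext M N (prepend a p)
          + (if N = 0 then 0 else of_nat a / of_nat N ^ Suc a * pole_weight M N * zeta_trunc N p
            + gap_derivation_ext M N p / of_nat N ^ a)"])
    (auto intro!: qformI simp: supp_in_def gap_derivation_Suc algebra_simps add_divide_distrib simp del: gap_derivation.simps)

lemma gap_derivation_ext_prepend_0 [simp]: "gap_derivation_ext M 0 (prepend a p) = 0"
  by (rule linear_eq_on_words[where s="(*)" and A=UNIV and f="\<lambda>p. gap_derivation_ext M 0 (prepend a p)" and g="\<lambda>p. 0"])
    (auto intro!: qformI simp: supp_in_def)

text \<open>Induction on the bound with \<open>M\<close> fixed. The factor \<open>k\<close> is
  additive in the exponent, so a merged letter \<open>a + b\<close> varies by the product
  rule.\<close>

lemma gap_derivation_harmonic_word: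
  "gap_derivation_ext M N (harmonic_word u v)
    = gap_derivation M u N * zeta_trunc_word N v + zeta_trunc_word N u * gap_derivation M v N"
proof (induction u v arbitrary: N rule: harmonic_word.induct)
  case (3 a u b v)
  show ?case
  proof (induction N)
    case 0
    then show ?case by simp
  next
    case (Suc N)
    show ?case
    proof (cases "N = 0")
      case True
      then show ?thesis by (simp add: gap_derivation_ext_prepend_Suc)
    next
      case False
      define x y h :: rat where "x = 1 / of_nat N ^ a" and "y = 1 / of_nat N ^ b"
        and "h = pole_weight M N / of_nat N"
      have g: "gap_derivation M (k # w) (Suc N) = gap_derivation M (k # w) N
          + (of_nat k * h * zeta_trunc_word N w + gap_derivation M w N) * (1 / of_nat N ^ k)" for k w
        using False unfolding gap_derivation_Suc by (simp add: h_def field_simps del: gap_derivation.simps)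
      have e: "gap_derivation_ext M (Suc N) (prepend k p) = gap_derivation_ext M N (prepend k p)
          + (of_nat k * h * zeta_trunc N p + gap_derivation_ext M N p) * (1 / of_nat N ^ k)" for k p
        using False unfolding gap_derivation_ext_prepend_Suc by (simp add: h_def field_simps)
      have z: "zeta_trunc_word (Suc N) (k # w) = zeta_trunc_word N (k # w) + 1 / of_nat N ^ k * zeta_trunc_word N w" for k w
        using False by (simp add: zeta_trunc_word_Suc)
      have xy: "1 / of_nat N ^ (a + b) = x * y" by (simp add: x_def y_def power_add)
      have "gap_derivation_ext M (Suc N) (harmonic_word (a # u) (b # v)) =
          gap_derivation_ext M N (harmonic_word (a # u) (b # v))
          + (of_nat a * h * zeta_trunc N (harmonic_word u (b # v)) + gap_derivation_ext M N (harmonic_word u (b # v))) * x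
          + (of_nat b * h * zeta_trunc N (harmonic_word (a # u) v) + gap_derivation_ext M N (harmonic_word (a # u) v)) * y
          + (of_nat (a + b) * h * zeta_trunc N (harmonic_word u v) + gap_derivation_ext M N (harmonic_word u v)) * (x * y)"
        unfolding harmonic_word.simps(3) gap_derivation_ext_simps e xy x_def[symmetric] y_def[symmetric] by simp
      also have "\<dots> = gap_derivation M (a # u) (Suc N) * zeta_trunc_word (Suc N) (b # v)
          + zeta_trunc_word (Suc N) (a # u) * gap_derivation M (b # v) (Suc N)"
        unfolding Suc.IH "3.IH" zeta_trunc_harmonic_word g z x_def[symmetric] y_def[symmetric]
        by (simp add: algebra_simps del: gap_derivation.simps)
      finally show ?thesis .
    qed
  qed
qed simp_all

lemma gap_derivation_harmonic:
  "gap_derivation_ext M N (p \<star> q)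
    = gap_derivation_ext M N p * zeta_trunc N q + zeta_trunc N p * gap_derivation_ext M N q"
proof -
  have w: "gap_derivation_ext M N (word u \<star> q)
      = gap_derivation_ext M N (word u) * zeta_trunc N q + zeta_trunc N (word u) * gap_derivation_ext M N q" for u
    by (rule linear_eq_on_words[where s="(*)" and A=UNIV and f="\<lambda>q. gap_derivation_ext M N (word u \<star> q)"
          and g="\<lambda>q. gap_derivation_ext M N (word u) * zeta_trunc N q + zeta_trunc N (word u) * gap_derivation_ext M N q"])
      (auto intro!: qformI simp: supp_in_def gap_derivation_harmonic_word algebra_simps)
  show ?thesis
    by (rule linear_eq_on_words[where s="(*)" and A=UNIV and f="\<lambda>p. gap_derivation_ext M N (p \<star> q)"
          and g="\<lambda>p. gap_derivation_ext M N p * zeta_trunc N q + zeta_trunc N p * gap_derivation_ext M N q"])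
      (use w in \<open>auto intro!: qformI simp: supp_in_def algebra_simps\<close>)
qed

lemma zeta_trunc_raise_gap:
  assumes "w \<in> lists {2..}" "N \<ge> 1"
  shows "zeta_trunc N (raise_gap w) = zeta_trunc N (raise_insert_1 w) + gap_derivation N w N"
proof -
  have add: "raise_sum w (*) (\<lambda>P Q. f P Q + g P Q) = raise_sum w (*) f + raise_sum w (*) g"
    for f g :: "nat list \<Rightarrow> nat list \<Rightarrow> rat"
  proof -
    have s: "split_sum w (\<lambda>P Q. f P Q + g P Q) = split_sum w f + split_sum w g"
      for w and f g :: "nat list \<Rightarrow> nat list \<Rightarrow> rat"
      by (induction w arbitrary: f g) (simp_all add: algebra_simps)
    show ?thesis by (induction w arbitrary: f g) (simp_all add: s algebra_simps)
  qed
  have "zeta_trunc N (raise_gap w) = raise_sum w (*) (\<lambda>P Q. zeta_trunc_word N (P @ 1 # Q) + gap_sum N P Q N)"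
    unfolding raise_gap_def raise_sum_hom[OF zeta_trunc_linear]
    by (rule raise_sum_cong[OF assms(1)]) (use assms(2) in \<open>auto simp: zeta_trunc_gap_elem\<close>)
  then show ?thesis
    unfolding add raise_sum_gap_sum raise_insert_1_def raise_sum_hom[OF zeta_trunc_linear] by simp
qed

lemma zeta_modified_raise_insert_1:
  assumes "w \<in> lists {2..}" "N \<ge> 1"
  shows "zeta_modified N (raise_insert_1 w) = zeta_trunc N (raise_gap w)"
  unfolding raise_insert_1_def raise_gap_def raise_sum_hom[OF zeta_trunc_linear] raise_sum_hom[OF zeta_modified_linear]
proof (rule raise_sum_cong[OF assms(1)])
  fix P Q :: "nat list" assume "P \<noteq> []" "P \<in> lists {2..}" "Q \<in> lists {2..}"
  then show "zeta_modified N (word (P @ 1 # Q)) = zeta_trunc N (gap_elem P Q)"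
    using zeta_modified_insert_1[of P Q N] zeta_trunc_gap_elem[of P Q N] assms(2) by simp
qed auto

section \<open>The explicit form of \<open>partial_op\<close> and the defect
  \<open>R_op\<close>\<close>

definition partial_word :: "nat list \<Rightarrow> zpoly" where
  "partial_word w = shuffle_2_part w + qscale 2 (raise_gap w)"

definition partial_explicit :: "zpoly \<Rightarrow> zpoly" where
  "partial_explicit p = lin_ext partial_word p - p \<star> word [2]"

lemma partial_explicit_linear: "qlin partial_explicit"
  by (rule qlinI) (simp_all add: partial_explicit_def qs.scale_right_diff_distrib algebra_simps)

lemmas partial_explicit_simps [simp] =
  module_hom.add[OF partial_explicit_linear] module_hom.scale[OF partial_explicit_linear]
  module_hom.zero[OF partial_explicit_linear] module_hom.diff[OF partial_explicit_linear]
  module_hom.neg[OF partial_explicit_linear]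

lemma partial_word_support:
  assumes "w \<in> lists {2..}"
  shows "partial_word w \<in> supp_in (weight_words (sum_list w + 2))"
  unfolding partial_word_def
  by (intro supp_in_add supp_in_qscale shuffle_2_part_support raise_gap_support assms)

lemma word_2_Hge2: "word [2] \<in> Hge2"
  by (simp add: Hge2_eq)

lemma subspace_Hge2: "qs.subspace Hge2"
  unfolding Hge2_eq by (rule subspace_supp_in)

lemma subspace_H1: "qs.subspace H1"
  unfolding H1_eq by (rule subspace_supp_in)

lemma partial_explicit_Hge2:
  assumes "p \<in> Hge2"
  shows "partial_explicit p \<in> Hge2"
proof -
  have "lin_ext partial_word p \<in> Hge2"
    using assms unfolding Hge2_eq
  proof (rule lin_ext_in_supp_in)
    fix w :: "nat list" assume "w \<in> lists {2..}"
    from partial_word_support[OF this] show "partial_word w \<in> supp_in (lists {2..})"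
      by (rule supp_in_mono) (auto simp: weight_words_def)
  qed
  then show ?thesis
    unfolding partial_explicit_def
    using qs.subspace_diff[OF subspace_Hge2] harmonic_Hge2[OF assms word_2_Hge2] by blast
qed

text \<open>On \<open>Hge2\<close> modified and truncated sums agree, so the harmonic product and
  \<open>shuffle_2_part\<close> are unaffected by Drop1; only the words with a \<open>z_1\<close>
  are replaced, by gap elements.\<close>

lemma zeta_modified_phi:
  assumes "p \<in> Hge2" "N \<ge> 1"
  shows "zeta_modified N (phi p) = - zeta_trunc N (partial_explicit p)"
proof -
  have "zeta_modified N (shuffle p (word [2])) = zeta_trunc N (lin_ext partial_word p)"
  proof (rule linear_eq_on_words[where s="(*)" and f="\<lambda>p. zeta_modified N (shuffle p (word [2]))"
        and g="\<lambda>p. zeta_trunc N (lin_ext partial_word p)", OF _ _ assms(1)[unfolded Hge2_eq]])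
    show "qform (\<lambda>p. zeta_modified N (shuffle p (word [2])))"
      by (rule qlin_comp[OF shuffle_linear_left zeta_modified_linear])
    show "qform (\<lambda>p. zeta_trunc N (lin_ext partial_word p))"
      by (rule qlin_comp[OF lin_ext_linear zeta_trunc_linear])
    fix w :: "nat list" assume w: "w \<in> lists {2..}"
    have "shuffle_2_part w \<in> Hge2"
      using shuffle_2_part_support[OF w] unfolding Hge2_eq by (rule supp_in_mono) (auto simp: weight_words_def)
    then show "zeta_modified N (shuffle (word w) (word [2])) = zeta_trunc N (lin_ext partial_word (word w))"
      using assms(2) w by (simp add: shuffle_word_2 partial_word_def zeta_modified_Hge2 zeta_modified_raise_insert_1)
  qed
  then show ?thesis
    using zeta_modified_Hge2[OF harmonic_Hge2[OF assms(1) word_2_Hge2] assms(2)]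
    by (simp add: phi_def partial_explicit_def)
qed

lemma partial_op_eq:
  assumes "p \<in> Hge2"
  shows "partial_op p = partial_explicit p"
proof -
  have D: "- partial_explicit p \<in> Hge2"
    using qs.subspace_neg[OF subspace_Hge2 partial_explicit_Hge2[OF assms]] .
  have "drop1 (phi p) = - partial_explicit p"
    unfolding drop1_def
  proof (rule the_equality)
    show "- partial_explicit p \<in> Hge2 \<and> (\<forall>N\<ge>1. zeta_trunc N (- partial_explicit p) = zeta_modified N (phi p))"
      using D by (simp add: zeta_modified_phi[OF assms])
    fix v assume v: "v \<in> Hge2 \<and> (\<forall>N\<ge>1. zeta_trunc N v = zeta_modified N (phi p))"
    then show "v = - partial_explicit p"
      by (intro zeta_trunc_inj) (auto simp: Hge2_H1 D zeta_modified_phi[OF assms])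
  qed
  then show ?thesis by (simp add: partial_op_def)
qed

text \<open>Passing from modified to truncated sums changes only the words with a
  \<open>z_1\<close>, and their total correction is twice \<open>gap_derivation\<close> on the
  diagonal.\<close>

lemma zeta_trunc_phi:
  assumes "p \<in> Hge2" "N \<ge> 1"
  shows "zeta_trunc N (phi p) = 2 * gap_derivation_ext N N p - zeta_trunc N (partial_explicit p)"
proof -
  have "zeta_trunc N (shuffle p (word [2])) = zeta_trunc N (lin_ext partial_word p) - 2 * gap_derivation_ext N N p"
  proof (rule linear_eq_on_words[where s="(*)" and f="\<lambda>p. zeta_trunc N (shuffle p (word [2]))"
        and g="\<lambda>p. zeta_trunc N (lin_ext partial_word p) - 2 * gap_derivation_ext N N p", OF _ _ assms(1)[unfolded Hge2_eq]])
    show "qform (\<lambda>p. zeta_trunc N (shuffle p (word [2])))"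
      by (rule qlin_comp[OF shuffle_linear_left zeta_trunc_linear])
    show "qform (\<lambda>p. zeta_trunc N (lin_ext partial_word p) - 2 * gap_derivation_ext N N p)"
      by (rule qformI) (auto simp: algebra_simps)
    fix w :: "nat list" assume w: "w \<in> lists {2..}"
    then show "zeta_trunc N (shuffle (word w) (word [2])) = zeta_trunc N (lin_ext partial_word (word w)) - 2 * gap_derivation_ext N N (word w)"
      using assms(2) by (simp add: shuffle_word_2 partial_word_def zeta_trunc_raise_gap)
  qed
  then show ?thesis by (simp add: phi_def partial_explicit_def)
qed

lemma phi_H1:
  assumes "p \<in> Hge2"
  shows "phi p \<in> H1"
proof -
  have "shuffle p (word [2]) \<in> H1"
  proof (rule subspace_word_induct[where P="\<lambda>p. shuffle p (word [2]) \<in> H1", OF _ assms[unfolded Hge2_eq]])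
    show "qs.subspace {p. shuffle p (word [2]) \<in> H1}"
      by (rule qs.subspaceI)
        (auto simp: module_hom.zero[OF shuffle_linear_left] module_hom.add[OF shuffle_linear_left]
          module_hom.scale[OF shuffle_linear_left] qs.subspace_0[OF subspace_H1] qs.subspace_add[OF subspace_H1]
          qs.subspace_scale[OF subspace_H1])
    fix w :: "nat list" assume w: "w \<in> lists {2..}"
    have "shuffle_2_part w \<in> Hge2"
      using shuffle_2_part_support[OF w] unfolding Hge2_eq by (rule supp_in_mono) (auto simp: weight_words_def)
    moreover have "raise_insert_1 w \<in> H1"
      unfolding H1_eq by (rule raise_insert_1_support) (use w lists2_lists1 in blast)
    ultimately show "shuffle (word w) (word [2]) \<in> H1"
      unfolding shuffle_word_2[OF w]
      using qs.subspace_add[OF subspace_H1 Hge2_H1 qs.subspace_scale[OF subspace_H1]] by blast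
  qed
  then show ?thesis
    unfolding phi_def using Hge2_H1[OF harmonic_Hge2[OF assms word_2_Hge2]] qs.subspace_diff[OF subspace_H1] by blast
qed

text \<open>The derivation in \<open>zeta_trunc_phi\<close> cancels at each \<open>N\<close>.
  Individual values of \<open>phi\<close> need not lie in \<open>Hge2\<close>, so injectivity of the
  truncated sums is applied on \<open>H1\<close>.\<close>

lemma R_op_eq:
  assumes "u \<in> Hge2" "v \<in> Hge2"
  shows "R_op u v = partial_explicit u \<star> v + u \<star> partial_explicit v - partial_explicit (u \<star> v)"
proof (rule zeta_trunc_inj)
  have uv: "u \<star> v \<in> Hge2" using assms by (rule harmonic_Hge2)
  show "R_op u v \<in> H1"
    unfolding R_op_def using assms uv by (intro qs.subspace_diff[OF subspace_H1] harmonic_H1 phi_H1 Hge2_H1)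
  show "partial_explicit u \<star> v + u \<star> partial_explicit v - partial_explicit (u \<star> v) \<in> H1"
    using assms uv
    by (intro Hge2_H1 qs.subspace_diff[OF subspace_Hge2] qs.subspace_add[OF subspace_Hge2] harmonic_Hge2 partial_explicit_Hge2)
  fix N :: nat assume N: "N \<ge> 1"
  show "zeta_trunc N (R_op u v) = zeta_trunc N (partial_explicit u \<star> v + u \<star> partial_explicit v - partial_explicit (u \<star> v))"
    unfolding R_op_def
    by (simp add: zeta_trunc_phi[OF _ N] assms uv gap_derivation_harmonic algebra_simps)
qed

section \<open>Commutation relations\<close>

lemma derivation_on_words:
  assumes d: "qlin d" and p: "p \<in> supp_in A" and q: "q \<in> supp_in A"
    and eq: "\<And>u v. u \<in> A \<Longrightarrow> v \<in> A \<Longrightarrow> d (harmonic_word u v) = d (word u) \<star> word v + word u \<star> d (word v)"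
  shows "d (p \<star> q) = d p \<star> q + p \<star> d q"
proof -
  note dl = module_hom.add[OF d] module_hom.scale[OF d]
  have w: "d (word u \<star> q) = d (word u) \<star> q + word u \<star> d q" if "u \<in> A" for u
    by (rule linear_eq_on_words[where s=qscale and f="\<lambda>q. d (word u \<star> q)"
          and g="\<lambda>q. d (word u) \<star> q + word u \<star> d q", OF _ _ q])
      (auto intro!: qlinI simp: dl eq that qs.scale_right_distrib algebra_simps)
  show ?thesis
    by (rule linear_eq_on_words[where s=qscale and f="\<lambda>p. d (p \<star> q)"
          and g="\<lambda>p. d p \<star> q + p \<star> d q", OF _ _ p])
      (use w in \<open>auto intro!: qlinI simp: dl qs.scale_right_distrib algebra_simps\<close>)
qed

section \<open>The weight operator\<close>

lemma W_op_linear: "qlin W_op"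
  unfolding W_op_def by (rule lin_ext_linear)

lemmas W_op_simps [simp] =
  module_hom.add[OF W_op_linear] module_hom.scale[OF W_op_linear]
  module_hom.zero[OF W_op_linear] module_hom.diff[OF W_op_linear] module_hom.neg[OF W_op_linear]

lemma W_op_word [simp]: "W_op (word w) = qscale (of_nat (sum_list w)) (word w)"
  by (simp add: W_op_def)

lemma W_op_homogeneous:
  assumes "p \<in> supp_in {w. sum_list w = n}"
  shows "W_op p = qscale (of_nat n) p"
  by (rule linear_eq_on_words[OF W_op_linear _ assms, where g="qscale (of_nat n)"])
    (auto intro!: qlinI simp: qs.scale_right_distrib mult.commute)

lemma W_op_Hge2:
  assumes "p \<in> Hge2"
  shows "W_op p \<in> Hge2"
  using assms unfolding Hge2_eq W_op_def
  by (rule lin_ext_in_supp_in) (auto intro!: supp_in_qscale)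

lemma W_op_harmonic: "W_op (p \<star> q) = W_op p \<star> q + p \<star> W_op q"
proof (rule derivation_on_words[OF W_op_linear, where A=UNIV])
  fix u v
  show "W_op (harmonic_word u v) = W_op (word u) \<star> word v + word u \<star> W_op (word v)"
    by (simp add: W_op_homogeneous[OF harmonic_word_homogeneous] qs.scale_left_distrib)
qed (simp_all add: supp_in_def)

lemma W_op_partial:
  assumes "p \<in> Hge2"
  shows "W_op (partial_explicit p) = partial_explicit (W_op p) + qscale 2 (partial_explicit p)"
proof (rule linear_eq_on_words[where s=qscale and f="\<lambda>p. W_op (partial_explicit p)"
      and g="\<lambda>p. partial_explicit (W_op p) + qscale 2 (partial_explicit p)", OF _ _ assms[unfolded Hge2_eq]])
  fix w :: "nat list" assume w: "w \<in> lists {2..}"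
  have "partial_word w \<in> supp_in {v. sum_list v = sum_list w + 2}"
    using partial_word_support[OF w] by (rule supp_in_mono) (auto simp: weight_words_def)
  moreover have "harmonic_word w [2] \<in> supp_in {v. sum_list v = sum_list w + 2}"
    using harmonic_word_homogeneous[of w "[2]"] by simp
  ultimately have "partial_explicit (word w) \<in> supp_in {v. sum_list v = sum_list w + 2}"
    unfolding partial_explicit_def by (simp add: supp_in_diff)
  from W_op_homogeneous[OF this]
  show "W_op (partial_explicit (word w)) = partial_explicit (W_op (word w)) + qscale 2 (partial_explicit (word w))"
    by (simp add: qs.scale_left_distrib)
qed (auto intro!: qlinI simp: qs.scale_right_distrib mult.commute)

section \<open>Removal of a leading \<open>z_2\<close>\<close>

lemma strip2_Hge2:
  assumes "p \<in> Hge2"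
  shows "strip2 p \<in> Hge2"
  using assms unfolding Hge2_eq strip2_def
proof (rule lin_ext_in_supp_in)
  fix w :: "nat list" assume "w \<in> lists {2..}"
  then show "(case w of [] \<Rightarrow> 0 | a # u \<Rightarrow> if a = 2 then word u else 0) \<in> supp_in (lists {2..})"
    by (cases w) auto
qed

lemma harmonic_word_Nil2 [simp]: "harmonic_word u [] = word u"
  by (cases u) simp_all

text \<open>Merging two letters that are at least 2 gives a letter of size at least 4, so the third
  term of the harmonic recursion never contributes.\<close>

lemma strip2_harmonic:
  assumes "p \<in> Hge2" "q \<in> Hge2"
  shows "strip2 (p \<star> q) = strip2 p \<star> q + p \<star> strip2 q"
proof (rule derivation_on_words[OF strip2_linear assms[unfolded Hge2_eq]])
  fix u v :: "nat list" assume "u \<in> lists {2..}" "v \<in> lists {2..}"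
  then show "strip2 (harmonic_word u v) = strip2 (word u) \<star> word v + word u \<star> strip2 (word v)"
    by (cases u; cases v) auto
qed

text \<open>The two \<open>pole_strip\<close> terms in \<open>strip2_gap_elem\<close> telescope over
  consecutive factorisations. At the far end \<open>pole_strip\<close> is zero for empty second
  argument, so only the boundary at the fixed prefix \<open>A\<close> survives.\<close>

lemma strip2_split_sum_gap_elem:
  assumes "w \<in> lists {2..}" "A \<in> lists {2..}" "A \<noteq> []"
  shows "strip2 (split_sum w (\<lambda>P. gap_elem (A @ P))) = - pole_strip (butlast A) (last A # w)
    + (if hd A = 2 then split_sum w (\<lambda>P. gap_elem (tl A @ P)) else 0)"
  using assms
proof (induction w arbitrary: A rule: list.induct)
  case Nil
  obtain k P where "A = k # P" using Nil by (cases A) auto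
  then show ?case using Nil strip2_gap_elem[of k P "[]"] by (simp add: pole_strip_def del: gap_elem.simps)
next
  case (Cons k w)
  obtain a A' where A: "A = a # A'" using Cons.prems by (cases A) auto
  have "strip2 (split_sum w (\<lambda>P. gap_elem ((A @ [k]) @ P))) = - pole_strip (butlast (A @ [k])) (last (A @ [k]) # w)
      + (if hd (A @ [k]) = 2 then split_sum w (\<lambda>P. gap_elem (tl (A @ [k]) @ P)) else 0)"
    by (rule Cons.IH) (use Cons.prems in auto)
  then have "strip2 (split_sum w (\<lambda>P. gap_elem (A @ k # P))) = - pole_strip A (k # w)
      + (if a = 2 then split_sum w (\<lambda>P. gap_elem (A' @ k # P)) else 0)"
    by (simp add: A del: gap_elem.simps)
  moreover have "strip2 (gap_elem A (k # w)) = pole_strip A (k # w) - pole_strip (butlast A) (last A # k # w)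
      + (if a = 2 then gap_elem A' (k # w) else 0)"
    using strip2_gap_elem[of a A' "k # w"] Cons.prems A by simp
  ultimately show ?case by (simp add: A del: gap_elem.simps last.simps butlast.simps)
qed

text \<open>The boundary term for a raised letter \<open>Suc k\<close> is
  \<open>pole_strip A (Suc k # w)\<close>, which lowers it back to \<open>k\<close>. It thus
  restores the original word with coefficient \<open>k\<close>, and summing over the letters yields
  the weight. The prefix \<open>A\<close> carries the letters already passed.\<close>

lemma strip2_raise_sum_gap_elem:
  assumes "w \<in> lists {2..}" "A \<in> lists {2..}"
  shows "strip2 (raise_sum w qscale (\<lambda>P. gap_elem (A @ P))) = - qscale (of_nat (sum_list w)) (word (A @ w))
    + (if A = [] then (if take 1 w = [2] then raise_sum (tl w) qscale gap_elem else 0)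
       else if hd A = 2 then raise_sum w qscale (\<lambda>P. gap_elem (tl A @ P)) else 0)"
  using assms
proof (induction w arbitrary: A rule: list.induct)
  case (Cons k w)
  then have k: "k \<ge> 2" and w: "w \<in> lists {2..}" by auto
  have "strip2 (split_sum w (\<lambda>P. gap_elem ((A @ [Suc k]) @ P)))
      = - pole_strip (butlast (A @ [Suc k])) (last (A @ [Suc k]) # w)
      + (if hd (A @ [Suc k]) = 2 then split_sum w (\<lambda>P. gap_elem (tl (A @ [Suc k]) @ P)) else 0)"
    by (rule strip2_split_sum_gap_elem[OF w]) (use Cons.prems k in auto)
  then have s: "strip2 (split_sum w (\<lambda>P. gap_elem (A @ Suc k # P))) = - word (A @ k # w)
      + (if A \<noteq> [] \<and> hd A = 2 then split_sum w (\<lambda>P. gap_elem (tl A @ Suc k # P)) else 0)"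
    using k by (cases A) (simp_all add: pole_strip_def)
  have "strip2 (raise_sum w qscale (\<lambda>P. gap_elem ((A @ [k]) @ P))) = - qscale (of_nat (sum_list w)) (word ((A @ [k]) @ w))
      + (if A @ [k] = [] then (if take 1 w = [2] then raise_sum (tl w) qscale gap_elem else 0)
         else if hd (A @ [k]) = 2 then raise_sum w qscale (\<lambda>P. gap_elem (tl (A @ [k]) @ P)) else 0)"
    by (rule Cons.IH) (use Cons.prems in auto)
  then have r: "strip2 (raise_sum w qscale (\<lambda>P. gap_elem (A @ k # P))) = - qscale (of_nat (sum_list w)) (word (A @ k # w))
      + (if A = [] then (if k = 2 then raise_sum w qscale gap_elem else 0)
         else if hd A = 2 then raise_sum w qscale (\<lambda>P. gap_elem (tl A @ k # P)) else 0)"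
    by (cases A) simp_all
  show ?case
    unfolding raise_sum.simps strip2_simps s r
    by (cases A) (simp_all add: qs.scale_left_distrib qs.scale_right_distrib algebra_simps)
qed simp

lemma strip2_raise_gap:
  assumes "w \<in> lists {2..}"
  shows "strip2 (raise_gap w) = (if take 1 w = [2] then raise_gap (tl w) else 0)
    - qscale (of_nat (sum_list w)) (word w)"
  using strip2_raise_sum_gap_elem[OF assms, of "[]"] by (simp add: raise_gap_def)

lemma harmonic_unit_right [simp]: "p \<star> word [] = p"
  by (rule linear_eq_on_words[where s=qscale and A=UNIV and f="\<lambda>p. p \<star> word []" and g="\<lambda>p. p"])
    (auto intro!: qlinI simp: supp_in_def)

lemma harmonic_unit_left [simp]: "word [] \<star> p = p"
  by (rule linear_eq_on_words[where s=qscale and A=UNIV and f="\<lambda>p. word [] \<star> p" and g="\<lambda>p. p"])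
    (auto intro!: qlinI simp: supp_in_def)

text \<open>The extra copy of \<open>w\<close> from \<open>shuffle_2_part\<close> cancels the one
  from \<open>w \<star> z_2\<close>, so that only the weight term of \<open>raise_gap\<close>
  remains.\<close>

lemma strip2_partial:
  assumes "p \<in> Hge2"
  shows "strip2 (partial_explicit p) = partial_explicit (strip2 p) - qscale 2 (W_op p)"
proof (rule linear_eq_on_words[where s=qscale and f="\<lambda>p. strip2 (partial_explicit p)"
      and g="\<lambda>p. partial_explicit (strip2 p) - qscale 2 (W_op p)", OF _ _ assms[unfolded Hge2_eq]])
  fix w :: "nat list" assume w: "w \<in> lists {2..}"
  have h: "strip2 (word w \<star> word [2]) = strip2 (word w) \<star> word [2] + word w"
    by (subst strip2_harmonic) (use w in \<open>simp_all add: Hge2_eq del: harmonic_words\<close>)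
  have "strip2 (partial_word w) = lin_ext partial_word (strip2 (word w)) + word w - qscale 2 (W_op (word w))"
  proof (cases w)
    case Nil
    then show ?thesis by (simp add: partial_word_def raise_gap_def)
  next
    case (Cons k v)
    then show ?thesis
      using strip2_shuffle_2_part[OF w] strip2_raise_gap[OF w]
      by (simp add: partial_word_def qs.scale_right_distrib qs.scale_right_diff_distrib del: shuffle_2_part.simps)
  qed
  then show "strip2 (partial_explicit (word w)) = partial_explicit (strip2 (word w)) - qscale 2 (W_op (word w))"
    unfolding partial_explicit_def strip2_simps lin_ext_word h by simp
qed (auto intro!: qlinI simp: qs.scale_right_distrib qs.scale_right_diff_distrib algebra_simps)

section \<open>The operator \<open>delta_op\<close> on \<open>Hge2\<close>\<close>

lemma delta_op_linear: "qlin delta_op"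
  unfolding delta_op_def by (rule lin_ext_linear)

lemma xy_word_no_LY_LY:
  assumes "w \<in> lists {2..}"
  shows "successively (\<lambda>a b. \<not> (a = LY \<and> b = LY)) (xy_word w)"
  using assms
proof (induction w rule: list.induct)
  case (Cons k w)
  have "successively (\<lambda>a b. \<not> (a = LY \<and> b = LY)) (replicate c LX)" for c
    by (induction c) (auto simp: successively_Cons)
  moreover have "successively (\<lambda>a b. \<not> (a = LY \<and> b = LY)) (LY # xy_word w)"
    using Cons xy_word_starts_LX[of w] by (cases "xy_word w") (auto simp: successively_Cons)
  ultimately show ?case
    by (auto simp: successively_append_iff)
qed simp

lemma replace_triple_eq_0:
  assumes "w \<in> lists {2..}"
  shows "replace_triple [LY, LY, LX] (xy_word w) = 0" "replace_triple [LX, LY, LY] (xy_word w) = 0"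
proof -
  have no: "\<not> (xy_word w ! i = LY \<and> xy_word w ! Suc i = LY)" if "Suc i < length (xy_word w)" for i
    using xy_word_no_LY_LY[OF assms] that unfolding successively_conv_nth by blast
  have nth: "xy_word w ! (i + j) = t ! j" if "i + 3 \<le> length (xy_word w)" "take 3 (drop i (xy_word w)) = t" "j < 3" for i j t
    using that by (metis add_leD1 nth_drop nth_take)
  have "{i. i + 3 \<le> length (xy_word w) \<and> take 3 (drop i (xy_word w)) = [LY, LY, LX]} = {}"
  proof (clarsimp)
    fix i assume i: "i + 3 \<le> length (xy_word w)" "take 3 (drop i (xy_word w)) = [LY, LY, LX]"
    show False using nth[OF i, of 0] nth[OF i, of 1] no[of i] i(1) by simp
  qed
  then show "replace_triple [LY, LY, LX] (xy_word w) = 0" by (simp only: replace_triple_def sum.empty)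
  have "{i. i + 3 \<le> length (xy_word w) \<and> take 3 (drop i (xy_word w)) = [LX, LY, LY]} = {}"
  proof (clarsimp)
    fix i assume i: "i + 3 \<le> length (xy_word w)" "take 3 (drop i (xy_word w)) = [LX, LY, LY]"
    show False using nth[OF i, of 1] nth[OF i, of 2] no[of "Suc i"] i(1) by (simp add: numeral_2_eq_2)
  qed
  then show "replace_triple [LX, LY, LY] (xy_word w) = 0" by (simp only: replace_triple_def sum.empty)
qed

text \<open>Words of \<open>Hge2\<close> contain no adjacent \<open>LY\<close> and never begin with
  \<open>LY\<close>, so only the prefix \<open>[LX, LY]\<close>, that is a leading
  \<open>z_2\<close>, contributes.\<close>

lemma delta_op_eq:
  assumes "p \<in> Hge2"
  shows "delta_op p = qscale (- 1 / 2) (strip2 p)"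
proof (rule linear_eq_on_words[where s=qscale and f=delta_op and g="\<lambda>p. qscale (- 1 / 2) (strip2 p)",
      OF delta_op_linear _ assms[unfolded Hge2_eq]])
  fix w :: "nat list" assume w: "w \<in> lists {2..}"
  show "delta_op (word w) = qscale (- 1 / 2) (strip2 (word w))"
  proof (cases w)
    case Nil
    then show ?thesis using replace_triple_eq_0[OF w] by (simp add: delta_op_def delta_xy_def)
  next
    case (Cons k v)
    then have v: "v \<in> lists {1..}" "k \<ge> 2" using w lists2_lists1 by auto
    consider "k = 2" | c where "k = Suc (Suc (Suc c))"
      using v(2) by (metis Suc_1 Suc_le_D Suc_le_mono le_antisym not_less_eq_eq One_nat_def)
    then show ?thesis
    proof cases
      case 1
      then show ?thesis using replace_triple_eq_0[OF w] v Cons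
        by (simp add: delta_op_def delta_xy_def numeral_2_eq_2)
    next
      case 2
      then show ?thesis using replace_triple_eq_0[OF w] v Cons
        by (simp add: delta_op_def delta_xy_def numeral_2_eq_2)
    qed
  qed
qed (auto intro!: qlinI simp: qs.scale_right_distrib mult.commute)

lemma delta_op_Hge2: "p \<in> Hge2 \<Longrightarrow> delta_op p \<in> Hge2"
  by (simp only: delta_op_eq qs.subspace_scale[OF subspace_Hge2] strip2_Hge2)

lemma delta_op_harmonic:
  assumes "p \<in> Hge2" "q \<in> Hge2"
  shows "delta_op (p \<star> q) = delta_op p \<star> q + p \<star> delta_op q"
  using assms by (simp add: delta_op_eq harmonic_Hge2 strip2_harmonic qs.scale_right_distrib)

lemma delta_op_partial:
  assumes "p \<in> Hge2"
  shows "delta_op (partial_explicit p) = partial_explicit (delta_op p) + W_op p"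
  using assms
  by (simp add: delta_op_eq partial_explicit_Hge2 strip2_partial qs.scale_right_diff_distrib)

lemma strip2_W_op: "W_op (strip2 p) = strip2 (W_op p) - qscale 2 (strip2 p)"
proof (rule linear_eq_on_words[where s=qscale and A=UNIV and f="\<lambda>p. W_op (strip2 p)"
      and g="\<lambda>p. strip2 (W_op p) - qscale 2 (strip2 p)"])
  fix w :: "nat list"
  show "W_op (strip2 (word w)) = strip2 (W_op (word w)) - qscale 2 (strip2 (word w))"
    by (cases w) (auto simp: qs.scale_left_distrib)
qed (auto intro!: qlinI simp: supp_in_def qs.scale_right_distrib algebra_simps qs.scale_right_diff_distrib)

lemma W_op_delta:
  assumes "p \<in> Hge2"
  shows "W_op (delta_op p) = delta_op (W_op p) - qscale 2 (delta_op p)"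
  using assms by (simp add: delta_op_eq W_op_Hge2 strip2_W_op qs.scale_right_diff_distrib)

section \<open>The ideal and the quotient\<close>

text \<open>Inherited from the product of rational numbers through injectivity of the truncated
  sums; associativity follows the same way.\<close>

lemma harmonic_comm:
  assumes "p \<in> Hge2" "q \<in> Hge2"
  shows "p \<star> q = q \<star> p"
  by (rule zeta_trunc_inj) (use assms in \<open>auto intro!: Hge2_H1 simp: mult.commute\<close>)

lemma harmonic_assoc:
  assumes "p \<in> Hge2" "q \<in> Hge2" "r \<in> Hge2"
  shows "(p \<star> q) \<star> r = p \<star> (q \<star> r)"
  by (rule zeta_trunc_inj) (use assms in \<open>auto intro!: Hge2_H1 simp: mult.assoc\<close>)

lemmas Hge2_closed = qs.subspace_0[OF subspace_Hge2] qs.subspace_add[OF subspace_Hge2]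
  qs.subspace_diff[OF subspace_Hge2] qs.subspace_neg[OF subspace_Hge2] qs.subspace_scale[OF subspace_Hge2]
  harmonic_Hge2 partial_explicit_Hge2 W_op_Hge2 delta_op_Hge2

lemma word_Nil_Hge2: "word [] \<in> Hge2"
  by (simp add: Hge2_eq)

lemma R_op_Hge2: "u \<in> Hge2 \<Longrightarrow> v \<in> Hge2 \<Longrightarrow> R_op u v \<in> Hge2"
  by (simp add: R_op_eq Hge2_closed)

lemma partial_op_Hge2: "p \<in> Hge2 \<Longrightarrow> partial_op p \<in> Hge2"
  by (simp add: partial_op_eq partial_explicit_Hge2)

lemma partial_op_pow_Hge2: "p \<in> Hge2 \<Longrightarrow> (partial_op ^^ n) p \<in> Hge2"
  by (induction n) (simp_all add: partial_op_Hge2)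

text \<open>The ideal generators before multiplication by \<open>w\<close>. Stability under the
  operators can be checked on the span of this smaller set.\<close>

definition DR_core :: "zpoly set" where
  "DR_core = {(partial_op ^^ n) (R_op u v) | n u v. u \<in> Hge2 \<and> v \<in> Hge2}"

lemma DR_eq: "DR = qs.span {t \<star> w | t w. t \<in> DR_core \<and> w \<in> Hge2}"
  unfolding DR_def DR_core_def by (rule arg_cong[where f=qs.span]) blast

lemma subspace_DR: "qs.subspace DR"
  unfolding DR_eq by (rule qs.subspace_span)

lemma DR_core_Hge2: "t \<in> DR_core \<Longrightarrow> t \<in> Hge2"
  by (auto simp: DR_core_def partial_op_pow_Hge2 R_op_Hge2)

lemma DR_Hge2: "t \<in> DR \<Longrightarrow> t \<in> Hge2"
proof -
  have "{t \<star> w | t w. t \<in> DR_core \<and> w \<in> Hge2} \<subseteq> Hge2"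
    by (auto simp: DR_core_Hge2 harmonic_Hge2)
  then show "t \<in> DR \<Longrightarrow> t \<in> Hge2"
    unfolding DR_eq using qs.span_minimal[OF _ subspace_Hge2] by blast
qed

lemma R_op_in_DR_core: "u \<in> Hge2 \<Longrightarrow> v \<in> Hge2 \<Longrightarrow> R_op u v \<in> DR_core"
  unfolding DR_core_def by (intro CollectI exI[of _ 0] exI[of _ u] exI[of _ v]) simp

lemma partial_DR_core: "t \<in> DR_core \<Longrightarrow> partial_explicit t \<in> DR_core"
proof -
  assume t: "t \<in> DR_core"
  then obtain n u v where "t = (partial_op ^^ n) (R_op u v)" "u \<in> Hge2" "v \<in> Hge2"
    by (auto simp: DR_core_def)
  moreover have "partial_explicit t = partial_op t" using partial_op_eq[OF DR_core_Hge2[OF t]] by simp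
  ultimately show ?thesis
    unfolding DR_core_def by (intro CollectI exI[of _ "Suc n"] exI[of _ u] exI[of _ v]) simp
qed

lemma span_image_subset:
  assumes f: "qlin f" and V: "qs.subspace V" and "\<And>x. x \<in> B \<Longrightarrow> f x \<in> V" and p: "p \<in> qs.span B"
  shows "f p \<in> V"
proof -
  have "qs.subspace {x. f x \<in> V}"
    by (rule qs.subspaceI)
      (auto simp: module_hom.zero[OF f] module_hom.add[OF f] module_hom.scale[OF f]
        qs.subspace_0[OF V] qs.subspace_add[OF V] qs.subspace_scale[OF V])
  then show ?thesis using qs.span_minimal[of B "{x. f x \<in> V}"] assms by blast
qed

lemma partial_span_DR_core: "t \<in> qs.span DR_core \<Longrightarrow> partial_explicit t \<in> qs.span DR_core"
  by (rule span_image_subset[OF partial_explicit_linear qs.subspace_span])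
    (auto intro: qs.span_base partial_DR_core)

lemma span_DR_core_mult: "t \<in> qs.span DR_core \<Longrightarrow> w \<in> Hge2 \<Longrightarrow> t \<star> w \<in> DR"
  by (rule span_image_subset[OF harmonic_linear_left subspace_DR, of DR_core])
    (auto simp: DR_eq intro!: qs.span_base)

lemma DR_mult:
  assumes "t \<in> DR" "x \<in> Hge2"
  shows "t \<star> x \<in> DR"
proof (rule span_image_subset[OF harmonic_linear_left subspace_DR _ assms(1)[unfolded DR_eq]])
  fix y assume "y \<in> {t \<star> w | t w. t \<in> DR_core \<and> w \<in> Hge2}"
  then obtain t w where "y = t \<star> w" "t \<in> DR_core" "w \<in> Hge2" by blast
  then show "y \<star> x \<in> DR"
    using assms(2) by (simp add: harmonic_assoc DR_core_Hge2 span_DR_core_mult qs.span_base harmonic_Hge2)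
qed

text \<open>A defect in the span of \<open>DR_core\<close> is allowed in the product rule, so that
  \<open>partial_explicit\<close>, whose defect is \<open>- R_op\<close>, is covered together with
  the two genuine derivations.\<close>

lemma derivation_DR:
  assumes d: "qlin d" and dH: "\<And>p. p \<in> Hge2 \<Longrightarrow> d p \<in> Hge2"
    and core: "\<And>t. t \<in> DR_core \<Longrightarrow> d t \<in> qs.span DR_core"
    and der: "\<And>p q. p \<in> Hge2 \<Longrightarrow> q \<in> Hge2 \<Longrightarrow> d (p \<star> q) - (d p \<star> q + p \<star> d q) \<in> qs.span DR_core"
    and p: "p \<in> DR"
  shows "d p \<in> DR"
proof (rule span_image_subset[OF d subspace_DR _ p[unfolded DR_eq]])
  fix y assume "y \<in> {t \<star> w | t w. t \<in> DR_core \<and> w \<in> Hge2}"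
  then obtain t w where y: "y = t \<star> w" and t: "t \<in> DR_core" and w: "w \<in> Hge2" by blast
  have "(d y - (d t \<star> w + t \<star> d w)) \<star> word [] \<in> DR"
    unfolding y using der[OF DR_core_Hge2[OF t] w] word_Nil_Hge2 by (rule span_DR_core_mult)
  moreover have "d t \<star> w + t \<star> d w \<in> DR"
    using span_DR_core_mult[OF core[OF t] w] span_DR_core_mult[OF qs.span_base[OF t] dH[OF w]]
    by (rule qs.subspace_add[OF subspace_DR])
  ultimately have "(d y - (d t \<star> w + t \<star> d w)) + (d t \<star> w + t \<star> d w) \<in> DR"
    unfolding harmonic_unit_right by (rule qs.subspace_add[OF subspace_DR])
  then show "d y \<in> DR" by simp
qed

lemma partial_harmonic:
  assumes "p \<in> Hge2" "q \<in> Hge2"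
  shows "partial_explicit (p \<star> q) = partial_explicit p \<star> q + p \<star> partial_explicit q - R_op p q"
  using R_op_eq[OF assms] by simp

lemma partial_DR: "p \<in> DR \<Longrightarrow> partial_explicit p \<in> DR"
proof (rule derivation_DR[OF partial_explicit_linear partial_explicit_Hge2])
  fix p q assume "p \<in> Hge2" "q \<in> Hge2"
  then show "partial_explicit (p \<star> q) - (partial_explicit p \<star> q + p \<star> partial_explicit q) \<in> qs.span DR_core"
    using qs.span_neg[OF qs.span_base[OF R_op_in_DR_core]] by (simp add: partial_harmonic)
qed (auto intro: qs.span_base partial_DR_core)

lemma W_op_R_op:
  assumes "u \<in> Hge2" "v \<in> Hge2"
  shows "W_op (R_op u v) = R_op (W_op u) v + R_op u (W_op v) + qscale 2 (R_op u v)"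
  using assms
  by (simp add: R_op_eq Hge2_closed W_op_harmonic W_op_partial qs.scale_right_distrib qs.scale_right_diff_distrib
      algebra_simps)

text \<open>Each exchange of \<open>delta_op\<close> with \<open>partial_explicit\<close> adds a
  \<open>W_op\<close>; these terms cancel because \<open>W_op\<close> is a derivation.\<close>

lemma delta_op_R_op:
  assumes "u \<in> Hge2" "v \<in> Hge2"
  shows "delta_op (R_op u v) = R_op (delta_op u) v + R_op u (delta_op v)"
  using assms
  by (simp add: R_op_eq Hge2_closed delta_op_harmonic delta_op_partial W_op_harmonic
      module_hom.add[OF delta_op_linear] module_hom.diff[OF delta_op_linear] algebra_simps)

lemma W_op_DR_core: "t \<in> DR_core \<Longrightarrow> W_op t \<in> qs.span DR_core"
proof -
  have "W_op ((partial_op ^^ n) (R_op u v)) \<in> qs.span DR_core" if uv: "u \<in> Hge2" "v \<in> Hge2" for n u v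
  proof (induction n)
    case 0
    then show ?case
      using uv by (simp add: W_op_R_op qs.span_add qs.span_scale qs.span_base R_op_in_DR_core W_op_Hge2)
  next
    case (Suc n)
    let ?x = "(partial_op ^^ n) (R_op u v)"
    have x: "?x \<in> DR_core" using uv by (auto simp: DR_core_def)
    have "W_op (partial_explicit ?x) = partial_explicit (W_op ?x) + qscale 2 (partial_explicit ?x)"
      by (rule W_op_partial[OF DR_core_Hge2[OF x]])
    then show ?case
      using Suc x by (simp add: partial_op_eq DR_core_Hge2 qs.span_add qs.span_scale qs.span_base
          partial_span_DR_core partial_DR_core)
  qed
  then show "t \<in> DR_core \<Longrightarrow> W_op t \<in> qs.span DR_core" by (auto simp: DR_core_def)
qed

text \<open>Moving \<open>delta_op\<close> past one more application of \<open>partial_op\<close>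
  leaves a \<open>W_op\<close> term, so stability under \<open>W_op\<close> has to be known
  beforehand.\<close>

lemma delta_op_DR_core: "t \<in> DR_core \<Longrightarrow> delta_op t \<in> qs.span DR_core"
proof -
  have "delta_op ((partial_op ^^ n) (R_op u v)) \<in> qs.span DR_core" if uv: "u \<in> Hge2" "v \<in> Hge2" for n u v
  proof (induction n)
    case 0
    then show ?case
      using uv by (simp add: delta_op_R_op qs.span_add qs.span_base R_op_in_DR_core delta_op_Hge2)
  next
    case (Suc n)
    let ?x = "(partial_op ^^ n) (R_op u v)"
    have x: "?x \<in> DR_core" using uv by (auto simp: DR_core_def)
    have "delta_op (partial_explicit ?x) = partial_explicit (delta_op ?x) + W_op ?x"
      by (rule delta_op_partial[OF DR_core_Hge2[OF x]])
    then show ?case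
      using Suc x by (simp add: partial_op_eq DR_core_Hge2 qs.span_add W_op_DR_core partial_span_DR_core)
  qed
  then show "t \<in> DR_core \<Longrightarrow> delta_op t \<in> qs.span DR_core" by (auto simp: DR_core_def)
qed

lemma W_op_DR: "p \<in> DR \<Longrightarrow> W_op p \<in> DR"
  by (rule derivation_DR[OF W_op_linear W_op_Hge2])
    (auto simp: W_op_DR_core W_op_harmonic intro: qs.span_zero)

lemma delta_op_DR: "p \<in> DR \<Longrightarrow> delta_op p \<in> DR"
  by (rule derivation_DR[OF delta_op_linear delta_op_Hge2])
    (auto simp: delta_op_DR_core delta_op_harmonic intro: qs.span_zero)

section \<open>The algebra on \<open>Hge2\<close> and its quotient by \<open>DR\<close>\<close>

lemma Hge2_alg_simps [simp]:
  "carrier Hge2_alg = Hge2" "monoid.mult Hge2_alg = (\<star>)" "one Hge2_alg = word []" "zero Hge2_alg = 0"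
  "add Hge2_alg = (+)" "module.smult Hge2_alg = qscale"
  by (simp_all add: Hge2_alg_def)

lemma cring_Hge2_alg: "cring Hge2_alg"
proof (rule cringI)
  show "abelian_group Hge2_alg"
    by (rule abelian_groupI) (auto simp: Hge2_closed algebra_simps intro!: bexI[where x="- x" for x])
  show "comm_monoid Hge2_alg"
    by (rule comm_monoidI) (auto simp: Hge2_closed word_Nil_Hge2 harmonic_assoc intro: harmonic_comm)
qed simp

lemma minus_Hge2_alg:
  assumes "a \<in> Hge2" "b \<in> Hge2"
  shows "a \<ominus>\<^bsub>Hge2_alg\<^esub> b = a - b"
proof -
  interpret cring Hge2_alg by (rule cring_Hge2_alg)
  have "\<ominus>\<^bsub>Hge2_alg\<^esub> b = - b"
    using minus_equality[of "- b" b] assms by (simp add: Hge2_closed)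
  then show ?thesis by (simp add: a_minus_def)
qed

lemma ideal_DR: "ideal DR Hge2_alg"
proof -
  interpret cring Hge2_alg by (rule cring_Hge2_alg)
  have inv: "\<ominus>\<^bsub>Hge2_alg\<^esub> b = - b" if "b \<in> Hge2" for b
    using minus_equality[of "- b" b] that by (simp add: Hge2_closed)
  show ?thesis
  proof (rule idealI)
    show "ring Hge2_alg" by (rule ring_axioms)
    show "subgroup DR (add_monoid Hge2_alg)"
    proof (rule add.subgroupI)
      show "DR \<subseteq> carrier Hge2_alg" by (auto simp: DR_Hge2)
      show "DR \<noteq> {}" using qs.subspace_0[OF subspace_DR] by blast
    qed (auto simp: inv DR_Hge2 qs.subspace_neg[OF subspace_DR] qs.subspace_add[OF subspace_DR])
  qed (auto simp: DR_mult harmonic_comm[OF _ DR_Hge2])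
qed

abbreviation DR_class :: "zpoly \<Rightarrow> zpoly set" where
  "DR_class a \<equiv> DR +>\<^bsub>Hge2_alg\<^esub> a"

lemma DR_class_eq_iff:
  assumes "a \<in> Hge2" "b \<in> Hge2"
  shows "DR_class a = DR_class b \<longleftrightarrow> a - b \<in> DR"
proof -
  interpret cring Hge2_alg by (rule cring_Hge2_alg)
  show ?thesis
    using quotient_eq_iff_same_a_r_cos[OF ideal_DR, of a b] assms by (simp add: minus_Hge2_alg)
qed

lemma in_DR_class:
  assumes "a \<in> Hge2" "x \<in> DR_class a"
  shows "x \<in> Hge2" "x - a \<in> DR"
proof -
  obtain h where "h \<in> DR" "x = h + a" using assms(2) by (auto simp: a_r_coset_def')
  then show "x \<in> Hge2" "x - a \<in> DR" using assms(1) by (simp_all add: DR_Hge2 Hge2_closed)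
qed

lemma DR_class_self:
  assumes "a \<in> Hge2"
  shows "a \<in> DR_class a"
  using qs.subspace_0[OF subspace_DR] by (force simp: a_r_coset_def')

text \<open>Scalar multiplication and induced maps on the quotient are defined as unions over
  representatives; compatibility with \<open>DR\<close> makes all the united cosets equal.\<close>

lemma UN_DR_class:
  assumes a: "a \<in> Hge2" and f: "\<And>x. x \<in> Hge2 \<Longrightarrow> f x \<in> Hge2"
    and d: "\<And>x. x \<in> Hge2 \<Longrightarrow> x - a \<in> DR \<Longrightarrow> f x - f a \<in> DR"
  shows "(\<Union>x\<in>DR_class a. DR_class (f x)) = DR_class (f a)"
proof -
  have "DR_class (f x) = DR_class (f a)" if "x \<in> DR_class a" for x
    using in_DR_class[OF a that] by (simp add: DR_class_eq_iff f a d)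
  then show ?thesis using DR_class_self[OF a] by blast
qed

lemma Ef_alg_simps:
  shows "carrier Ef_alg = DR_class ` Hge2"
    and "zero Ef_alg = DR_class 0" "one Ef_alg = DR_class (word [])"
    and "a \<in> Hge2 \<Longrightarrow> b \<in> Hge2 \<Longrightarrow> DR_class a \<otimes>\<^bsub>Ef_alg\<^esub> DR_class b = DR_class (a \<star> b)"
    and "a \<in> Hge2 \<Longrightarrow> b \<in> Hge2 \<Longrightarrow> DR_class a \<oplus>\<^bsub>Ef_alg\<^esub> DR_class b = DR_class (a + b)"
    and "a \<in> Hge2 \<Longrightarrow> c \<odot>\<^bsub>Ef_alg\<^esub> DR_class a = DR_class (qscale c a)"
proof -
  interpret ideal DR Hge2_alg by (rule ideal_DR)
  show "carrier Ef_alg = DR_class ` Hge2"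
    by (auto simp: Ef_alg_def quot_algebra_def FactRing_def A_RCOSETS_def')
  show "zero Ef_alg = DR_class 0"
    using a_coset_add_zero[OF a_subset] by (simp add: Ef_alg_def quot_algebra_def FactRing_def)
  show "one Ef_alg = DR_class (word [])"
    by (simp add: Ef_alg_def quot_algebra_def FactRing_def)
  show "a \<in> Hge2 \<Longrightarrow> b \<in> Hge2 \<Longrightarrow> DR_class a \<otimes>\<^bsub>Ef_alg\<^esub> DR_class b = DR_class (a \<star> b)"
    using rcoset_mult_add[of a b] by (simp add: Ef_alg_def quot_algebra_def FactRing_def)
  show "a \<in> Hge2 \<Longrightarrow> b \<in> Hge2 \<Longrightarrow> DR_class a \<oplus>\<^bsub>Ef_alg\<^esub> DR_class b = DR_class (a + b)"
    using a_rcos_sum[of a b] by (simp add: Ef_alg_def quot_algebra_def FactRing_def)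
  assume a: "a \<in> Hge2"
  have "(\<Union>x\<in>DR_class a. DR_class (qscale c x)) = DR_class (qscale c a)"
  proof (rule UN_DR_class[OF a])
    fix x assume "x - a \<in> DR"
    then show "qscale c x - qscale c a \<in> DR"
      using qs.subspace_scale[OF subspace_DR] by (metis qs.scale_right_diff_distrib)
  qed (simp add: Hge2_closed)
  then show "c \<odot>\<^bsub>Ef_alg\<^esub> DR_class a = DR_class (qscale c a)"
    by (simp add: Ef_alg_def quot_algebra_def)
qed

lemma cring_Ef_alg: "cring Ef_alg"
proof (rule cringI)
  show "abelian_group Ef_alg"
  proof (rule abelian_groupI)
    fix x assume "x \<in> carrier Ef_alg"
    then obtain a where "a \<in> Hge2" "x = DR_class a" by (auto simp: Ef_alg_simps)
    then show "\<exists>y\<in>carrier Ef_alg. y \<oplus>\<^bsub>Ef_alg\<^esub> x = \<zero>\<^bsub>Ef_alg\<^esub>"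
      by (intro bexI[of _ "DR_class (- a)"]) (auto simp: Ef_alg_simps Hge2_closed)
  qed (auto simp: Ef_alg_simps Hge2_closed algebra_simps)
  show "comm_monoid Ef_alg"
  proof (rule comm_monoidI)
    fix x y assume "x \<in> carrier Ef_alg" "y \<in> carrier Ef_alg"
    then obtain a b where "a \<in> Hge2" "x = DR_class a" "b \<in> Hge2" "y = DR_class b"
      by (auto simp: Ef_alg_simps)
    then show "x \<otimes>\<^bsub>Ef_alg\<^esub> y = y \<otimes>\<^bsub>Ef_alg\<^esub> x"
      by (simp add: Ef_alg_simps harmonic_comm[of a b])
  qed (auto simp: Ef_alg_simps Hge2_closed word_Nil_Hge2 harmonic_assoc)
qed (auto simp: Ef_alg_simps Hge2_closed)

lemma cring_rat_field: "cring rat_field"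
proof (rule cringI)
  show "abelian_group rat_field"
    by (rule abelian_groupI) (auto simp: rat_field_def intro: exI[of _ "- x" for x])
  show "comm_monoid rat_field"
    by (rule comm_monoidI) (auto simp: rat_field_def)
qed (auto simp: rat_field_def algebra_simps)

lemma algebra_Ef_alg: "algebra rat_field Ef_alg"
  by (rule algebraI[OF cring_rat_field cring_Ef_alg])
    (auto simp: Ef_alg_simps Hge2_closed rat_field_def qs.scale_left_distrib qs.scale_right_distrib)

lemma minus_Ef_alg:
  assumes "a \<in> Hge2" "b \<in> Hge2"
  shows "DR_class a \<ominus>\<^bsub>Ef_alg\<^esub> DR_class b = DR_class (a - b)"
    and "\<ominus>\<^bsub>Ef_alg\<^esub> DR_class b = DR_class (- b)"
proof -
  interpret cring Ef_alg by (rule cring_Ef_alg)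
  show inv: "\<ominus>\<^bsub>Ef_alg\<^esub> DR_class b = DR_class (- b)"
    by (rule minus_equality) (use assms in \<open>auto simp: Ef_alg_simps Hge2_closed\<close>)
  show "DR_class a \<ominus>\<^bsub>Ef_alg\<^esub> DR_class b = DR_class (a - b)"
    using assms by (simp add: a_minus_def inv Ef_alg_simps Hge2_closed)
qed

lemma double_Ef_alg:
  assumes "a \<in> Hge2"
  shows "[(2::nat)] \<cdot>\<^bsub>Ef_alg\<^esub> DR_class a = DR_class (qscale 2 a)"
proof -
  interpret cring Ef_alg by (rule cring_Ef_alg)
  have "qscale 2 a = a + a" by (metis one_add_one qs.scale_left_distrib qs.scale_one)
  then show ?thesis
    using assms by (simp add: numeral_2_eq_2 Ef_alg_simps Hge2_closed)
qed

section \<open>Operators induced on the quotient\<close>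

lemma descendsI_DR:
  assumes "\<And>p. p \<in> Hge2 \<Longrightarrow> f p = g p" "qlin g" "\<And>p. p \<in> Hge2 \<Longrightarrow> g p \<in> Hge2" "\<And>p. p \<in> DR \<Longrightarrow> g p \<in> DR"
  shows "descends Hge2_alg DR f"
  unfolding descends_def
proof (intro conjI ballI impI)
  show "f \<in> carrier Hge2_alg \<rightarrow> carrier Hge2_alg" using assms(1,3) by simp
  fix a b assume "a \<in> carrier Hge2_alg" "b \<in> carrier Hge2_alg" and ab: "a \<ominus>\<^bsub>Hge2_alg\<^esub> b \<in> DR"
  then have "a \<in> Hge2" "b \<in> Hge2" by simp_all
  then show "f a \<ominus>\<^bsub>Hge2_alg\<^esub> f b \<in> DR"
    using ab assms(4)[of "a - b"] by (simp add: minus_Hge2_alg assms(1,3) module_hom.diff[OF assms(2)])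
qed

lemma induced_DR_class:
  assumes "descends Hge2_alg DR f" "a \<in> Hge2"
  shows "induced Hge2_alg DR f (DR_class a) = DR_class (f a)"
  unfolding induced_def
proof (rule UN_DR_class[OF assms(2)])
  show f: "f x \<in> Hge2" if "x \<in> Hge2" for x using assms(1) that by (auto simp: descends_def)
  fix x assume "x \<in> Hge2" "x - a \<in> DR"
  then show "f x - f a \<in> DR"
    using assms unfolding descends_def by (simp add: minus_Hge2_alg f)
qed

text \<open>Linearity is required of \<open>g\<close> only, which agrees with \<open>f\<close> on
  \<open>Hge2\<close>: \<open>partial_op\<close> rests on a definite description and is handled
  through \<open>partial_explicit\<close>.\<close>

lemma induced_is_derivation:
  assumes f: "\<And>p. p \<in> Hge2 \<Longrightarrow> f p = g p" and g: "qlin g" "\<And>p. p \<in> Hge2 \<Longrightarrow> g p \<in> Hge2"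
    and D: "descends Hge2_alg DR f"
    and der: "\<And>p q. p \<in> Hge2 \<Longrightarrow> q \<in> Hge2 \<Longrightarrow> g (p \<star> q) - (g p \<star> q + p \<star> g q) \<in> DR"
  shows "is_derivation rat_field Ef_alg (induced Hge2_alg DR f)"
proof -
  have i: "induced Hge2_alg DR f (DR_class a) = DR_class (g a)" if "a \<in> Hge2" for a
    using induced_DR_class[OF D that] f[OF that] by simp
  show ?thesis
    unfolding is_derivation_def
    by (auto simp: Ef_alg_simps i Hge2_closed g module_hom.add[OF g(1)] module_hom.scale[OF g(1)] DR_class_eq_iff der)
qed

theorem theorem5p2:
  shows "ideal DR Hge2_alg \<and>
    descends Hge2_alg DR W_op \<and> descends Hge2_alg DR partial_op \<and> descends Hge2_alg DR delta_op \<and>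
    sl2_algebra rat_field Ef_alg
      (induced Hge2_alg DR W_op) (induced Hge2_alg DR partial_op) (induced Hge2_alg DR delta_op)"
proof -
  have DW: "descends Hge2_alg DR W_op"
    by (rule descendsI_DR[OF refl W_op_linear W_op_Hge2 W_op_DR])
  have DP: "descends Hge2_alg DR partial_op"
    by (rule descendsI_DR[OF partial_op_eq partial_explicit_linear partial_explicit_Hge2 partial_DR])
  have DD: "descends Hge2_alg DR delta_op"
    by (rule descendsI_DR[OF refl delta_op_linear delta_op_Hge2 delta_op_DR])
  have R_DR: "R_op p q \<in> DR" if "p \<in> Hge2" "q \<in> Hge2" for p q
    using span_DR_core_mult[OF qs.span_base[OF R_op_in_DR_core[OF that]] word_Nil_Hge2] by simp
  have "is_derivation rat_field Ef_alg (induced Hge2_alg DR W_op)"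
    by (rule induced_is_derivation[OF refl W_op_linear W_op_Hge2 DW])
      (simp_all add: W_op_harmonic qs.subspace_0[OF subspace_DR])
  moreover have "is_derivation rat_field Ef_alg (induced Hge2_alg DR partial_op)"
    by (rule induced_is_derivation[OF partial_op_eq partial_explicit_linear partial_explicit_Hge2 DP])
      (simp_all add: partial_harmonic R_DR qs.subspace_neg[OF subspace_DR])
  moreover have "is_derivation rat_field Ef_alg (induced Hge2_alg DR delta_op)"
    by (rule induced_is_derivation[OF refl delta_op_linear delta_op_Hge2 DD])
      (simp_all add: delta_op_harmonic qs.subspace_0[OF subspace_DR])
  moreover have "commutator Ef_alg (induced Hge2_alg DR W_op) (induced Hge2_alg DR partial_op) x
        = [(2::nat)] \<cdot>\<^bsub>Ef_alg\<^esub> induced Hge2_alg DR partial_op x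
      \<and> commutator Ef_alg (induced Hge2_alg DR W_op) (induced Hge2_alg DR delta_op) x
        = \<ominus>\<^bsub>Ef_alg\<^esub> ([(2::nat)] \<cdot>\<^bsub>Ef_alg\<^esub> induced Hge2_alg DR delta_op x)
      \<and> commutator Ef_alg (induced Hge2_alg DR delta_op) (induced Hge2_alg DR partial_op) x
        = induced Hge2_alg DR W_op x"
    if x: "x \<in> carrier Ef_alg" for x
  proof -
    obtain a where "a \<in> Hge2" "x = DR_class a" using x by (auto simp: Ef_alg_simps)
    then show ?thesis
      by (simp add: commutator_def induced_DR_class DW DP DD Hge2_closed partial_op_eq minus_Ef_alg double_Ef_alg
          W_op_partial W_op_delta delta_op_partial)
  qed
  ultimately show ?thesis
    unfolding sl2_algebra_def sl2_triple_def using ideal_DR DW DP DD algebra_Ef_alg by blast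
qed

end
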